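(* Let $\mathfrak a,\mathfrak b,\mathfrak c$ be positive integers and $0\le \mathfrak d<\mathfrak c$ with $\gcd(\mathfrak c,\mathfrak d)=1$. The birational operators $s_\ell$ ($1\le \ell\le \mathfrak a-1$) and $\pi$ generate an action of the extended affine symmetric group $W=(\mathbb Z/\mathfrak a\mathfrak c\,\mathbb Z)\ltimes\widehat{\mathfrak S}_{\mathfrak a}$ on $\mathcal M=\mathbb C^{\mathfrak a\mathfrak b\mathfrak c}$, where $\widehat{\mathfrak S}_{\mathfrak a}$ is the Coxeter group of type $\tilde A_{\mathfrak a-1}$. Similarly, the operators $\tilde s_\ell$ ($1\le\ell\le\mathfrak b-1$) and $\tilde\pi$ generate an action of $\tilde W=(\mathbb Z/\mathfrak b\mathfrak c\,\mathbb Z)\ltimes\widehat{\mathfrak S}_{\mathfrak b}$ on $\mathcal M$. Furthermore these two actions commute. Precisely, the following relations hold on $\mathcal M$ (as identities of birational maps), where the index of $s_\ell$ is taken modulo $\mathfrak a$ and $s_0$ is defined by $\pi s_1=s_0\pi$, and the index of $\tilde s_\ell$ is taken modulo $\mathfrak b$ and $\tilde s_0$ is defined by $\tilde\pi\tilde s_1=\tilde s_0\tilde\pi$: (1) $s_\ell s_{\ell+1}s_\ell=s_{\ell+1}s_\ell s_{\ell+1}$ (for $\mathfrak a\ge 3$); $s_js_\ell=s_\ell s_j$ if $j,\ell$ are distinct and not adjacent modulo $\mathfrak a$; $s_\ell^2=1$; $\pi s_{\ell+1}=s_\ell\pi$; $\pi^{\mathfrak a\mathfrak c}=1$. (2) $\tilde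 s_\ell\tilde s_{\ell+1}\tilde s_\ell=\tilde s_{\ell+1}\tilde s_\ell\tilde s_{\ell+1}$ (for $\mathfrak b\ge3$); $\tilde s_j\tilde s_\ell=\tilde s_\ell\tilde s_j$ if $j,\ell$ are distinct and not adjacent modulo $\mathfrak b$; $\tilde s_\ell^2=1$; $\tilde\pi\tilde s_{\ell+1}=\tilde s_\ell\tilde\pi$; $\tilde\pi^{\mathfrak b\mathfrak c}=1$. (3) $s_j\tilde s_\ell=\tilde s_\ell s_j$, $\tilde\pi s_\ell=s_\ell\tilde\pi$, $\pi\tilde s_\ell=\tilde s_\ell\pi$, $\tilde\pi\pi=\pi\tilde\pi$.
   Context: Notation: $[a]=\{1,\dots,a\}$. Geometric $R$-matrix. For $\mathbf a=(a_1,\dots,a_n)$ put $\mathbf a^{(i)}=(a_{i+1},\dots,a_n,a_1,\dots,a_i)$ (indices cyclic mod $n$). For two vectors $\mathbf a,\mathbf b$ of length $n$ let $E(\mathbf a,\mathbf b)=\sum_{i=0}^{n-1}\left(\prod_{j=1}^{i}b_j\prod_{j=i+2}^{n}a_j\right)$. Define the birational map $R(\mathbf a,\mathbf b)=(\mathbf b',\mathbf a')$ by $b_i'=b_i\,\frac{E(\mathbf a^{(i)},\mathbf b^{(i)})}{E(\mathbf a^{(i-1)},\mathbf b^{(i-1)})}$, $\ a_i'=a_i\,\frac{E(\mathbf a^{(i-1)},\mathbf b^{(i-1)})}{E(\mathbf a^{(i)},\mathbf b^{(i)})}$. Operators on arrays. For an array $A$ with $r$ rows and $s$ columns, $a_{i,j}$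 denotes the entry in the $i$-th column and $j$-th row, and $\mathbf a_i=(a_{i,j})_{j\in[r]}$ the $i$-th column. For $1\le\ell\le s-1$, the first operation replaces the pair of columns $(\mathbf a_\ell,\mathbf a_{\ell+1})$, in positions $\ell,\ell+1$, by the pair $R(\mathbf a_\ell,\mathbf a_{\ell+1})$ (in the same positions), leaving the other columns fixed. The second operation is the cyclic shift sending $A$ to the array with $(i,j)$ entry $a_{i,j-1}$ (row index mod $r$). Phase space. $\mathcal M=\mathbb C^{\mathfrak a\mathfrak b\mathfrak c}$ with coordinates $q_{a,b,c}$, $a\in[\mathfrak a],b\in[\mathfrak b],c\in[\mathfrak c]$. ($\mathfrak d=0$ is allowed only if $\mathfrak c=1$.) Let $\mathfrak d^{-1}$ be the number with $0\le\mathfrak d^{-1}<\mathfrak c$ and $\mathfrak d\mathfrak d^{-1}\equiv1\bmod\mathfrak c$. Arrange the coordinates in two arrays: $Q=(q_{i,j})$ with $\mathfrak a$ columns and $\mathfrak b\mathfrak c$ rows, $q_{i,j}=q_{a,b,c}$ for $i=a$, $j=b+\mathfrak b(c-1)$; $\tilde Q=(\tilde q_{i,j})$ with $\mathfrak b$ columns and $\mathfrak a\mathfrak c$ rows, $\tilde q_{i,j}=q_{a,b,c}$ for $i=\mathfrak b+1-b$, $j\equiv\mathfrak a\mathfrak d^{-1}c-a+1\bmod\mathfrak a\mathfrak c$. The first operation applied to $Q$ gives $s_1,\dots,s_{\mathfrak a-1}$ and the cyclic shift of $Q$ gives $\tilde\pi$. The first operation applied to $\tilde Q$ gives $\tilde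 s_1,\dots,\tilde s_{\mathfrak b-1}$ and the cyclic shift of $\tilde Q$ gives $\pi$. All are regarded as birational self-maps of $\mathcal M$. *)

theory Defs
  imports Complex_Main "HOL-Library.FuncSet" "HOL-Number_Theory.Cong" "HOL-Algebra.Algebra"
begin

section \<open>Birational self-maps of complex affine space\<close>

text \<open>The affine space \<open>\<complex>\<^sup>I\<close> over an index set \<open>I\<close>, with its polynomial functions.\<close>

definition affine_space :: "'i set \<Rightarrow> ('i \<Rightarrow> complex) set" where
  "affine_space I = (I \<rightarrow>\<^sub>E UNIV)"

inductive_set poly_functions :: "'i set \<Rightarrow> (('i \<Rightarrow> complex) \<Rightarrow> complex) set" for I where
  const: "(\<lambda>x. k) \<in> poly_functions I"
| coord: "i \<in> I \<Longrightarrow> (\<lambda>x. x i) \<in> poly_functions I"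
| add: "\<lbrakk>p \<in> poly_functions I; q \<in> poly_functions I\<rbrakk> \<Longrightarrow> (\<lambda>x. p x + q x) \<in> poly_functions I"
| mult: "\<lbrakk>p \<in> poly_functions I; q \<in> poly_functions I\<rbrakk> \<Longrightarrow> (\<lambda>x. p x * q x) \<in> poly_functions I"

definition zariski_open :: "'i set \<Rightarrow> ('i \<Rightarrow> complex) set \<Rightarrow> bool" where
  "zariski_open I U \<longleftrightarrow>
     (\<exists>P \<subseteq> poly_functions I. U = {x \<in> affine_space I. \<exists>p\<in>P. p x \<noteq> 0})"

definition regular_function ::
  "'i set \<Rightarrow> ('i \<Rightarrow> complex) set \<Rightarrow> (('i \<Rightarrow> complex) \<Rightarrow> complex) \<Rightarrow> bool" where
  "regular_function I U f \<longleftrightarrow>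
     (\<forall>x\<in>U. \<exists>V. zariski_open I V \<and> x \<in> V \<and> V \<subseteq> U \<and>
        (\<exists>p\<in>poly_functions I. \<exists>q\<in>poly_functions I. \<forall>y\<in>V. q y \<noteq> 0 \<and> f y = p y / q y))"

text \<open>A rational self-map is an equivalence class of regular maps defined on nonempty Zariski open
  subsets; two such maps are equivalent if they agree on a nonempty Zariski open set.  The
  representatives are partial functions, the domain being the open set.\<close>

type_synonym 'i partial_map = "('i \<Rightarrow> complex) \<rightharpoonup> ('i \<Rightarrow> complex)"

definition rational_reps :: "'i set \<Rightarrow> 'i partial_map set" where
  "rational_reps I = {f. zariski_open I (dom f) \<and> dom f \<noteq> {} \<and> ran f \<subseteq> affine_space I \<and>
     (\<forall>i\<in>I. regular_function I (dom f) (\<lambda>x. the (f x) i))}"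

definition generically_equal :: "'i set \<Rightarrow> 'i partial_map \<Rightarrow> 'i partial_map \<Rightarrow> bool" where
  "generically_equal I f g \<longleftrightarrow>
     (\<exists>U. zariski_open I U \<and> U \<noteq> {} \<and> U \<subseteq> dom f \<inter> dom g \<and> (\<forall>x\<in>U. f x = g x))"

definition rational_class :: "'i set \<Rightarrow> 'i partial_map \<Rightarrow> 'i partial_map set" where
  "rational_class I f = {g \<in> rational_reps I. generically_equal I f g}"

definition dominant :: "'i set \<Rightarrow> 'i partial_map \<Rightarrow> bool" where
  "dominant I f \<longleftrightarrow> (\<forall>V. zariski_open I V \<and> V \<noteq> {} \<longrightarrow> ran f \<inter> V \<noteq> {})"

definition dominant_monoid :: "'i set \<Rightarrow> 'i partial_map set monoid" where
  "dominant_monoid I =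
     \<lparr>carrier = {rational_class I f |f. f \<in> rational_reps I \<and> dominant I f},
      monoid.mult = (\<lambda>F G. {h \<in> rational_reps I. \<exists>f\<in>F. \<exists>g\<in>G. generically_equal I (f \<circ>\<^sub>m g) h}),
      one = rational_class I (Some |` affine_space I)\<rparr>"

definition Bir :: "'i set \<Rightarrow> 'i partial_map set monoid" where
  "Bir I = units_of (dominant_monoid I)"


section \<open>The extended affine symmetric group\<close>

text \<open>The Coxeter group with generators \<open>S\<close> and Coxeter matrix \<open>m\<close>, where the entry 0 stands for
  infinity, i.e. for the absence of a relation.  Since the generators are involutions
  (\<open>m i i = 1\<close>), it is the monoid of words in \<open>S\<close> modulo the relations \<open>(ij)\<^bsup>m i j\<^esup> = 1\<close>.\<close>

inductive coxeter_eq :: "'g set \<Rightarrow> ('g \<Rightarrow> 'g \<Rightarrow> nat) \<Rightarrow> 'g list \<Rightarrow> 'g list \<Rightarrow> bool" for S m where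
  refl: "w \<in> lists S \<Longrightarrow> coxeter_eq S m w w"
| sym: "coxeter_eq S m v w \<Longrightarrow> coxeter_eq S m w v"
| trans: "\<lbrakk>coxeter_eq S m u v; coxeter_eq S m v w\<rbrakk> \<Longrightarrow> coxeter_eq S m u w"
| rel: "\<lbrakk>u \<in> lists S; v \<in> lists S; i \<in> S; j \<in> S; m i j \<noteq> 0\<rbrakk> \<Longrightarrow>
    coxeter_eq S m (u @ concat (replicate (m i j) [i, j]) @ v) (u @ v)"

definition coxeter_class :: "'g set \<Rightarrow> ('g \<Rightarrow> 'g \<Rightarrow> nat) \<Rightarrow> 'g list \<Rightarrow> 'g list set" where
  "coxeter_class S m w = {v. coxeter_eq S m w v}"

definition coxeter_group :: "'g set \<Rightarrow> ('g \<Rightarrow> 'g \<Rightarrow> nat) \<Rightarrow> 'g list set monoid" where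
  "coxeter_group S m =
     \<lparr>carrier = coxeter_class S m ` lists S,
      monoid.mult = (\<lambda>A B. {w. \<exists>u\<in>A. \<exists>v\<in>B. coxeter_eq S m (u @ v) w}),
      one = coxeter_class S m []\<rparr>"

text \<open>Type \<open>A~\<^sub>a\<^sub>-\<^sub>1\<close>: the Dynkin diagram is a cycle on \<open>\<int>/a\<close> for \<open>a \<ge> 3\<close>, two vertices joined by an
  edge labelled infinity for \<open>a = 2\<close>, and empty (so that the group is trivial) for \<open>a = 1\<close>.\<close>

definition affine_A_nodes :: "nat \<Rightarrow> nat set" where
  "affine_A_nodes a = (if a = 1 then {} else {0..<a})"

definition cyc_adjacent :: "nat \<Rightarrow> nat \<Rightarrow> nat \<Rightarrow> bool" where
  "cyc_adjacent a i j \<longleftrightarrow> [i + 1 = j] (mod a) \<or> [j + 1 = i] (mod a)"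

definition affine_A_matrix :: "nat \<Rightarrow> nat \<Rightarrow> nat \<Rightarrow> nat" where
  "affine_A_matrix a i j =
     (if i = j then 1 else if cyc_adjacent a i j then (if a = 2 then 0 else 3) else 2)"

definition affine_sym_group :: "nat \<Rightarrow> nat list set monoid" where
  "affine_sym_group a = coxeter_group (affine_A_nodes a) (affine_A_matrix a)"

definition semidirect ::
  "('k, 'x) monoid_scheme \<Rightarrow> ('k \<Rightarrow> 'n \<Rightarrow> 'n) \<Rightarrow> ('n, 'y) monoid_scheme \<Rightarrow> ('k \<times> 'n) monoid" where
  "semidirect K \<theta> N =
     \<lparr>carrier = carrier K \<times> carrier N,
      monoid.mult = (\<lambda>(k, x) (k', x'). (k \<otimes>\<^bsub>K\<^esub> k', x \<otimes>\<^bsub>N\<^esub> \<theta> k x')),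
      one = (\<one>\<^bsub>K\<^esub>, \<one>\<^bsub>N\<^esub>)\<rparr>"

text \<open>The generator of \<open>\<int>/N\<close> acts on the affine symmetric group by \<open>s\<^sub>l\<^sub>+\<^sub>1 \<mapsto> s\<^sub>l\<close> (well defined for
  \<open>a\<close> dividing \<open>N\<close>), so that \<open>\<pi> s\<^sub>l\<^sub>+\<^sub>1 = s\<^sub>l \<pi>\<close>.  Elements of \<open>affine_sym_group a\<close> are sets of words.\<close>

definition diagram_rotation :: "nat \<Rightarrow> int \<Rightarrow> nat list set \<Rightarrow> nat list set" where
  "diagram_rotation a k A = map (\<lambda>l. nat ((int l - k) mod int a)) ` A"

definition ext_affine_sym_group :: "nat \<Rightarrow> nat \<Rightarrow> (int \<times> nat list set) monoid" where
  "ext_affine_sym_group N a =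
     semidirect (integer_mod_group N) (diagram_rotation a) (affine_sym_group a)"

definition W_s :: "nat \<Rightarrow> nat \<Rightarrow> nat \<Rightarrow> int \<times> nat list set" where
  "W_s N a l = (0, coxeter_class (affine_A_nodes a) (affine_A_matrix a) [l])"

definition W_pi :: "nat \<Rightarrow> nat \<Rightarrow> int \<times> nat list set" where
  "W_pi N a = (1 mod int N, \<one>\<^bsub>affine_sym_group a\<^esub>)"


section \<open>The geometric R-matrix\<close>

text \<open>Vectors of length \<open>n\<close> are functions on \<open>{1..n}\<close>; \<open>cyc n k\<close> is the representative in \<open>{1..n}\<close> of
  \<open>k\<close> modulo \<open>n\<close>.\<close>

definition cyc :: "nat \<Rightarrow> int \<Rightarrow> nat" where
  "cyc n k = nat ((k - 1) mod int n) + 1"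

definition rot :: "nat \<Rightarrow> nat \<Rightarrow> (nat \<Rightarrow> complex) \<Rightarrow> nat \<Rightarrow> complex" where
  "rot n i x = (\<lambda>j. x (cyc n (int i + int j)))"

definition E :: "nat \<Rightarrow> (nat \<Rightarrow> complex) \<Rightarrow> (nat \<Rightarrow> complex) \<Rightarrow> complex" where
  "E n x y = (\<Sum>i<n. (\<Prod>j=1..i. y j) * (\<Prod>j=i+2..n. x j))"

definition E_rot :: "nat \<Rightarrow> (nat \<Rightarrow> complex) \<Rightarrow> (nat \<Rightarrow> complex) \<Rightarrow> nat \<Rightarrow> complex" where
  "E_rot n x y i = E n (rot n i x) (rot n i y)"

definition R_matrix ::
  "nat \<Rightarrow> (nat \<Rightarrow> complex) \<times> (nat \<Rightarrow> complex) \<Rightarrow> (nat \<Rightarrow> complex) \<times> (nat \<Rightarrow> complex)" where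
  "R_matrix n = (\<lambda>(x, y).
     (\<lambda>i. y i * (E_rot n x y i / E_rot n x y (i - 1)),
      \<lambda>i. x i * (E_rot n x y (i - 1) / E_rot n x y i)))"


section \<open>Operators on arrays and on the phase space\<close>

text \<open>Following the convention for \<open>a\<^sub>i\<^sub>,\<^sub>j\<close>, the entry of \<open>A\<close> in column \<open>i\<close> and row \<open>j\<close> is \<open>A i j\<close>, so
  \<open>A i\<close> is the \<open>i\<close>-th column.  The number of rows is \<open>r\<close>.\<close>

type_synonym array = "nat \<Rightarrow> nat \<Rightarrow> complex"

definition R_columns :: "nat \<Rightarrow> nat \<Rightarrow> array \<Rightarrow> array" where
  "R_columns r l A =
     A(l := fst (R_matrix r (A l, A (l + 1))), l + 1 := snd (R_matrix r (A l, A (l + 1))))"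

definition shift_rows :: "nat \<Rightarrow> array \<Rightarrow> array" where
  "shift_rows r A = (\<lambda>i j. A i (cyc r (int j - 1)))"

text \<open>An arrangement of the coordinates in an array is an injective map \<open>\<phi>\<close> from the index set to
  positions (column, row).\<close>

definition to_array :: "'i set \<Rightarrow> ('i \<Rightarrow> nat \<times> nat) \<Rightarrow> ('i \<Rightarrow> complex) \<Rightarrow> array" where
  "to_array I \<phi> q = (\<lambda>i j. q (inv_into I \<phi> (i, j)))"

definition of_array :: "'i set \<Rightarrow> ('i \<Rightarrow> nat \<times> nat) \<Rightarrow> array \<Rightarrow> 'i \<Rightarrow> complex" where
  "of_array I \<phi> A = (\<lambda>t\<in>I. A (fst (\<phi> t)) (snd (\<phi> t)))"

text \<open>The domain is where no denominator of the R-matrix vanishes.\<close>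

definition R_map :: "'i set \<Rightarrow> ('i \<Rightarrow> nat \<times> nat) \<Rightarrow> nat \<Rightarrow> nat \<Rightarrow> 'i partial_map" where
  "R_map I \<phi> r l = (\<lambda>q. let A = to_array I \<phi> q in
     if q \<in> affine_space I \<and> (\<forall>i\<in>{0..r}. E_rot r (A l) (A (l + 1)) i \<noteq> 0)
     then Some (of_array I \<phi> (R_columns r l A)) else None)"

definition shift_map :: "'i set \<Rightarrow> ('i \<Rightarrow> nat \<times> nat) \<Rightarrow> nat \<Rightarrow> 'i partial_map" where
  "shift_map I \<phi> r = (\<lambda>q.
     if q \<in> affine_space I then Some (of_array I \<phi> (shift_rows r (to_array I \<phi> q))) else None)"

type_synonym index = "nat \<times> nat \<times> nat"

definition indices :: "nat \<Rightarrow> nat \<Rightarrow> nat \<Rightarrow> index set" where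
  "indices \<aa> \<bb> \<cc> = {1..\<aa>} \<times> {1..\<bb>} \<times> {1..\<cc>}"

definition mod_inverse :: "nat \<Rightarrow> nat \<Rightarrow> nat" where
  "mod_inverse \<cc> \<dd> = (THE e. e < \<cc> \<and> [\<dd> * e = 1] (mod \<cc>))"

definition Q_pos :: "nat \<Rightarrow> index \<Rightarrow> nat \<times> nat" where
  "Q_pos \<bb> = (\<lambda>(a, b, c). (a, b + \<bb> * (c - 1)))"

definition Qt_pos :: "nat \<Rightarrow> nat \<Rightarrow> nat \<Rightarrow> nat \<Rightarrow> index \<Rightarrow> nat \<times> nat" where
  "Qt_pos \<aa> \<bb> \<cc> \<dd> = (\<lambda>(a, b, c).
     (\<bb> + 1 - b, cyc (\<aa> * \<cc>) (int (\<aa> * mod_inverse \<cc> \<dd> * c) - int a + 1)))"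

definition op_s :: "nat \<Rightarrow> nat \<Rightarrow> nat \<Rightarrow> nat \<Rightarrow> index partial_map set" where
  "op_s \<aa> \<bb> \<cc> l =
     rational_class (indices \<aa> \<bb> \<cc>) (R_map (indices \<aa> \<bb> \<cc>) (Q_pos \<bb>) (\<bb> * \<cc>) l)"

definition op_pit :: "nat \<Rightarrow> nat \<Rightarrow> nat \<Rightarrow> index partial_map set" where
  "op_pit \<aa> \<bb> \<cc> =
     rational_class (indices \<aa> \<bb> \<cc>) (shift_map (indices \<aa> \<bb> \<cc>) (Q_pos \<bb>) (\<bb> * \<cc>))"

definition op_st :: "nat \<Rightarrow> nat \<Rightarrow> nat \<Rightarrow> nat \<Rightarrow> nat \<Rightarrow> index partial_map set" where
  "op_st \<aa> \<bb> \<cc> \<dd> l =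
     rational_class (indices \<aa> \<bb> \<cc>) (R_map (indices \<aa> \<bb> \<cc>) (Qt_pos \<aa> \<bb> \<cc> \<dd>) (\<aa> * \<cc>) l)"

definition op_pi :: "nat \<Rightarrow> nat \<Rightarrow> nat \<Rightarrow> nat \<Rightarrow> index partial_map set" where
  "op_pi \<aa> \<bb> \<cc> \<dd> =
     rational_class (indices \<aa> \<bb> \<cc>) (shift_map (indices \<aa> \<bb> \<cc>) (Qt_pos \<aa> \<bb> \<cc> \<dd>) (\<aa> * \<cc>))"

text \<open>Extension of a family \<open>s\<^sub>1, \<dots>, s\<^sub>a\<^sub>-\<^sub>1\<close> to indices modulo \<open>a\<close>, with \<open>s\<^sub>0\<close> determined by
  \<open>p s\<^sub>1 = s\<^sub>0 p\<close>.  For \<open>a = 1\<close> there is no \<open>s\<^sub>1\<close> and the value is meaningless.\<close>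

definition cyclic_family :: "('x, 'y) monoid_scheme \<Rightarrow> nat \<Rightarrow> (nat \<Rightarrow> 'x) \<Rightarrow> 'x \<Rightarrow> nat \<Rightarrow> 'x" where
  "cyclic_family G a s p l =
     (if l mod a = 0 then p \<otimes>\<^bsub>G\<^esub> s 1 \<otimes>\<^bsub>G\<^esub> inv\<^bsub>G\<^esub> p else s (l mod a))"

end

theory Submission
  imports Defs "HOL-Computational_Algebra.Polynomial"
begin

text \<open>Points with positive coordinates are Zariski dense, and all operators are subtraction-free, so they
  act on these points and every relation needs to be checked only there.  The array \<open>Q\<close> lifts to a
  function on \<open>\<int>\<times>\<int>\<close> that is periodic under a lattice of index \<open>abc\<close>; the array \<open>Q~\<close> is the same function
  with rows and columns exchanged, and \<open>\<pi>\<close>, \<open>\<pi>~\<close> are the two unit translations.  Hence the rotation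
  relations are immediate, and \<open>s\<^sub>0\<close> is an operator of the same kind as the other \<open>s\<^sub>l\<close>.

  The weights \<open>e\<^sub>i = E(a\<^sup>(\<^sup>i\<^sup>), b\<^sup>(\<^sup>i\<^sup>))\<close> satisfy \<open>b\<^sub>i e\<^sub>i - a\<^sub>i e\<^sub>i\<^sub>-\<^sub>1 = const\<close>, and up to a scalar they are the only
  periodic solution, whereas \<open>R\<close> depends only on their ratios.  This gives \<open>R\<^sup>2 = 1\<close>, and it gives the
  commutation of row and column operators: a solution for the moved array arises from the old one by
  changing it inside the \<open>2\<times>2\<close> blocks where the two operators meet, by the tetrahedron equation.
  The braid relation follows from uniqueness of the factorization of a product of Lax operators
  \<open>v \<mapsto> (x\<^sub>i v\<^sub>i + v\<^sub>i\<^sub>-\<^sub>1)\<close> with prescribed, distinct products \<open>\<Prod>x\<^sub>i\<close>.\<close>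

section \<open>Polynomial functions and the Zariski topology\<close>

text \<open>Away from the positive points the operators are only partially defined; on them each is
  a total bijection, so a relation in \<open>Bir I\<close> becomes an equation between functions on
  \<open>torus_fun m n h\<close>. The periods of the lift of \<open>Q\<close> are spanned by (0, bc)
  and (a, bd), those of \<open>Q~\<close>, with the axes exchanged, by (ac, 0) and (ae, b), where e
  is the inverse of d modulo c. The two lattices agree because de = 1 modulo c, which explains the
  factor e in the definition of \<open>Q~\<close>. The obstacle to commutation is that a weight
  depends on two entire columns, so it is not evident that a row operator disturbs it only nearby.
  The linear recurrence makes the problem local: candidates for the new weights are written down
  block by block, and uniqueness of the periodic solution identifies them with the true ones up to a
  scalar. In the braid relation \<open>R\<close> interchanges the products of its two columns, so
  both sides carry the three products in reversed order, and the products tell the factors apart.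
  This fails when two products coincide; but then some application of \<open>R\<close> is the
  identity.\<close>

lemma poly_functions_prod:
  assumes "finite A" "\<And>k. k \<in> A \<Longrightarrow> p k \<in> poly_functions I"
  shows "(\<lambda>x. \<Prod>k\<in>A. p k x) \<in> poly_functions I"
  using assms by (induction A rule: finite_induct) (simp_all add: poly_functions.const poly_functions.mult)

lemma poly_functions_sum:
  assumes "finite A" "\<And>k. k \<in> A \<Longrightarrow> p k \<in> poly_functions I"
  shows "(\<lambda>x. \<Sum>k\<in>A. p k x) \<in> poly_functions I"
  using assms by (induction A rule: finite_induct) (simp_all add: poly_functions.const poly_functions.add)

lemma poly_functions_diff:
  assumes "p \<in> poly_functions I" "q \<in> poly_functions I"
  shows "(\<lambda>x. p x - q x) \<in> poly_functions I"
proof -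
  have "(\<lambda>x. p x + (-1) * q x) \<in> poly_functions I"
    by (rule poly_functions.add[OF assms(1) poly_functions.mult[OF poly_functions.const assms(2)]])
  then show ?thesis by simp
qed

text \<open>On a line, vanishing is governed by the finitely many roots of one univariate
  polynomial. Both density arguments, for open sets and for positive points, move along such
  lines.\<close>

lemma poly_functions_line:
  assumes "p \<in> poly_functions I"
  shows "\<exists>P. \<forall>t. p (\<lambda>i. x i + t * y i) = poly P t"
  using assms
proof induction
  case (const k)
  show ?case by (intro exI[of _ "[:k:]"]) simp
next
  case (coord i)
  show ?case by (intro exI[of _ "[:x i, y i:]"]) simp
next
  case (add p q)
  then obtain P Q where "\<forall>t. p (\<lambda>i. x i + t * y i) = poly P t" "\<forall>t. q (\<lambda>i. x i + t * y i) = poly Q t"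
    by blast
  then show ?case by (intro exI[of _ "P + Q"]) simp
next
  case (mult p q)
  then obtain P Q where "\<forall>t. p (\<lambda>i. x i + t * y i) = poly P t" "\<forall>t. q (\<lambda>i. x i + t * y i) = poly Q t"
    by blast
  then show ?case by (intro exI[of _ "P * Q"]) simp
qed

text \<open>Principal open sets form a basis: the possibly infinite family \<open>P\<close> of the
  definition is traded for one polynomial at each point, the form used from here on.\<close>

lemma zariski_open_iff:
  "zariski_open I U \<longleftrightarrow> U \<subseteq> affine_space I \<and>
     (\<forall>x\<in>U. \<exists>p\<in>poly_functions I. p x \<noteq> 0 \<and> (\<forall>y\<in>affine_space I. p y \<noteq> 0 \<longrightarrow> y \<in> U))"
    (is "?L \<longleftrightarrow> ?R")
proof
  assume ?L
  then obtain P where P: "P \<subseteq> poly_functions I" "U = {x \<in> affine_space I. \<exists>p\<in>P. p x \<noteq> 0}"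
    by (auto simp: zariski_open_def)
  then show ?R by blast
next
  assume R: ?R
  \<comment> \<open>The largest possible family: all polynomial functions that vanish outside
    \<open>U\<close>.\<close>
  let ?P = "{p \<in> poly_functions I. \<forall>y\<in>affine_space I. p y \<noteq> 0 \<longrightarrow> y \<in> U}"
  have "U = {x \<in> affine_space I. \<exists>p\<in>?P. p x \<noteq> 0}"
  proof (intro equalityI subsetI)
    fix x assume x: "x \<in> U"
    then obtain p where "p \<in> poly_functions I" "p x \<noteq> 0" "\<forall>y\<in>affine_space I. p y \<noteq> 0 \<longrightarrow> y \<in> U"
      using R by meson
    then have "p \<in> ?P" "p x \<noteq> 0" by simp_all
    moreover have "x \<in> affine_space I" using R x by (meson subsetD)
    ultimately show "x \<in> {x \<in> affine_space I. \<exists>p\<in>?P. p x \<noteq> 0}" by (metis (mono_tags, lifting) mem_Collect_eq)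
  next
    fix x assume "x \<in> {x \<in> affine_space I. \<exists>p\<in>?P. p x \<noteq> 0}"
    then show "x \<in> U" by (elim CollectE conjE bexE) simp
  qed
  then show ?L unfolding zariski_open_def by (intro exI[of _ ?P] conjI) auto
qed

lemma zariski_openE:
  assumes "zariski_open I U" "x \<in> U"
  obtains p where "p \<in> poly_functions I" "p x \<noteq> 0" "\<forall>y\<in>affine_space I. p y \<noteq> 0 \<longrightarrow> y \<in> U"
  using assms unfolding zariski_open_iff by meson

lemma zariski_open_nonvanishing:
  assumes "p \<in> poly_functions I"
  shows "zariski_open I {x \<in> affine_space I. p x \<noteq> 0}"
  unfolding zariski_open_def using assms by (intro exI[of _ "{p}"]) simp

lemma zariski_open_affine: "zariski_open I (affine_space I)"
  unfolding zariski_open_iff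
  by (intro conjI subset_refl ballI bexI[of _ "\<lambda>x. 1"] poly_functions.const) simp_all

lemma zariski_open_Int:
  assumes "zariski_open I U" "zariski_open I V"
  shows "zariski_open I (U \<inter> V)"
  unfolding zariski_open_iff
proof (intro conjI ballI)
  show "U \<inter> V \<subseteq> affine_space I" using assms by (auto simp: zariski_open_iff)
  fix x assume "x \<in> U \<inter> V"
  then have "x \<in> U" "x \<in> V" by auto
  obtain p where "p \<in> poly_functions I" "p x \<noteq> 0" "\<forall>y\<in>affine_space I. p y \<noteq> 0 \<longrightarrow> y \<in> U"
    using zariski_openE[OF assms(1) \<open>x \<in> U\<close>] .
  moreover obtain q where "q \<in> poly_functions I" "q x \<noteq> 0" "\<forall>y\<in>affine_space I. q y \<noteq> 0 \<longrightarrow> y \<in> V"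
    using zariski_openE[OF assms(2) \<open>x \<in> V\<close>] .
  ultimately show "\<exists>r\<in>poly_functions I. r x \<noteq> 0 \<and> (\<forall>y\<in>affine_space I. r y \<noteq> 0 \<longrightarrow> y \<in> U \<inter> V)"
    by (intro bexI[of _ "\<lambda>x. p x * q x"] conjI) (simp_all add: poly_functions.mult)
qed

text \<open>Two polynomial functions restricted to the line through \<open>x\<close> and \<open>y\<close> are univariate, so each has
  only finitely many zeros there.\<close>

lemma zariski_open_Int_nonempty:
  assumes "zariski_open I U" "zariski_open I V" "U \<noteq> {}" "V \<noteq> {}"
  shows "U \<inter> V \<noteq> {}"
proof -
  obtain x y where x: "x \<in> U" and y: "y \<in> V" using assms by auto
  obtain p where p: "p \<in> poly_functions I" "p x \<noteq> 0" "\<forall>y\<in>affine_space I. p y \<noteq> 0 \<longrightarrow> y \<in> U"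
    using zariski_openE[OF assms(1) x] .
  obtain q where q: "q \<in> poly_functions I" "q y \<noteq> 0" "\<forall>y\<in>affine_space I. q y \<noteq> 0 \<longrightarrow> y \<in> V"
    using zariski_openE[OF assms(2) y] .
  let ?z = "\<lambda>t i. x i + t * (y i - x i)"
  obtain P Q where P: "\<And>t. p (?z t) = poly P t" and Q: "\<And>t. q (?z t) = poly Q t"
    using poly_functions_line[OF p(1)] poly_functions_line[OF q(1)] by meson
  have "P \<noteq> 0" "Q \<noteq> 0" using P[of 0] Q[of 1] p q by auto
  then have "finite {t. poly (P * Q) t = 0}" by (intro poly_roots_finite) simp
  then obtain t where "poly (P * Q) t \<noteq> 0"
    using ex_new_if_finite[of "{t. poly (P * Q) t = 0}"] infinite_UNIV_char_0 by blast
  then have "p (?z t) \<noteq> 0" "q (?z t) \<noteq> 0" using P Q by auto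
  moreover have "?z t \<in> affine_space I"
  proof -
    have "x \<in> affine_space I" "y \<in> affine_space I" using assms x y by (auto simp: zariski_open_iff)
    then show ?thesis by (simp add: affine_space_def PiE_iff extensional_def)
  qed
  ultimately show ?thesis using p q by blast
qed

lemma regular_functionI:
  assumes "\<And>x. x \<in> U \<Longrightarrow> \<exists>g\<in>poly_functions I. \<exists>p\<in>poly_functions I. \<exists>q\<in>poly_functions I.
      g x \<noteq> 0 \<and> (\<forall>y\<in>affine_space I. g y \<noteq> 0 \<longrightarrow> y \<in> U \<and> q y \<noteq> 0 \<and> f y = p y / q y)"
    and "U \<subseteq> affine_space I"
  shows "regular_function I U f"
  unfolding regular_function_def
proof
  fix x assume x: "x \<in> U"
  obtain g p q where gpq: "g\<in>poly_functions I" "p\<in>poly_functions I" "q\<in>poly_functions I" "g x \<noteq> 0"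
    "\<forall>y\<in>affine_space I. g y \<noteq> 0 \<longrightarrow> y \<in> U \<and> q y \<noteq> 0 \<and> f y = p y / q y"
    using assms(1)[OF x] by blast
  show "\<exists>V. zariski_open I V \<and> x \<in> V \<and> V \<subseteq> U \<and>
        (\<exists>p\<in>poly_functions I. \<exists>q\<in>poly_functions I. \<forall>y\<in>V. q y \<noteq> 0 \<and> f y = p y / q y)"
    using gpq x assms(2) zariski_open_nonvanishing[OF gpq(1)]
    by (intro exI[of _ "{y \<in> affine_space I. g y \<noteq> 0}"] conjI bexI[of _ p] bexI[of _ q]) auto
qed

text \<open>A simultaneous local presentation: one principal open set around \<open>x\<close> on
  which all coordinates of \<open>f\<close> are quotients. Regularity gives a neighbourhood per
  coordinate; multiplying their polynomials into a single \<open>g\<close> uses that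
  \<open>I\<close> is finite.\<close>

definition fractions_at ::
  "'i set \<Rightarrow> 'i partial_map \<Rightarrow> ('i \<Rightarrow> complex) \<Rightarrow> (('i \<Rightarrow> complex) \<Rightarrow> complex) \<Rightarrow>
    ('i \<Rightarrow> ('i \<Rightarrow> complex) \<Rightarrow> complex) \<Rightarrow> ('i \<Rightarrow> ('i \<Rightarrow> complex) \<Rightarrow> complex) \<Rightarrow> bool" where
  "fractions_at I f x g p q \<longleftrightarrow> g \<in> poly_functions I \<and> g x \<noteq> 0 \<and>
     (\<forall>i\<in>I. p i \<in> poly_functions I \<and> q i \<in> poly_functions I) \<and>
     (\<forall>y\<in>affine_space I. g y \<noteq> 0 \<longrightarrow> y \<in> dom f \<and> (\<forall>i\<in>I. q i y \<noteq> 0 \<and> the (f y) i = p i y / q i y))"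

lemma fractions_atD:
  assumes "fractions_at I f x g p q"
  shows "g \<in> poly_functions I" "g x \<noteq> 0"
    "\<And>i. i \<in> I \<Longrightarrow> p i \<in> poly_functions I" "\<And>i. i \<in> I \<Longrightarrow> q i \<in> poly_functions I"
    "\<And>y. y \<in> affine_space I \<Longrightarrow> g y \<noteq> 0 \<Longrightarrow> y \<in> dom f"
    "\<And>y i. y \<in> affine_space I \<Longrightarrow> g y \<noteq> 0 \<Longrightarrow> i \<in> I \<Longrightarrow> q i y \<noteq> 0 \<and> the (f y) i = p i y / q i y"
  using assms by (simp_all add: fractions_at_def)

lemma rational_reps_fractions:
  assumes "f \<in> rational_reps I" "finite I" "x \<in> dom f"
  shows "\<exists>g p q. fractions_at I f x g p q"
proof -
  have "\<forall>i\<in>I. \<exists>g p q. g \<in> poly_functions I \<and> p \<in> poly_functions I \<and> q \<in> poly_functions I \<and> g x \<noteq> 0 \<and>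
      (\<forall>y\<in>affine_space I. g y \<noteq> 0 \<longrightarrow> q y \<noteq> 0 \<and> the (f y) i = p y / q y)"
  proof
    fix i assume "i \<in> I"
    then have "regular_function I (dom f) (\<lambda>x. the (f x) i)"
      using assms(1) by (auto simp: rational_reps_def)
    then obtain V p q where V: "zariski_open I V" "x \<in> V" "p \<in> poly_functions I" "q \<in> poly_functions I"
      "\<forall>y\<in>V. q y \<noteq> 0 \<and> the (f y) i = p y / q y"
      using assms(3) unfolding regular_function_def by blast
    obtain g where "g \<in> poly_functions I" "g x \<noteq> 0" "\<forall>y\<in>affine_space I. g y \<noteq> 0 \<longrightarrow> y \<in> V"
      using zariski_openE[OF V(1,2)] by metis
    then show "\<exists>g p q. g \<in> poly_functions I \<and> p \<in> poly_functions I \<and> q \<in> poly_functions I \<and> g x \<noteq> 0 \<and>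
      (\<forall>y\<in>affine_space I. g y \<noteq> 0 \<longrightarrow> q y \<noteq> 0 \<and> the (f y) i = p y / q y)"
      using V by blast
  qed
  then obtain g p q where gpq: "\<And>i. i \<in> I \<Longrightarrow> g i \<in> poly_functions I \<and> p i \<in> poly_functions I \<and> q i \<in> poly_functions I
      \<and> g i x \<noteq> 0 \<and> (\<forall>y\<in>affine_space I. g i y \<noteq> 0 \<longrightarrow> q i y \<noteq> 0 \<and> the (f y) i = p i y / q i y)"
    by metis
  have "zariski_open I (dom f)" using assms(1) by (simp add: rational_reps_def)
  then obtain k where k: "k \<in> poly_functions I" "k x \<noteq> 0" "\<forall>y\<in>affine_space I. k y \<noteq> 0 \<longrightarrow> y \<in> dom f"
    using zariski_openE assms(3) by metis
  have "fractions_at I f x (\<lambda>y. k y * (\<Prod>i\<in>I. g i y)) p q"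
    unfolding fractions_at_def
  proof (intro conjI ballI impI)
    show "(\<lambda>y. k y * (\<Prod>i\<in>I. g i y)) \<in> poly_functions I"
      using gpq k assms by (intro poly_functions.mult poly_functions_prod) auto
    show "k x * (\<Prod>i\<in>I. g i x) \<noteq> 0" using gpq k assms by auto
    show "p i \<in> poly_functions I" "q i \<in> poly_functions I" if "i \<in> I" for i using gpq that by auto
    fix y assume y: "y \<in> affine_space I" "k y * (\<Prod>i\<in>I. g i y) \<noteq> 0"
    then show "y \<in> dom f" using k by auto
    fix i assume i: "i \<in> I"
    with y have "g i y \<noteq> 0" using assms by auto
    with y i show "q i y \<noteq> 0" "the (f y) i = p i y / q i y" using gpq by auto
  qed
  then show ?thesis by blast
qed

text \<open>A polynomial in fractions is a fraction whose denominator is a product of the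
  \<open>q i\<close>, so no new poles arise. The order of quantifiers matters: \<open>n\<close> and
  \<open>d\<close> are fixed before the point.\<close>

lemma poly_functions_substitute:
  assumes "h \<in> poly_functions I"
    and "\<And>i. i \<in> I \<Longrightarrow> p i \<in> poly_functions I" "\<And>i. i \<in> I \<Longrightarrow> q i \<in> poly_functions I"
  shows "\<exists>n\<in>poly_functions I. \<exists>d\<in>poly_functions I. \<forall>y z. (\<forall>i\<in>I. q i y \<noteq> 0 \<and> z i = p i y / q i y) \<longrightarrow>
           d y \<noteq> 0 \<and> h z = n y / d y"
  using assms(1)
proof induction
  case (const k)
  show ?case by (intro bexI[of _ "\<lambda>x. k"] bexI[of _ "\<lambda>x. 1"]) (simp_all add: poly_functions.const)
next
  case (coord i)
  then show ?case
    by (intro bexI[of _ "p i"] bexI[of _ "q i"]) (simp_all add: assms)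
next
  case (add g h)
  obtain n d where *: "n\<in>poly_functions I" "d\<in>poly_functions I"
    "\<forall>y z. (\<forall>i\<in>I. q i y \<noteq> 0 \<and> z i = p i y / q i y) \<longrightarrow> d y \<noteq> 0 \<and> g z = n y / d y"
    using add.IH(1) by blast
  obtain n' d' where **: "n'\<in>poly_functions I" "d'\<in>poly_functions I"
    "\<forall>y z. (\<forall>i\<in>I. q i y \<noteq> 0 \<and> z i = p i y / q i y) \<longrightarrow> d' y \<noteq> 0 \<and> h z = n' y / d' y"
    using add.IH(2) by blast
  show ?case
  proof (intro bexI allI impI conjI)
    fix y z assume "\<forall>i\<in>I. q i y \<noteq> 0 \<and> z i = p i y / q i y"
    then have "d y \<noteq> 0" "g z = n y / d y" "d' y \<noteq> 0" "h z = n' y / d' y" using *(3) **(3) by blast+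
    then show "d y * d' y \<noteq> 0" "g z + h z = (n y * d' y + n' y * d y) / (d y * d' y)"
      by (simp_all add: add_frac_eq)
  qed (intro poly_functions.intros * **)+
next
  case (mult g h)
  obtain n d where *: "n\<in>poly_functions I" "d\<in>poly_functions I"
    "\<forall>y z. (\<forall>i\<in>I. q i y \<noteq> 0 \<and> z i = p i y / q i y) \<longrightarrow> d y \<noteq> 0 \<and> g z = n y / d y"
    using mult.IH(1) by blast
  obtain n' d' where **: "n'\<in>poly_functions I" "d'\<in>poly_functions I"
    "\<forall>y z. (\<forall>i\<in>I. q i y \<noteq> 0 \<and> z i = p i y / q i y) \<longrightarrow> d' y \<noteq> 0 \<and> h z = n' y / d' y"
    using mult.IH(2) by blast
  show ?case
  proof (intro bexI allI impI conjI)
    fix y z assume "\<forall>i\<in>I. q i y \<noteq> 0 \<and> z i = p i y / q i y"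
    then have "d y \<noteq> 0" "g z = n y / d y" "d' y \<noteq> 0" "h z = n' y / d' y" using *(3) **(3) by blast+
    then show "d y * d' y \<noteq> 0" "g z * h z = (n y * n' y) / (d y * d' y)" by simp_all
  qed (intro poly_functions.intros * **)+
qed

section \<open>The group of birational maps\<close>

lemma rational_reps_affine:
  assumes "f \<in> rational_reps I" "f x = Some y"
  shows "x \<in> affine_space I" "y \<in> affine_space I"
  using assms by (auto simp: rational_reps_def zariski_open_iff ran_def)

text \<open>The polynomial \<open>h\<close> that certifies the image point pulls back to a fraction;
  its numerator times the neighbourhood polynomial \<open>g\<close> cuts out a principal open set
  inside the preimage.\<close>

lemma zariski_open_vimage:
  assumes f: "f \<in> rational_reps I" and "finite I" and V: "zariski_open I V"
  shows "zariski_open I {x \<in> dom f. the (f x) \<in> V}"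
  unfolding zariski_open_iff
proof (intro conjI ballI)
  show "{x \<in> dom f. the (f x) \<in> V} \<subseteq> affine_space I"
    using rational_reps_affine[OF f] by auto
  fix x assume x: "x \<in> {x \<in> dom f. the (f x) \<in> V}"
  then obtain h where h: "h \<in> poly_functions I" "h (the (f x)) \<noteq> 0" "\<forall>y\<in>affine_space I. h y \<noteq> 0 \<longrightarrow> y \<in> V"
    using zariski_openE[OF V] by (metis (no_types, lifting) mem_Collect_eq)
  obtain g p q where "fractions_at I f x g p q"
    using rational_reps_fractions[OF f \<open>finite I\<close>] x by blast
  note g = fractions_atD[OF this]
  obtain n d where nd: "n\<in>poly_functions I" "d\<in>poly_functions I"
    "\<forall>y z. (\<forall>i\<in>I. q i y \<noteq> 0 \<and> z i = p i y / q i y) \<longrightarrow> d y \<noteq> 0 \<and> h z = n y / d y"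
    using poly_functions_substitute[OF h(1), of p q] g(3,4) by blast
  have hf: "d y \<noteq> 0 \<and> h (the (f y)) = n y / d y" if "y \<in> affine_space I" "g y \<noteq> 0" for y
    using nd(3) g(6) that by blast
  have "x \<in> affine_space I" using x rational_reps_affine[OF f] by auto
  then have "g x * n x \<noteq> 0" using hf h g by auto
  moreover have "y \<in> {x \<in> dom f. the (f x) \<in> V}" if y: "y \<in> affine_space I" "g y * n y \<noteq> 0" for y
  proof -
    have d: "y \<in> dom f" using g(5) y by auto
    then have "the (f y) \<in> affine_space I" using rational_reps_affine[OF f] by auto
    moreover have "h (the (f y)) \<noteq> 0" using hf[of y] y by auto
    ultimately show ?thesis using h(3) d by blast
  qed
  ultimately show "\<exists>p\<in>poly_functions I. p x \<noteq> 0 \<and>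
      (\<forall>y\<in>affine_space I. p y \<noteq> 0 \<longrightarrow> y \<in> {x \<in> dom f. the (f x) \<in> V})"
    using g(1) nd(1) by (intro bexI[of _ "\<lambda>y. g y * n y"] poly_functions.mult) auto
qed

lemma dom_map_comp: "dom (f \<circ>\<^sub>m g) = {x \<in> dom g. the (g x) \<in> dom f}"
  by (auto simp: map_comp_def dom_def split: option.splits)

lemma dominant_vimage_nonempty:
  assumes "dominant I g" "zariski_open I V" "V \<noteq> {}"
  shows "{x \<in> dom g. the (g x) \<in> V} \<noteq> {}"
proof -
  obtain x y where "g x = Some y" "y \<in> V"
    using assms unfolding dominant_def ran_def by blast
  then have "x \<in> {x \<in> dom g. the (g x) \<in> V}" by auto
  then show ?thesis by blast
qed

lemma rational_reps_dom:
  assumes "f \<in> rational_reps I" shows "zariski_open I (dom f)" "dom f \<noteq> {}"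
  using assms by (auto simp: rational_reps_def)

lemma rational_reps_comp:
  assumes f: "f \<in> rational_reps I" and g: "g \<in> rational_reps I" and fin: "finite I" and "dominant I g"
  shows "f \<circ>\<^sub>m g \<in> rational_reps I"
  unfolding rational_reps_def mem_Collect_eq
proof (intro conjI ballI)
  show op: "zariski_open I (dom (f \<circ>\<^sub>m g))"
    unfolding dom_map_comp by (rule zariski_open_vimage[OF g fin rational_reps_dom(1)[OF f]])
  show "dom (f \<circ>\<^sub>m g) \<noteq> {}"
    unfolding dom_map_comp by (rule dominant_vimage_nonempty[OF assms(4) rational_reps_dom[OF f]])
  show "ran (f \<circ>\<^sub>m g) \<subseteq> affine_space I"
    using rational_reps_affine[OF f] by (auto simp: ran_def map_comp_def split: option.splits)
  fix i assume i: "i \<in> I"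
  show "regular_function I (dom (f \<circ>\<^sub>m g)) (\<lambda>x. the ((f \<circ>\<^sub>m g) x) i)"
  proof (rule regular_functionI)
    show "dom (f \<circ>\<^sub>m g) \<subseteq> affine_space I" using op by (simp add: zariski_open_iff)
    fix x assume "x \<in> dom (f \<circ>\<^sub>m g)"
    then have x: "x \<in> dom g" "the (g x) \<in> dom f" by (auto simp: dom_map_comp)
    obtain k p q where "fractions_at I g x k p q"
      using rational_reps_fractions[OF g fin x(1)] by blast
    note k = fractions_atD[OF this]
    obtain k' p' q' where "fractions_at I f (the (g x)) k' p' q'"
      using rational_reps_fractions[OF f fin x(2)] by blast
    note k' = fractions_atD[OF this]
    have sub: "\<exists>n\<in>poly_functions I. \<exists>d\<in>poly_functions I.
        \<forall>y\<in>affine_space I. k y \<noteq> 0 \<longrightarrow> d y \<noteq> 0 \<and> h (the (g y)) = n y / d y"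
      if h: "h \<in> poly_functions I" for h
    proof -
      obtain n d where "n\<in>poly_functions I" "d\<in>poly_functions I"
        "\<forall>y z. (\<forall>i\<in>I. q i y \<noteq> 0 \<and> z i = p i y / q i y) \<longrightarrow> d y \<noteq> 0 \<and> h z = n y / d y"
        using poly_functions_substitute[OF h, of p q] k(3,4) by blast
      then show ?thesis using k(6) by (intro bexI[of _ n] bexI[of _ d] ballI impI) auto
    qed
    obtain n d where nd: "n\<in>poly_functions I" "d\<in>poly_functions I"
      "\<And>y. y\<in>affine_space I \<Longrightarrow> k y \<noteq> 0 \<Longrightarrow> d y \<noteq> 0 \<and> k' (the (g y)) = n y / d y"
      using sub[OF k'(1)] by blast
    obtain np dp where ndp: "np\<in>poly_functions I" "dp\<in>poly_functions I"
      "\<And>y. y\<in>affine_space I \<Longrightarrow> k y \<noteq> 0 \<Longrightarrow> dp y \<noteq> 0 \<and> p' i (the (g y)) = np y / dp y"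
      using sub[OF k'(3)[OF i]] by blast
    obtain nq dq where ndq: "nq\<in>poly_functions I" "dq\<in>poly_functions I"
      "\<And>y. y\<in>affine_space I \<Longrightarrow> k y \<noteq> 0 \<Longrightarrow> dq y \<noteq> 0 \<and> q' i (the (g y)) = nq y / dq y"
      using sub[OF k'(4)[OF i]] by blast
    have xa: "x \<in> affine_space I" using x rational_reps_affine[OF g] by auto
    show "\<exists>ga\<in>poly_functions I. \<exists>p\<in>poly_functions I. \<exists>q\<in>poly_functions I. ga x \<noteq> 0 \<and>
       (\<forall>y\<in>affine_space I. ga y \<noteq> 0 \<longrightarrow>
         y \<in> dom (f \<circ>\<^sub>m g) \<and> q y \<noteq> 0 \<and> the ((f \<circ>\<^sub>m g) y) i = p y / q y)"
    proof (intro bexI conjI ballI impI)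
      \<comment> \<open>\<open>n\<close> is the numerator of \<open>k'\<close> composed with
        \<open>g\<close>. So \<open>k * n \<noteq> 0\<close> keeps a point where \<open>g\<close>
        has its presentation and its image where \<open>f\<close> has one; there the coordinate is
        the quotient of \<open>np / dp\<close> by \<open>nq / dq\<close>.\<close>
      show "k x * n x \<noteq> 0" using nd(3)[OF xa] k k' by auto
      fix y assume y: "y \<in> affine_space I" "k y * n y \<noteq> 0"
      then have ky: "k y \<noteq> 0" "n y \<noteq> 0" by auto
      obtain z where z: "g y = Some z" using k(5)[OF y(1) ky(1)] by auto
      have za: "z \<in> affine_space I" using rational_reps_affine[OF g z] by simp
      have "k' z \<noteq> 0" using nd(3)[OF y(1) ky(1)] ky z by simp
      note fz = k'(5)[OF za this] k'(6)[OF za this i]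
      show "y \<in> dom (f \<circ>\<^sub>m g)" using z fz by (simp add: dom_map_comp domIff)
      show "dp y * nq y \<noteq> 0"
        using ndp(3)[OF y(1) ky(1)] ndq(3)[OF y(1) ky(1)] z fz by auto
      then show "the ((f \<circ>\<^sub>m g) y) i = (np y * dq y) / (dp y * nq y)"
        using ndp(3)[OF y(1) ky(1)] ndq(3)[OF y(1) ky(1)] z fz by (simp add: map_comp_def)
    qed (intro poly_functions.mult k nd ndp ndq)+
  qed
qed

lemma dominant_comp:
  assumes "f \<in> rational_reps I" and "finite I" and "dominant I f" "dominant I g"
  shows "dominant I (f \<circ>\<^sub>m g)"
  unfolding dominant_def
proof (intro allI impI)
  fix V assume V: "zariski_open I V \<and> V \<noteq> {}"
  let ?V = "{x \<in> dom f. the (f x) \<in> V}"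
  have "zariski_open I ?V" "?V \<noteq> {}"
    using zariski_open_vimage[OF assms(1,2)] dominant_vimage_nonempty[OF assms(3)] V by simp_all
  then obtain x where "x \<in> dom g" "the (g x) \<in> ?V"
    using dominant_vimage_nonempty[OF assms(4), of ?V] by blast
  then have "the (f (the (g x))) \<in> ran (f \<circ>\<^sub>m g) \<inter> V"
    by (auto simp: ran_def map_comp_def intro!: exI[of _ x])
  then show "ran (f \<circ>\<^sub>m g) \<inter> V \<noteq> {}" by blast
qed

lemma generically_equal_refl:
  "f \<in> rational_reps I \<Longrightarrow> generically_equal I f f"
  unfolding generically_equal_def using rational_reps_dom[of f I] by (intro exI[of _ "dom f"]) simp

lemma generically_equal_sym:
  "generically_equal I f g \<Longrightarrow> generically_equal I g f"
  unfolding generically_equal_def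
proof (elim exE)
  fix U assume "zariski_open I U \<and> U \<noteq> {} \<and> U \<subseteq> dom f \<inter> dom g \<and> (\<forall>x\<in>U. f x = g x)"
  then show "\<exists>U. zariski_open I U \<and> U \<noteq> {} \<and> U \<subseteq> dom g \<inter> dom f \<and> (\<forall>x\<in>U. g x = f x)"
    by (intro exI[of _ U]) simp
qed

lemma generically_equal_trans:
  assumes "generically_equal I f g" "generically_equal I g h"
  shows "generically_equal I f h"
proof -
  obtain U V where "zariski_open I U" "U \<noteq> {}" "U \<subseteq> dom f \<inter> dom g" "\<forall>x\<in>U. f x = g x"
     "zariski_open I V" "V \<noteq> {}" "V \<subseteq> dom g \<inter> dom h" "\<forall>x\<in>V. g x = h x"
    using assms unfolding generically_equal_def by blast
  then show ?thesis unfolding generically_equal_def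
    by (intro exI[of _ "U \<inter> V"]) (simp add: zariski_open_Int zariski_open_Int_nonempty subset_iff)
qed

lemma rational_class_eq:
  assumes "generically_equal I f g"
  shows "rational_class I f = rational_class I g"
  using assms generically_equal_trans generically_equal_sym unfolding rational_class_def by blast

text \<open>Dominance of \<open>g\<close> keeps the preimage of the agreement set of
  \<open>f\<close> and \<open>f'\<close> nonempty; being open, it meets the agreement set of
  \<open>g\<close> and \<open>g'\<close>.\<close>

lemma generically_equal_comp:
  assumes g: "g \<in> rational_reps I" "dominant I g" and fin: "finite I"
    and "generically_equal I f f'" "generically_equal I g g'"
  shows "generically_equal I (f \<circ>\<^sub>m g) (f' \<circ>\<^sub>m g')"
proof -
  obtain U V where U: "zariski_open I U" "U \<noteq> {}" "U \<subseteq> dom f \<inter> dom f'" "\<forall>x\<in>U. f x = f' x"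
    and V: "zariski_open I V" "V \<noteq> {}" "V \<subseteq> dom g \<inter> dom g'" "\<forall>x\<in>V. g x = g' x"
    using assms(4,5) unfolding generically_equal_def by blast
  let ?U = "{x \<in> dom g. the (g x) \<in> U}"
  note U' = zariski_open_vimage[OF g(1) fin U(1)] dominant_vimage_nonempty[OF g(2) U(1,2)]
  have "zariski_open I (?U \<inter> V)" "?U \<inter> V \<noteq> {}"
    by (rule zariski_open_Int[OF U'(1) V(1)], rule zariski_open_Int_nonempty[OF U'(1) V(1) U'(2) V(2)])
  moreover have "x \<in> dom (f \<circ>\<^sub>m g) \<inter> dom (f' \<circ>\<^sub>m g') \<and> (f \<circ>\<^sub>m g) x = (f' \<circ>\<^sub>m g') x"
    if x: "x \<in> ?U \<inter> V" for x
  proof -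
    obtain z where z: "g x = Some z" "z \<in> U" using x by auto
    then have "g' x = Some z" using x V by auto
    then show ?thesis using z U by (auto simp: dom_map_comp)
  qed
  ultimately show ?thesis unfolding generically_equal_def
    by (intro exI[of _ "?U \<inter> V"]) blast
qed

text \<open>The product of classes is defined as a union over all pairs of representatives; it
  collapses to one class because composition respects generic equality.\<close>

lemma dominant_monoid_mult:
  assumes f: "f \<in> rational_reps I" and g: "g \<in> rational_reps I" "dominant I g" and fin: "finite I"
  shows "rational_class I f \<otimes>\<^bsub>dominant_monoid I\<^esub> rational_class I g = rational_class I (f \<circ>\<^sub>m g)"
proof (intro equalityI subsetI)
  fix h assume "h \<in> rational_class I f \<otimes>\<^bsub>dominant_monoid I\<^esub> rational_class I g"
  then obtain f' g' where *: "h \<in> rational_reps I" "generically_equal I f f'" "generically_equal I g g'"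
      "generically_equal I (f' \<circ>\<^sub>m g') h"
    by (auto simp: dominant_monoid_def rational_class_def)
  then show "h \<in> rational_class I (f \<circ>\<^sub>m g)"
    using generically_equal_trans[OF generically_equal_comp[OF g fin *(2,3)] *(4)]
    by (simp add: rational_class_def)
next
  fix h assume "h \<in> rational_class I (f \<circ>\<^sub>m g)"
  then show "h \<in> rational_class I f \<otimes>\<^bsub>dominant_monoid I\<^esub> rational_class I g"
    using f g generically_equal_refl by (auto simp: dominant_monoid_def rational_class_def)
qed

lemma dominant_monoid_one_rep:
  "Some |` affine_space I \<in> rational_reps I" "dominant I (Some |` affine_space I)"
proof -
  have dom: "dom (Some |` affine_space I) = affine_space I" by simp
  have ran: "ran (Some |` affine_space I) = affine_space I" 
    by (auto simp: ran_def restrict_map_def)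
  have ne: "affine_space I \<noteq> {}" by (auto simp: affine_space_def PiE_eq_empty_iff)
  show "Some |` affine_space I \<in> rational_reps I"
    unfolding rational_reps_def mem_Collect_eq dom ran
  proof (intro conjI ballI zariski_open_affine ne subset_refl regular_functionI)
    fix i x assume "i \<in> I" "x \<in> affine_space I"
    then show "\<exists>g\<in>poly_functions I. \<exists>p\<in>poly_functions I. \<exists>q\<in>poly_functions I.
              g x \<noteq> 0 \<and> (\<forall>y\<in>affine_space I. g y \<noteq> 0 \<longrightarrow> y \<in> affine_space I \<and> q y \<noteq> 0 \<and>
                the ((Some |` affine_space I) y) i = p y / q y)"
      by (intro bexI[of _ "\<lambda>x. 1"] bexI[of _ "\<lambda>x. x i"] poly_functions.intros) auto
  qed
  show "dominant I (Some |` affine_space I)"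
    unfolding dominant_def ran by (auto simp: zariski_open_iff)
qed

lemma monoid_dominant_monoid:
  assumes fin: "finite I"
  shows "Group.monoid (dominant_monoid I)"
proof -
  note carr = dominant_monoid_def[of I, THEN arg_cong[where f = carrier], simplified]
  note one = dominant_monoid_def[of I, THEN arg_cong[where f = one], simplified]
  note mult = dominant_monoid_mult[OF _ _ _ fin]
  note comp = rational_reps_comp[OF _ _ fin] dominant_comp[OF _ fin]
  let ?e = "Some |` affine_space I"
  have idl: "?e \<circ>\<^sub>m f = f" "f \<circ>\<^sub>m ?e = f" if "f \<in> rational_reps I" for f
  proof -
    show "?e \<circ>\<^sub>m f = f"
    proof
      fix x
      show "(?e \<circ>\<^sub>m f) x = f x"
        by (cases "f x") (auto simp: rational_reps_affine[OF that])
    qed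
    show "f \<circ>\<^sub>m ?e = f"
    proof
      fix x
      show "(f \<circ>\<^sub>m ?e) x = f x"
      proof (cases "x \<in> affine_space I")
        case False
        then have "f x = None" using rational_reps_affine(1)[OF that] by (cases "f x") auto
        with False show ?thesis by simp
      qed simp
    qed
  qed
  show ?thesis
  proof
    fix F G assume "F \<in> carrier (dominant_monoid I)" "G \<in> carrier (dominant_monoid I)"
    then obtain f g where fg: "F = rational_class I f" "f \<in> rational_reps I" "dominant I f"
        "G = rational_class I g" "g \<in> rational_reps I" "dominant I g"
      unfolding carr by blast
    then show "F \<otimes>\<^bsub>dominant_monoid I\<^esub> G \<in> carrier (dominant_monoid I)"
      unfolding carr using comp by (auto simp: mult)
    fix H assume "H \<in> carrier (dominant_monoid I)"
    then obtain h where "H = rational_class I h" "h \<in> rational_reps I" "dominant I h"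
      unfolding carr by blast
    moreover have "(f \<circ>\<^sub>m g) \<circ>\<^sub>m h = f \<circ>\<^sub>m (g \<circ>\<^sub>m h)"
      by (auto simp: map_comp_def split: option.splits)
    ultimately show "F \<otimes>\<^bsub>dominant_monoid I\<^esub> G \<otimes>\<^bsub>dominant_monoid I\<^esub> H =
        F \<otimes>\<^bsub>dominant_monoid I\<^esub> (G \<otimes>\<^bsub>dominant_monoid I\<^esub> H)"
      using fg comp by (simp add: mult)
  next
    show "\<one>\<^bsub>dominant_monoid I\<^esub> \<in> carrier (dominant_monoid I)"
      unfolding carr one using dominant_monoid_one_rep by blast
  next
    fix F assume "F \<in> carrier (dominant_monoid I)"
    then obtain f where "F = rational_class I f" "f \<in> rational_reps I" "dominant I f"
      unfolding carr by blast
    then show "\<one>\<^bsub>dominant_monoid I\<^esub> \<otimes>\<^bsub>dominant_monoid I\<^esub> F = F"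
      "F \<otimes>\<^bsub>dominant_monoid I\<^esub> \<one>\<^bsub>dominant_monoid I\<^esub> = F"
      unfolding one using dominant_monoid_one_rep[of I] by (simp_all add: mult idl)
  qed
qed

lemma group_Bir: "finite I \<Longrightarrow> group (Bir I)"
  unfolding Bir_def by (intro monoid.units_group monoid_dominant_monoid)


section \<open>Positive points\<close>

definition pos_reals :: "complex set" where
  "pos_reals = complex_of_real ` {0<..}"

lemma pos_reals_simps [simp, intro]:
  "x \<in> pos_reals \<Longrightarrow> y \<in> pos_reals \<Longrightarrow> x + y \<in> pos_reals"
  "x \<in> pos_reals \<Longrightarrow> y \<in> pos_reals \<Longrightarrow> x * y \<in> pos_reals"
  "x \<in> pos_reals \<Longrightarrow> y \<in> pos_reals \<Longrightarrow> x / y \<in> pos_reals"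
  "1 \<in> pos_reals"
  unfolding pos_reals_def image_iff
  by (elim bexE; (simp flip: of_real_add of_real_mult of_real_divide)) +
    (rule bexI[of _ 1], auto)

lemma pos_reals_nonzero: "x \<in> pos_reals \<Longrightarrow> x \<noteq> 0"
  by (auto simp: pos_reals_def)

lemma pos_reals_prod: "(\<And>k. k \<in> A \<Longrightarrow> f k \<in> pos_reals) \<Longrightarrow> (\<Prod>k\<in>A. f k) \<in> pos_reals"
  by (induction A rule: infinite_finite_induct) auto

lemma pos_reals_sum:
  "finite A \<Longrightarrow> A \<noteq> {} \<Longrightarrow> (\<And>k. k \<in> A \<Longrightarrow> f k \<in> pos_reals) \<Longrightarrow> (\<Sum>k\<in>A. f k) \<in> pos_reals"
  by (induction A rule: finite_ne_induct) auto

lemma infinite_pos_reals: "infinite pos_reals"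
proof -
  have "inj_on complex_of_real {0<..}" by (rule inj_onI) simp
  then show ?thesis unfolding pos_reals_def using infinite_Ioi by (simp add: finite_image_iff)
qed

definition positive_points :: "'i set \<Rightarrow> ('i \<Rightarrow> complex) set" where
  "positive_points I = (I \<rightarrow>\<^sub>E pos_reals)"

lemma positive_points_affine: "positive_points I \<subseteq> affine_space I"
  by (auto simp: positive_points_def affine_space_def PiE_iff)

text \<open>The coordinates of \<open>x\<close> are made positive one at a time.\<close>

lemma positive_points_dense:
  assumes fin: "finite I" and p: "p \<in> poly_functions I" and x: "x \<in> affine_space I" "p x \<noteq> 0"
  shows "\<exists>y\<in>positive_points I. p y \<noteq> 0"
proof -
  have "\<exists>y\<in>affine_space I. p y \<noteq> 0 \<and> (\<forall>i\<in>J. y i \<in> pos_reals)" if "J \<subseteq> I" for J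
    using finite_subset[OF that fin] that
  proof (induction J rule: finite_induct)
    case empty
    then show ?case using x by blast
  next
    case (insert j J)
    then obtain y where y: "y \<in> affine_space I" "p y \<noteq> 0" "\<forall>i\<in>J. y i \<in> pos_reals" by blast
    let ?z = "\<lambda>t i. y i + t * (if i = j then 1 else 0)"
    obtain P where P: "\<And>t. p (?z t) = poly P t"
      using poly_functions_line[OF p] by meson
    have "P \<noteq> 0" using P[of 0] y by auto
    then have "finite {t. poly P t = 0}" by (rule poly_roots_finite)
    then have "finite ((\<lambda>t. y j + t) ` {t. poly P t = 0})" by simp
    then obtain r where r: "r \<in> pos_reals" "r \<notin> (\<lambda>t. y j + t) ` {t. poly P t = 0}"
      using infinite_pos_reals by (meson finite_subset subsetI)
    have "p (?z (r - y j)) \<noteq> 0" using r by (force simp: P image_iff)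
    moreover have "?z (r - y j) \<in> affine_space I"
      using y insert.prems by (auto simp: affine_space_def PiE_iff extensional_def)
    moreover have "\<forall>i\<in>insert j J. ?z (r - y j) i \<in> pos_reals"
      using r y insert.hyps by auto
    ultimately show ?case by (intro bexI[of _ "?z (r - y j)"]) auto
  qed
  from this[of I] show ?thesis by (auto simp: positive_points_def affine_space_def PiE_iff)
qed

text \<open>A coordinate that differs at some point of both domains gives, after
  cross-multiplication, a polynomial that is nonzero there, hence nonzero at a positive point. So
  agreement spreads to the whole common domain.\<close>

lemma generically_equal_if_positive:
  assumes f: "f \<in> rational_reps I" and g: "g \<in> rational_reps I" and fin: "finite I"
    and eq: "\<And>x. x \<in> positive_points I \<Longrightarrow> x \<in> dom f \<and> f x = g x"
  shows "generically_equal I f g"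
  unfolding generically_equal_def
proof (intro exI[of _ "dom f \<inter> dom g"] conjI ballI subset_refl)
  show "zariski_open I (dom f \<inter> dom g)" "dom f \<inter> dom g \<noteq> {}"
    using rational_reps_dom[OF f] rational_reps_dom[OF g]
      zariski_open_Int[of I "dom f" "dom g"] zariski_open_Int_nonempty[of I "dom f" "dom g"] by simp_all
  fix x assume "x \<in> dom f \<inter> dom g"
  then have x: "x \<in> dom f" "x \<in> dom g" by auto
  obtain h p q where "fractions_at I f x h p q"
    using rational_reps_fractions[OF f fin x(1)] by blast
  note h = fractions_atD[OF this]
  obtain h' p' q' where "fractions_at I g x h' p' q'"
    using rational_reps_fractions[OF g fin x(2)] by blast
  note h' = fractions_atD[OF this]
  have xa: "x \<in> affine_space I" using x rational_reps_affine[OF f] by auto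
  have "the (f x) i = the (g x) i" if i: "i \<in> I" for i
  proof (rule ccontr)
    assume ne: "the (f x) i \<noteq> the (g x) i"
    \<comment> \<open>The factors \<open>h\<close> and \<open>h'\<close> force the positive point
      found below into the region where both presentations are valid.\<close>
    let ?P = "\<lambda>y. h y * h' y * (p i y * q' i y - p' i y * q i y)"
    have "?P x \<noteq> 0" using h(6)[OF xa h(2) i] h'(6)[OF xa h'(2) i] h(2) h'(2) ne
      by (auto simp: frac_eq_eq)
    moreover have "?P \<in> poly_functions I"
      using h h' i by (intro poly_functions.mult poly_functions_diff) auto
    ultimately obtain y where y: "y \<in> positive_points I" "?P y \<noteq> 0"
      using positive_points_dense[OF fin _ xa] by blast
    have "y \<in> affine_space I" "h y \<noteq> 0" "h' y \<noteq> 0" using y positive_points_affine by auto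
    then have "the (f y) i \<noteq> the (g y) i"
      using h(6)[of y i] h'(6)[of y i] i y by (auto simp: frac_eq_eq)
    then show False using eq y by auto
  qed
  moreover have "the (f x) \<in> I \<rightarrow>\<^sub>E UNIV" "the (g x) \<in> I \<rightarrow>\<^sub>E UNIV"
    using x rational_reps_affine(2)[OF f] rational_reps_affine(2)[OF g] unfolding affine_space_def dom_def
    by (metis (mono_tags, lifting) mem_Collect_eq option.exhaust_sel)+
  ultimately have "the (f x) = the (g x)" by (metis PiE_ext)
  then show "f x = g x" using x by auto
qed


text \<open>The coordinates \<open>lift\<close> identify the positive points with \<open>Z\<close>, and \<open>T\<close> is \<open>C\<close> in these coordinates.\<close>

definition acts_by :: "'i set \<Rightarrow> (('i \<Rightarrow> complex) \<Rightarrow> 'z) \<Rightarrow> 'z set \<Rightarrow> 'i partial_map set \<Rightarrow> ('z \<Rightarrow> 'z) \<Rightarrow> bool" where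
  "acts_by I lift Z C T \<longleftrightarrow> T ` Z = Z \<and>
     (\<exists>f\<in>rational_reps I. C = rational_class I f \<and>
        (\<forall>q\<in>positive_points I. \<exists>q'\<in>positive_points I. f q = Some q' \<and> lift q' = T (lift q)))"

locale positive_coordinates =
  fixes I :: "'i set" and lift :: "('i \<Rightarrow> complex) \<Rightarrow> 'z" and Z :: "'z set"
  assumes finite_I: "finite I" and bij_lift: "bij_betw lift (positive_points I) Z"
begin

abbreviation "acts \<equiv> acts_by I lift Z"

lemma lift_in: "q \<in> positive_points I \<Longrightarrow> lift q \<in> Z"
  using bij_lift by (auto simp: bij_betw_def)

lemma lift_inj: "q \<in> positive_points I \<Longrightarrow> q' \<in> positive_points I \<Longrightarrow> lift q = lift q' \<longleftrightarrow> q = q'"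
  using bij_lift by (auto simp: bij_betw_def inj_on_def)

text \<open>Dominance comes for free: \<open>T\<close> maps \<open>Z\<close> onto \<open>Z\<close>,
  so the image of \<open>f\<close> contains every positive point, and every nonempty open set
  contains one.\<close>

lemma actsE:
  assumes "acts C T"
  obtains f where "f \<in> rational_reps I" "dominant I f" "C = rational_class I f" "T ` Z = Z"
    "\<forall>q\<in>positive_points I. \<exists>q'\<in>positive_points I. f q = Some q' \<and> lift q' = T (lift q)"
proof -
  obtain f where f: "f \<in> rational_reps I" "C = rational_class I f" and T: "T ` Z = Z"
    and fT: "\<forall>q\<in>positive_points I. \<exists>q'\<in>positive_points I. f q = Some q' \<and> lift q' = T (lift q)"
    using assms unfolding acts_by_def by auto
  have "dominant I f"
    unfolding dominant_def
  proof (intro allI impI, elim conjE)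
    fix V assume V: "zariski_open I V" "V \<noteq> {}"
    then obtain x where x: "x \<in> V" by blast
    obtain p where p: "p \<in> poly_functions I" "p x \<noteq> 0" "\<forall>y\<in>affine_space I. p y \<noteq> 0 \<longrightarrow> y \<in> V"
      using zariski_openE[OF V(1) x] .
    have "x \<in> affine_space I" using V x by (auto simp: zariski_open_iff)
    then obtain y where y: "y \<in> positive_points I" "p y \<noteq> 0"
      using positive_points_dense[OF finite_I p(1) _ p(2)] by blast
    have "lift y \<in> T ` lift ` positive_points I"
      using lift_in[OF y(1)] T bij_lift by (simp add: bij_betw_def)
    then obtain q where q: "q \<in> positive_points I" "lift y = T (lift q)" by blast
    obtain q' where q': "q' \<in> positive_points I" "f q = Some q'" "lift q' = T (lift q)"
      using fT[rule_format, OF q(1)] by blast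
    then have "f q = Some y" using q(2) lift_inj[OF y(1) q'(1)] by simp
    moreover have "y \<in> V" using p(3) y positive_points_affine by blast
    ultimately show "ran f \<inter> V \<noteq> {}" by (auto simp: ran_def)
  qed
  then show ?thesis using that f T fT by blast
qed

lemma acts_carrier: "acts C T \<Longrightarrow> C \<in> carrier (dominant_monoid I)"
  by (elim actsE) (auto simp: dominant_monoid_def)

text \<open>Every relation in \<open>Bir I\<close> is obtained from this: both sides act by explicit
  functions, which are compared on \<open>Z\<close> alone.\<close>

lemma acts_unique:
  assumes "acts C T" "acts D U" "\<And>z. z \<in> Z \<Longrightarrow> T z = U z"
  shows "C = D"
proof -
  obtain f where f: "f \<in> rational_reps I" "dominant I f" "C = rational_class I f" "T ` Z = Z"
    "\<forall>q\<in>positive_points I. \<exists>q'\<in>positive_points I. f q = Some q' \<and> lift q' = T (lift q)"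
    using actsE[OF assms(1)] .
  obtain g where g: "g \<in> rational_reps I" "dominant I g" "D = rational_class I g" "U ` Z = Z"
    "\<forall>q\<in>positive_points I. \<exists>q'\<in>positive_points I. g q = Some q' \<and> lift q' = U (lift q)"
    using actsE[OF assms(2)] .
  have "generically_equal I f g"
  proof (rule generically_equal_if_positive[OF f(1) g(1) finite_I])
    fix q assume q: "q \<in> positive_points I"
    obtain r r' where "r \<in> positive_points I" "f q = Some r" "lift r = T (lift q)"
      "r' \<in> positive_points I" "g q = Some r'" "lift r' = U (lift q)"
      using f(5)[rule_format, OF q] g(5)[rule_format, OF q] by blast
    moreover from this have "r = r'" using lift_inj assms(3)[OF lift_in[OF q]] by metis
    ultimately show "q \<in> dom f \<and> f q = g q" by auto
  qed
  then show ?thesis unfolding f(3) g(3) by (rule rational_class_eq)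
qed

lemma acts_cong:
  assumes "acts C T" "\<And>z. z \<in> Z \<Longrightarrow> T z = U z"
  shows "acts C U"
proof -
  have "U ` Z = T ` Z" using assms(2) by (intro image_cong) simp_all
  then show ?thesis using assms lift_in unfolding acts_by_def by simp
qed

lemma acts_mult_dominant:
  assumes "acts C T" "acts D U"
  shows "acts (C \<otimes>\<^bsub>dominant_monoid I\<^esub> D) (\<lambda>z. T (U z))"
proof -
  obtain f where f: "f \<in> rational_reps I" "dominant I f" "C = rational_class I f" "T ` Z = Z"
    "\<forall>q\<in>positive_points I. \<exists>q'\<in>positive_points I. f q = Some q' \<and> lift q' = T (lift q)"
    using actsE[OF assms(1)] .
  obtain g where g: "g \<in> rational_reps I" "dominant I g" "D = rational_class I g" "U ` Z = Z"
    "\<forall>q\<in>positive_points I. \<exists>q'\<in>positive_points I. g q = Some q' \<and> lift q' = U (lift q)"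
    using actsE[OF assms(2)] .
  show ?thesis unfolding acts_by_def
  proof (intro conjI bexI[of _ "f \<circ>\<^sub>m g"] ballI)
    show "(\<lambda>z. T (U z)) ` Z = Z" using f(4) g(4) by (metis image_image)
    show "f \<circ>\<^sub>m g \<in> rational_reps I" by (rule rational_reps_comp[OF f(1) g(1) finite_I g(2)])
    show "C \<otimes>\<^bsub>dominant_monoid I\<^esub> D = rational_class I (f \<circ>\<^sub>m g)"
      using dominant_monoid_mult[OF f(1) g(1,2) finite_I] f g by simp
    fix q assume "q \<in> positive_points I"
    then obtain r where r: "r \<in> positive_points I" "g q = Some r" "lift r = U (lift q)" using g(5) by blast
    then show "\<exists>q'\<in>positive_points I. (f \<circ>\<^sub>m g) q = Some q' \<and> lift q' = T (U (lift q))"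
      using f(5)[rule_format, OF r(1)] by simp
  qed
qed

lemma acts_mult: "acts C T \<Longrightarrow> acts D U \<Longrightarrow> acts (C \<otimes>\<^bsub>Bir I\<^esub> D) (\<lambda>z. T (U z))"
  using acts_mult_dominant by (simp add: Bir_def units_of_mult)

lemma acts_one: "acts \<one>\<^bsub>Bir I\<^esub> (\<lambda>z. z)"
proof -
  have "\<one>\<^bsub>Bir I\<^esub> = rational_class I (Some |` affine_space I)"
    by (simp add: Bir_def units_of_one dominant_monoid_def)
  then show ?thesis
    unfolding acts_by_def using dominant_monoid_one_rep(1)[of I] positive_points_affine[of I]
    by (intro conjI bexI[of _ "Some |` affine_space I"] ballI) auto
qed

text \<open>An inverse on \<open>Z\<close> suffices for birationality if it is itself the action of
  some class: both products then act as the identity, and \<open>acts_unique\<close>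
  applies.\<close>

lemma acts_Bir:
  assumes "acts C T" "acts D U" "\<And>z. z \<in> Z \<Longrightarrow> T (U z) = z" "\<And>z. z \<in> Z \<Longrightarrow> U (T z) = z"
  shows "C \<in> carrier (Bir I)"
proof -
  have "C \<otimes>\<^bsub>Bir I\<^esub> D = \<one>\<^bsub>Bir I\<^esub>" "D \<otimes>\<^bsub>Bir I\<^esub> C = \<one>\<^bsub>Bir I\<^esub>"
    using acts_unique[OF acts_mult[OF assms(1,2)] acts_one] acts_unique[OF acts_mult[OF assms(2,1)] acts_one]
      assms(3,4) by simp_all
  then show ?thesis using assms(1,2)[THEN acts_carrier]
    by (auto simp: Bir_def units_of_def Units_def)
qed

lemma acts_pow:
  assumes "acts C T"
  shows "acts (C [^]\<^bsub>Bir I\<^esub> (n::nat)) (T ^^ n)"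
proof (induction n)
  interpret group "Bir I" by (rule group_Bir[OF finite_I])
  case 0
  have "acts \<one>\<^bsub>Bir I\<^esub> (T ^^ 0)" by (rule acts_cong[OF acts_one]) simp
  then show ?case by (simp only: nat_pow_0)
next
  interpret group "Bir I" by (rule group_Bir[OF finite_I])
  case (Suc n)
  have "acts (C [^]\<^bsub>Bir I\<^esub> n \<otimes>\<^bsub>Bir I\<^esub> C) (\<lambda>z. (T ^^ n) (T z))"
    by (rule acts_mult[OF Suc.IH assms])
  moreover have "(\<lambda>z. (T ^^ n) (T z)) = T ^^ Suc n" by (rule ext) (simp only: funpow_Suc_right comp_def)
  ultimately show ?case by (simp only: nat_pow_Suc)
qed

end

section \<open>The R-matrix on periodic sequences\<close>

definition pos_periodic :: "nat \<Rightarrow> (int \<Rightarrow> complex) \<Rightarrow> bool" where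
  "pos_periodic n x \<longleftrightarrow> (\<forall>i. x i \<in> pos_reals \<and> x (i + int n) = x i)"

definition window_prod :: "nat \<Rightarrow> (int \<Rightarrow> complex) \<Rightarrow> int \<Rightarrow> complex" where
  "window_prod k x i = (\<Prod>j=1..k. x (i + int j))"

text \<open>With \<open>n\<close> the period this is \<open>E_rot n x y i\<close>; the number of factors is kept independent of the
  period since the recursions below change it.\<close>

definition eps :: "nat \<Rightarrow> (int \<Rightarrow> complex) \<Rightarrow> (int \<Rightarrow> complex) \<Rightarrow> int \<Rightarrow> complex" where
  "eps n x y i = (\<Sum>k<n. (\<Prod>j=1..k. y (i + int j)) * (\<Prod>j=k+2..n. x (i + int j)))"

definition R_fst :: "nat \<Rightarrow> (int \<Rightarrow> complex) \<Rightarrow> (int \<Rightarrow> complex) \<Rightarrow> int \<Rightarrow> complex" where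
  "R_fst n x y i = y i * (eps n x y i / eps n x y (i - 1))"

definition R_snd :: "nat \<Rightarrow> (int \<Rightarrow> complex) \<Rightarrow> (int \<Rightarrow> complex) \<Rightarrow> int \<Rightarrow> complex" where
  "R_snd n x y i = x i * (eps n x y (i - 1) / eps n x y i)"

lemma periodic_mult:
  fixes f :: "int \<Rightarrow> 'b"
  assumes "\<And>i. f (i + p) = f i"
  shows "f (i + z * p) = f i"
proof (induction z arbitrary: i rule: int_induct[where k = 0])
  case base
  then show ?case by simp
next
  case (step1 z)
  have "f (i + (z + 1) * p) = f (i + z * p + p)" by (simp add: algebra_simps)
  then show ?case using assms step1 by simp
next
  case (step2 z)
  have "f (i + (z - 1) * p) = f (i + (z - 1) * p + p)" using assms by simp
  also have "i + (z - 1) * p + p = i + z * p" by (simp add: algebra_simps)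
  finally show ?case using step2 by simp
qed

lemma window_prod_Suc: "window_prod (Suc k) x i = window_prod k x i * x (i + int k + 1)"
  by (simp add: window_prod_def algebra_simps)

lemma window_prod_Suc_left: "window_prod (Suc k) x (i - 1) = x i * window_prod k x i"
  by (induction k) (simp_all add: window_prod_Suc, simp_all add: window_prod_def algebra_simps)

lemma window_prod_nonzero: "(\<And>i. x i \<noteq> 0) \<Longrightarrow> window_prod k x i \<noteq> 0"
  by (simp add: window_prod_def)

lemma pos_periodicD:
  assumes "pos_periodic n x"
  shows "x i \<in> pos_reals" "x i \<noteq> 0" "x (i + int n) = x i"
  using assms pos_reals_nonzero by (auto simp: pos_periodic_def)

lemma window_prod_shift:
  assumes "\<And>i. x (i + int n) = x i" "\<And>i. x i \<noteq> 0"
  shows "window_prod n x i = window_prod n x 0"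
proof -
  have step: "window_prod n x (i + 1) = window_prod n x i" for i
  proof -
    have "window_prod n x i * x (i + int n + 1) = x (i + 1) * window_prod n x (i + 1)"
      using window_prod_Suc[of n x i] window_prod_Suc_left[of n x "i + 1"] by simp
    moreover have "x (i + int n + 1) = x (i + 1)" using assms(1)[of "i + 1"] by (simp add: algebra_simps)
    ultimately show ?thesis using assms(2)[of "i + 1"] by simp
  qed
  then show ?thesis using periodic_mult[of "window_prod n x" 1 0 i] by simp
qed

text \<open>The summand \<open>k = n\<close> is the only one without the new factor
  \<open>x (i + int n + 1)\<close>. \<open>eps_Suc_left\<close> splits the sum at its other end,
  where only \<open>k = 0\<close> lacks the factor \<open>y i\<close>.\<close>

lemma eps_Suc: "eps (Suc n) x y i = eps n x y i * x (i + int n + 1) + window_prod n y i"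
proof -
  let ?P = "\<lambda>k. \<Prod>j=1..k. y (i + int j)"
  have peel: "(\<Prod>j=k+2..Suc n. x (i + int j)) = (\<Prod>j=k+2..n. x (i + int j)) * x (i + int n + 1)" if "k < n" for k
  proof -
    have "{k + 2..Suc n} = insert (Suc n) {k + 2..n}" using that by auto
    then show ?thesis by (simp add: ac_simps)
  qed
  have "eps (Suc n) x y i = (\<Sum>k<n. ?P k * (\<Prod>j=k+2..Suc n. x (i + int j))) + ?P n"
    by (simp add: eps_def)
  also have "(\<Sum>k<n. ?P k * (\<Prod>j=k+2..Suc n. x (i + int j))) = eps n x y i * x (i + int n + 1)"
    unfolding eps_def sum_distrib_right
  proof (rule sum.cong[OF HOL.refl])
    fix k assume "k \<in> {..<n}"
    then have "k < n" by simp
    then show "?P k * (\<Prod>j=k+2..Suc n. x (i + int j)) =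
        ?P k * (\<Prod>j=k+2..n. x (i + int j)) * x (i + int n + 1)"
      by (simp only: peel mult.assoc)
  qed
  finally show ?thesis by (simp add: window_prod_def)
qed

lemma eps_Suc_left: "eps (Suc n) x y (i - 1) = window_prod n x i + y i * eps n x y i"
proof (induction n)
  case 0
  show ?case by (simp add: eps_def window_prod_def)
next
  case (Suc n)
  have "eps (Suc (Suc n)) x y (i - 1) =
      (window_prod n x i + y i * eps n x y i) * x (i + int n + 1) + y i * window_prod n y i"
    using Suc by (subst eps_Suc) (simp add: window_prod_Suc_left algebra_simps)
  then show ?case by (simp add: eps_Suc window_prod_Suc algebra_simps)
qed

text \<open>With \<open>n = Suc k\<close>, the position \<open>i + int k + 1\<close> is
  \<open>i\<close> up to the period, so by the two recursions both products contain the same term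
  \<open>x i * y i * eps k x y i\<close>. What remains after cancelling are the full-period
  products, which do not depend on the starting point.\<close>

lemma eps_recurrence:
  assumes "n > 0" and x: "pos_periodic n x" and y: "pos_periodic n y"
  shows "y i * eps n x y i - x i * eps n x y (i - 1) = window_prod n y 0 - window_prod n x 0"
proof -
  obtain k where n: "n = Suc k" using \<open>n > 0\<close> by (cases n) auto
  have "x (i + int k + 1) = x i" using pos_periodicD(3)[OF x, of i] by (simp add: n algebra_simps)
  then have "y i * eps n x y i - x i * eps n x y (i - 1) = y i * window_prod k y i - x i * window_prod k x i"
    unfolding n using eps_Suc[of k x y i] eps_Suc_left[of k x y i] by (simp add: algebra_simps)
  also have "\<dots> = window_prod n y (i - 1) - window_prod n x (i - 1)"
    by (simp add: n window_prod_Suc_left)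
  also have "\<dots> = window_prod n y 0 - window_prod n x 0"
    using window_prod_shift pos_periodicD[OF x] pos_periodicD[OF y] by metis
  finally show ?thesis .
qed

lemma eps_pos:
  assumes "n > 0" "\<And>i. x i \<in> pos_reals" "\<And>i. y i \<in> pos_reals"
  shows "eps n x y i \<in> pos_reals"
  unfolding eps_def using assms by (intro pos_reals_sum pos_reals_simps pos_reals_prod) auto

lemma eps_shift:
  "eps n (\<lambda>i. x (i + h)) (\<lambda>i. y (i + h)) i = eps n x y (i + h)"
  by (simp add: eps_def add.assoc add.commute[of h] add.left_commute)

lemma eps_periodic:
  assumes "pos_periodic n x" "pos_periodic n y"
  shows "eps n x y (i + int n) = eps n x y i"
proof -
  have "(\<lambda>i. x (i + int n)) = x" "(\<lambda>i. y (i + int n)) = y" using assms by (auto simp: pos_periodic_def)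
  then show ?thesis using eps_shift[of n x "int n" y i] by simp
qed

text \<open>The recurrence determines \<open>eps\<close> up to a scalar: eliminating the inhomogeneous term from \<open>g\<close> and
  \<open>eps\<close> leaves a periodic solution \<open>d\<close> with a zero, and going once around the period multiplies its
  inhomogeneous term by the nonzero number \<open>eps n x y i0\<close>.\<close>

lemma eps_unique:
  assumes n: "n > 0" and x: "pos_periodic n x" and y: "pos_periodic n y"
    and g: "\<And>i. g (i + int n) = g i" "\<And>i. y i * g i - x i * g (i - 1) = \<kappa>" "g i0 \<noteq> 0"
  shows "\<exists>c. c \<noteq> 0 \<and> (\<forall>i. g i = c * eps n x y i)"
proof -
  let ?e = "eps n x y"
  define d where "d i = g i * ?e i0 - ?e i * g i0" for i
  define \<mu> where "\<mu> = \<kappa> * ?e i0 - (window_prod n y 0 - window_prod n x 0) * g i0"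
  have e0: "?e i \<noteq> 0" for i using eps_pos[OF n] pos_periodicD(1) x y pos_reals_nonzero by metis
  have d_per: "d (i + int n) = d i" for i using g(1) eps_periodic[OF x y] by (simp add: d_def)
  have "y i * d i - x i * d (i - 1) =
      (y i * g i - x i * g (i - 1)) * ?e i0 - (y i * ?e i - x i * ?e (i - 1)) * g i0" for i
    by (simp add: d_def algebra_simps)
  then have "y i * d i - x i * d (i - 1) = \<mu>" for i
    unfolding \<mu>_def by (simp only: g(2) eps_recurrence[OF n x y])
  then have rec: "y i * d i = \<mu> + x i * d (i - 1)" for i by (metis diff_add_cancel)
  have walk: "window_prod k y i0 * d (i0 + int k) = \<mu> * eps k x y i0" for k
  proof (induction k)
    case 0
    show ?case by (simp add: d_def eps_def)
  next
    case (Suc k)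
    have "window_prod (Suc k) y i0 * d (i0 + int (Suc k)) =
        window_prod k y i0 * (y (i0 + int k + 1) * d (i0 + int k + 1))"
      by (simp add: window_prod_Suc algebra_simps)
    also have "\<dots> = window_prod k y i0 * \<mu> + x (i0 + int k + 1) * (window_prod k y i0 * d (i0 + int k))"
      by (subst rec) (simp add: algebra_simps)
    also have "\<dots> = \<mu> * eps (Suc k) x y i0"
      unfolding Suc.IH by (simp add: eps_Suc algebra_simps)
    finally show ?case .
  qed
  have "\<mu> = 0" using walk[of n] d_per[of i0] e0[of i0] by (simp add: d_def)
  then have "d (i0 + int k) = 0" for k
    using walk[of k] window_prod_nonzero[of y k i0] pos_periodicD(2)[OF y] by simp
  moreover have "d i = d (i0 + int (nat ((i - i0) mod int n)))" for i
  proof -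
    have "i0 + int (nat ((i - i0) mod int n)) + (i - i0) div int n * int n = i"
    proof -
      have "int (nat ((i - i0) mod int n)) = (i - i0) mod int n" using n by simp
      then show ?thesis using mod_mult_div_eq[of "i - i0" "int n"] by (simp add: mult.commute)
    qed
    then show ?thesis
      using periodic_mult[of d "int n" "i0 + int (nat ((i - i0) mod int n))" "(i - i0) div int n", OF d_per]
      by simp
  qed
  ultimately have "d i = 0" for i by metis
  then have g_eq: "g i = (g i0 / ?e i0) * ?e i" for i
    using e0[of i0] by (simp add: d_def field_simps)
  show ?thesis
  proof (intro exI conjI allI)
    show "g i0 / ?e i0 \<noteq> 0" using g(3) e0[of i0] by simp
  qed (rule g_eq)
qed

lemma R_pos_periodic:
  assumes "n > 0" "pos_periodic n x" "pos_periodic n y"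
  shows "pos_periodic n (R_fst n x y)" "pos_periodic n (R_snd n x y)"
proof -
  have "eps n x y (i - 1 + int n) = eps n x y (i - 1)" for i by (rule eps_periodic[OF assms(2,3)])
  then have "eps n x y (i + int n - 1) = eps n x y (i - 1)" for i by (simp add: algebra_simps)
  then show "pos_periodic n (R_fst n x y)" "pos_periodic n (R_snd n x y)"
    using assms eps_pos[OF assms(1), of x y] eps_periodic[OF assms(2,3)]
    by (auto simp: pos_periodic_def R_fst_def R_snd_def)
qed

lemma R_scaled:
  assumes "c \<noteq> 0" "\<And>i. g i = c * eps n x y i"
  shows "R_fst n x y i = y i * (g i / g (i - 1))" "R_snd n x y i = x i * (g (i - 1) / g i)"
  using assms by (simp_all add: R_fst_def R_snd_def)

lemma R_shift:
  "R_fst n (\<lambda>i. x (i + h)) (\<lambda>i. y (i + h)) i = R_fst n x y (i + h)"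
  "R_snd n (\<lambda>i. x (i + h)) (\<lambda>i. y (i + h)) i = R_snd n x y (i + h)"
  by (simp_all add: R_fst_def R_snd_def eps_shift algebra_simps)

context
  fixes n :: nat and x y :: "int \<Rightarrow> complex"
  assumes n: "n > 0" and x: "pos_periodic n x" and y: "pos_periodic n y"
begin

lemma eps_nonzero: "eps n x y i \<noteq> 0"
  using eps_pos[OF n] pos_periodicD(1) x y pos_reals_nonzero by metis

lemma R_mult: "R_fst n x y i * R_snd n x y i = x i * y i"
  using eps_nonzero[of i] eps_nonzero[of "i - 1"] by (simp add: R_fst_def R_snd_def)

text \<open>The recurrence has the same right-hand side at \<open>i\<close> and at
  \<open>i - 1\<close>; dividing the resulting equality by the weight at \<open>i - 1\<close> gives
  the claim. Together with \<open>R_mult\<close> it says that \<open>R\<close> preserves the product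
  of two operators \<open>lax\<close>.\<close>

lemma R_add: "R_fst n x y i + R_snd n x y (i - 1) = x i + y (i - 1)"
proof -
  let ?e = "eps n x y"
  have "y i * ?e i - x i * ?e (i - 1) = y (i - 1) * ?e (i - 1) - x (i - 1) * ?e (i - 1 - 1)"
    by (simp only: eps_recurrence[OF n x y])
  then have *: "y i * ?e i + x (i - 1) * ?e (i - 1 - 1) = (x i + y (i - 1)) * ?e (i - 1)"
    by (simp add: algebra_simps)
  have "R_fst n x y i + R_snd n x y (i - 1) = (y i * ?e i + x (i - 1) * ?e (i - 1 - 1)) / ?e (i - 1)"
    by (simp add: R_fst_def R_snd_def add_divide_distrib)
  then show ?thesis unfolding * using eps_nonzero by simp
qed

text \<open>The ratios of weights telescope to the quotient of the weights at \<open>n\<close> and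
  at 0, which is 1 by periodicity. Hence \<open>R\<close> interchanges the two column
  products.\<close>

lemma window_prod_R:
  "window_prod n (R_fst n x y) 0 = window_prod n y 0"
  "window_prod n (R_snd n x y) 0 = window_prod n x 0"
proof -
  have "window_prod k (R_fst n x y) 0 = window_prod k y 0 * (eps n x y (int k) / eps n x y 0)"
    "window_prod k (R_snd n x y) 0 = window_prod k x 0 * (eps n x y 0 / eps n x y (int k))" for k
    by (induction k) (simp_all add: window_prod_Suc, simp_all add: R_fst_def R_snd_def window_prod_def eps_nonzero algebra_simps)
  from this[of n] show "window_prod n (R_fst n x y) 0 = window_prod n y 0"
    "window_prod n (R_snd n x y) 0 = window_prod n x 0"
    using eps_periodic[OF x y, of 0] eps_nonzero[of 0] by simp_all
qed

text \<open>The sequence \<open>eps n x y\<close> also solves the recurrence belonging to the pair \<open>R (x, y)\<close>.\<close>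

lemma R_involution:
  "R_fst n (R_fst n x y) (R_snd n x y) = x" "R_snd n (R_fst n x y) (R_snd n x y) = y"
proof -
  let ?e = "eps n x y"
  \<comment> \<open>Here \<open>R_snd n x y i * ?e i = x i * ?e (i - 1)\<close> and
    \<open>R_fst n x y i * ?e (i - 1) = y i * ?e i\<close>, so this is the old recurrence with its
    sign reversed.\<close>
  have "R_snd n x y i * ?e i - R_fst n x y i * ?e (i - 1) = window_prod n x 0 - window_prod n y 0" for i
    using eps_recurrence[OF n x y, of i] eps_nonzero
    by (simp add: R_fst_def R_snd_def algebra_simps)
  then obtain c where c: "c \<noteq> 0" "\<And>i. ?e i = c * eps n (R_fst n x y) (R_snd n x y) i"
    using eps_unique[OF n R_pos_periodic[OF n x y], of ?e] eps_periodic[OF x y] eps_nonzero by metis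
  show "R_fst n (R_fst n x y) (R_snd n x y) = x" "R_snd n (R_fst n x y) (R_snd n x y) = y"
    using R_scaled[OF c] eps_nonzero by (auto simp: R_fst_def R_snd_def)
qed

text \<open>For equal products the recurrence is homogeneous, and consecutive weights have the ratio
  \<open>x i / y i\<close>. This settles the cases of the braid relation in which the products do
  not separate the Lax factors.\<close>

lemma R_id_if_eq_prod:
  assumes "window_prod n x 0 = window_prod n y 0"
  shows "R_fst n x y = x" "R_snd n x y = y"
proof -
  have "y i * eps n x y i = x i * eps n x y (i - 1)" for i
    using eps_recurrence[OF n x y, of i] assms by simp
  then show "R_fst n x y = x" "R_snd n x y = y"
    using eps_nonzero by (auto simp: R_fst_def R_snd_def field_simps)
qed

end


section \<open>The braid relation\<close>

text \<open>The bidiagonal Lax matrix as an operator on all sequences; the spectral parameter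
  appears only as the multiplier of a quasi-periodic \<open>v\<close>.\<close>

definition lax :: "(int \<Rightarrow> complex) \<Rightarrow> (int \<Rightarrow> complex) \<Rightarrow> int \<Rightarrow> complex" where
  "lax x v i = x i * v i + v (i - 1)"

text \<open>A product of two bidiagonal operators has three diagonals, the last constantly 1. Unit
  sequences read off the other two.\<close>

lemma lax_lax_eq_iff:
  "(\<forall>v. lax x (lax y v) = lax x' (lax y' v)) \<longleftrightarrow>
     (\<forall>i. x i * y i = x' i * y' i \<and> x i + y (i - 1) = x' i + y' (i - 1))"
proof
  assume eq: "\<forall>v. lax x (lax y v) = lax x' (lax y' v)"
  show "\<forall>i. x i * y i = x' i * y' i \<and> x i + y (i - 1) = x' i + y' (i - 1)"
  proof (intro allI conjI)
    fix i
    have "lax x (lax y (\<lambda>k. if k = i then 1 else 0)) i = lax x' (lax y' (\<lambda>k. if k = i then 1 else 0)) i"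
      "lax x (lax y (\<lambda>k. if k = i - 1 then 1 else 0)) i = lax x' (lax y' (\<lambda>k. if k = i - 1 then 1 else 0)) i"
      using eq by simp_all
    then show "x i * y i = x' i * y' i" "x i + y (i - 1) = x' i + y' (i - 1)"
      by (simp_all add: lax_def)
  qed
next
  assume *: "\<forall>i. x i * y i = x' i * y' i \<and> x i + y (i - 1) = x' i + y' (i - 1)"
  have "lax x (lax y v) i = (x i * y i) * v i + (x i + y (i - 1)) * v (i - 1) + v (i - 1 - 1)" for x y v i
    by (simp add: lax_def algebra_simps)
  then show "\<forall>v. lax x (lax y v) = lax x' (lax y' v)" using * by (intro allI ext) simp
qed

lemma lax_kernel_walk:
  assumes "lax x v = (\<lambda>_. 0)"
  shows "v i = (-1) ^ k * window_prod k x i * v (i + int k)"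
proof (induction k)
  case 0
  show ?case by (simp add: window_prod_def)
next
  case (Suc k)
  have "lax x v (i + int k + 1) = 0" using assms by simp
  then have "v (i + int k) = - (x (i + int k + 1) * v (i + int k + 1))"
    by (simp add: lax_def eq_neg_iff_add_eq_0 add.commute)
  then show ?case using Suc by (simp add: window_prod_Suc algebra_simps)
qed

lemma lax_kernel_exists:
  assumes "\<And>i. x i \<noteq> 0"
  shows "\<exists>v. lax x v = (\<lambda>_. 0) \<and> (\<forall>i. v i \<noteq> 0)"
proof -
  \<comment> \<open>Normalized by \<open>v 0 = 1\<close>; the kernel equation
    \<open>v (i - 1) = - x i * v i\<close> is then solved to the right by division and to the left
    by multiplication.\<close>
  define v where "v i = (if i \<ge> 0 then \<Prod>j\<in>{1..i}. - inverse (x j) else \<Prod>j\<in>{i+1..0}. - x j)" for i :: int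
  have "x i * v i + v (i - 1) = 0" for i
  proof (cases "i \<ge> 1")
    case True
    then have "{1..i} = insert i {1..i - 1}" by auto
    then have "v i = - inverse (x i) * v (i - 1)" using True by (simp add: v_def)
    then show ?thesis using assms[of i] by simp
  next
    case False
    then have "{i..0} = insert i {i + 1..0}" by auto
    then have "v (i - 1) = - x i * (\<Prod>j\<in>{i+1..0}. - x j)" using False by (simp add: v_def)
    moreover have "v i = (\<Prod>j\<in>{i+1..0}. - x j)" using False by (cases "i = 0") (simp_all add: v_def)
    ultimately show ?thesis by simp
  qed
  then have "lax x v = (\<lambda>_. 0)" by (simp add: lax_def fun_eq_iff)
  moreover have "v i \<noteq> 0" for i using assms by (simp add: v_def)
  ultimately show ?thesis by blast
qed

text \<open>The sign is chosen so that the kernel of \<open>lax x\<close> has multiplier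
  \<open>window_prod n x 0\<close>: each step along a kernel sequence contributes a factor
  \<open>- x\<close>.\<close>

definition quasi_periodic :: "nat \<Rightarrow> complex \<Rightarrow> (int \<Rightarrow> complex) \<Rightarrow> bool" where
  "quasi_periodic n c v \<longleftrightarrow> (\<forall>i. v i = (-1) ^ n * c * v (i + int n))"

lemma quasi_periodicD: "quasi_periodic n c v \<Longrightarrow> v i = (-1) ^ n * c * v (i + int n)"
  unfolding quasi_periodic_def by (elim allE)

lemma quasi_periodic_lax:
  assumes x: "pos_periodic n x" and v: "quasi_periodic n c v"
  shows "quasi_periodic n c (lax x v)"
  unfolding quasi_periodic_def
proof
  fix i
  have "i - 1 + int n = i + int n - 1" by simp
  then have v1: "v (i - 1) = (-1) ^ n * c * v (i + int n - 1)"
    using quasi_periodicD[OF v, of "i - 1"] by (simp only:)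
  note v0 = quasi_periodicD[OF v, of i]
  show "lax x v i = (-1) ^ n * c * lax x v (i + int n)"
    unfolding lax_def v1 pos_periodicD(3)[OF x] by (subst v0) (simp add: algebra_simps)
qed

lemma quasi_periodic_kernel:
  assumes x: "pos_periodic n x" and v: "lax x v = (\<lambda>_. 0)"
  shows "quasi_periodic n (window_prod n x 0) v"
  unfolding quasi_periodic_def
proof
  fix i
  have "window_prod n x i = window_prod n x 0"
    using window_prod_shift pos_periodicD[OF x] by metis
  then show "v i = (-1) ^ n * window_prod n x 0 * v (i + int n)"
    using lax_kernel_walk[OF v, of i n] by (simp only:)
qed

text \<open>A kernel sequence of \<open>lax x\<close> has multiplier
  \<open>window_prod n x 0\<close>, and a sequence with two different multipliers vanishes.\<close>

lemma lax_injective: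
  assumes x: "pos_periodic n x" and v: "quasi_periodic n c v" and "window_prod n x 0 \<noteq> c"
    and 0: "lax x v = (\<lambda>_. 0)"
  shows "v = (\<lambda>_. 0)"
proof
  fix i
  have "(-1) ^ n * window_prod n x 0 * v (i + int n) = (-1) ^ n * c * v (i + int n)"
    by (rule HOL.trans[OF HOL.sym[OF quasi_periodicD[OF quasi_periodic_kernel[OF x 0]]] quasi_periodicD[OF v]])
  then have "v (i + int n) = 0" using assms(3) by simp
  then show "v i = 0" using quasi_periodicD[OF v, of i] by simp
qed

text \<open>The rightmost factor of a product of operators \<open>lax\<close> is determined by the product and by its own
  multiplier: it annihilates a quasi-periodic sequence, on which the other factors are injective.\<close>

lemma lax_factor_unique:
  assumes z: "pos_periodic n z" "pos_periodic n z'" and "window_prod n z 0 = window_prod n z' 0"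
    and A: "\<And>w. quasi_periodic n (window_prod n z 0) w \<Longrightarrow> A w = (\<lambda>_. 0) \<Longrightarrow> w = (\<lambda>_. 0)"
    and eq: "\<And>v. A (lax z v) = B (lax z' v)" "B (\<lambda>_. 0) = (\<lambda>_. 0)"
  shows "z = z'"
proof -
  obtain v where v: "lax z' v = (\<lambda>_. 0)" "\<And>i. v i \<noteq> 0"
    using lax_kernel_exists[of z'] pos_periodicD(2)[OF z(2)] by metis
  have "quasi_periodic n (window_prod n z 0) (lax z v)"
    using quasi_periodic_lax[OF z(1) quasi_periodic_kernel[OF z(2) v(1)]] assms(3) by simp
  moreover have "A (lax z v) = (\<lambda>_. 0)" by (simp only: eq v(1))
  ultimately have "lax z v = lax z' v" unfolding v(1) by (rule A)
  then have "z i * v i + v (i - 1) = z' i * v i + v (i - 1)" for i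
    unfolding lax_def by (rule fun_cong)
  then show ?thesis using v(2) by auto
qed

lemma lax_zero: "lax x (\<lambda>_. 0) = (\<lambda>_. 0)"
  by (simp add: lax_def fun_eq_iff)

lemma lax_R:
  assumes "n > 0" "pos_periodic n x" "pos_periodic n y"
  shows "lax (R_fst n x y) (lax (R_snd n x y) v) = lax x (lax y v)"
  using lax_lax_eq_iff[of "R_fst n x y" "R_snd n x y" x y] R_mult[OF assms] R_add[OF assms] by simp

lemma lax_triple_unique:
  assumes pp: "pos_periodic n x" "pos_periodic n y" "pos_periodic n z"
    "pos_periodic n x'" "pos_periodic n y'" "pos_periodic n z'"
    and prods: "window_prod n x 0 = window_prod n x' 0" "window_prod n y 0 = window_prod n y' 0"
      "window_prod n z 0 = window_prod n z' 0"
    and distinct: "window_prod n x 0 \<noteq> window_prod n y 0" "window_prod n x 0 \<noteq> window_prod n z 0"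
      "window_prod n y 0 \<noteq> window_prod n z 0"
    and eq: "\<And>v. lax x (lax y (lax z v)) = lax x' (lax y' (lax z' v))"
  shows "x = x'" "y = y'" "z = z'"
proof -
  have inj_x: "w = (\<lambda>_. 0)" if "quasi_periodic n c w" "window_prod n x 0 \<noteq> c" "lax x w = (\<lambda>_. 0)" for c w
    using lax_injective[OF pp(1)] that by blast
  show z: "z = z'"
  proof (rule lax_factor_unique[OF pp(3,6) prods(3), where A = "\<lambda>w. lax x (lax y w)" and B = "\<lambda>w. lax x' (lax y' w)"])
    fix w assume w: "quasi_periodic n (window_prod n z 0) w" "lax x (lax y w) = (\<lambda>_. 0)"
    then have "lax y w = (\<lambda>_. 0)" using inj_x quasi_periodic_lax[OF pp(2) w(1)] distinct(2) by blast
    then show "w = (\<lambda>_. 0)" using lax_injective[OF pp(2) w(1) distinct(3)] by blast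
  qed (simp_all only: eq lax_zero)
  \<comment> \<open>The common factor \<open>lax z\<close> is cancelled through coefficients of the
    triple product at position \<open>i\<close>: that of \<open>v i\<close> is
    \<open>x i * y i * z i\<close>, and that of \<open>v (i - 2)\<close> is
    \<open>x i + y (i - 1) + z (i - 2)\<close>.\<close>
  let ?d = "\<lambda>i k :: int. if k = i then 1 else (0 :: complex)"
  have xy: "x i * y i = x' i * y' i" for i
  proof -
    have "x i * y i * z i = x' i * y' i * z i"
      using fun_cong[OF eq[of "?d i"], of i] z by (simp add: lax_def mult.assoc)
    then show ?thesis using pos_periodicD(2)[OF pp(3), of i] by simp
  qed
  moreover have "x i + y (i - 1) = x' i + y' (i - 1)" for i
    using fun_cong[OF eq[of "?d (i - 2)"], of i] z by (simp add: lax_def)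
  ultimately have eq2: "lax x (lax y v) = lax x' (lax y' v)" for v
    using lax_lax_eq_iff[of x y x' y'] by simp
  show "y = y'"
    by (rule lax_factor_unique[where A = "lax x" and B = "lax x'", OF pp(2,5) prods(2) inj_x[OF _ distinct(1)]])
      (simp_all only: eq2 lax_zero)
  then have "x i * y i = x' i * y i" for i using xy by simp
  then show "x = x'" using pos_periodicD(2)[OF pp(2)] by auto
qed


text \<open>If two of the three products agree, then some of the factors on either side act trivially and the
  relation degenerates; otherwise both sides factor the same product of operators \<open>lax\<close>.\<close>

lemma R_braid:
  assumes n: "n > 0" and x: "pos_periodic n x" and y: "pos_periodic n y" and z: "pos_periodic n z"
  defines "x1 \<equiv> R_fst n x y" and "y1 \<equiv> R_snd n x y"
  defines "y2 \<equiv> R_fst n y1 z" and "z2 \<equiv> R_snd n y1 z"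
  defines "y1' \<equiv> R_fst n y z" and "z1' \<equiv> R_snd n y z"
  defines "x2' \<equiv> R_fst n x y1'" and "y2' \<equiv> R_snd n x y1'"
  shows "R_fst n x1 y2 = x2'" "R_snd n x1 y2 = R_fst n y2' z1'" "z2 = R_snd n y2' z1'"
proof -
  let ?w = "\<lambda>x. window_prod n x 0"
  note pp = R_pos_periodic[OF n]
  have p1: "pos_periodic n x1" "pos_periodic n y1" "pos_periodic n y1'" "pos_periodic n z1'"
    unfolding x1_def y1_def y1'_def z1'_def by (intro pp x y z)+
  have p2: "pos_periodic n y2" "pos_periodic n z2" "pos_periodic n x2'" "pos_periodic n y2'"
    unfolding y2_def z2_def x2'_def y2'_def by (intro pp p1 x z)+
  note w = window_prod_R[OF n]
  have w1: "?w x1 = ?w y" "?w y1 = ?w x" "?w y1' = ?w z" "?w z1' = ?w y"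
    unfolding x1_def y1_def y1'_def z1'_def by (simp_all only: w x y z)
  have w2: "?w y2 = ?w z" "?w z2 = ?w x" "?w x2' = ?w z" "?w y2' = ?w x"
    unfolding y2_def z2_def x2'_def y2'_def by (simp_all only: w w1 p1 x z)
  note idR = R_id_if_eq_prod[OF n]
  consider "?w x = ?w y" | "?w y = ?w z" | "?w x = ?w z"
    | "?w x \<noteq> ?w y" "?w y \<noteq> ?w z" "?w x \<noteq> ?w z" by blast
  then have "R_fst n x1 y2 = x2' \<and> R_snd n x1 y2 = R_fst n y2' z1' \<and> z2 = R_snd n y2' z1'"
  proof cases
    case 1
    then have "x1 = x" "y1 = y" unfolding x1_def y1_def by (simp_all only: idR x y)
    moreover from this have "y2 = y1'" "z2 = z1'" unfolding y2_def z2_def y1'_def z1'_def by simp_all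
    moreover have "R_fst n y2' z1' = y2'" "R_snd n y2' z1' = z1'"
      using idR[OF p2(4) p1(4)] w1 w2 1 by simp_all
    ultimately show ?thesis by (simp add: x2'_def y2'_def)
  next
    case 2
    then have "y1' = y" "z1' = z" unfolding y1'_def z1'_def by (simp_all only: idR y z)
    moreover from this have "x2' = x1" "y2' = y1" unfolding x2'_def y2'_def x1_def y1_def by simp_all
    moreover have "R_fst n x1 y2 = x1" "R_snd n x1 y2 = y2"
      using idR[OF p1(1) p2(1)] w1 w2 2 by simp_all
    ultimately show ?thesis by (simp add: y2_def z2_def)
  next
    \<comment> \<open>\<open>y1\<close> has the same product as \<open>x\<close>, hence as
      \<open>z\<close>, so the middle application of \<open>R\<close> is trivial and the outer two
      cancel by \<open>R_involution\<close>. The same happens on the other side, and both return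
      \<open>x\<close>, \<open>y\<close>, \<open>z\<close>.\<close>
    case 3
    have "y2 = y1" "z2 = z" unfolding y2_def z2_def using idR[OF p1(2) z] w1 3 by simp_all
    moreover have "R_fst n x1 y1 = x" "R_snd n x1 y1 = y"
      unfolding x1_def y1_def by (rule R_involution[OF n x y])+
    moreover have "x2' = x" "y2' = y1'" unfolding x2'_def y2'_def using idR[OF x p1(3)] w1 3 by simp_all
    moreover have "R_fst n y1' z1' = y" "R_snd n y1' z1' = z"
      unfolding y1'_def z1'_def by (rule R_involution[OF n y z])+
    ultimately show ?thesis by simp
  next
    case 4
    have l: "lax (R_fst n x1 y2) (lax (R_snd n x1 y2) (lax z2 v)) = lax x (lax y (lax z v))" for v
    proof -
      have "lax (R_fst n x1 y2) (lax (R_snd n x1 y2) (lax z2 v)) = lax x1 (lax y2 (lax z2 v))"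
        by (rule lax_R[OF n p1(1) p2(1)])
      also have "lax y2 (lax z2 v) = lax y1 (lax z v)" unfolding y2_def z2_def by (rule lax_R[OF n p1(2) z])
      also have "lax x1 (lax y1 (lax z v)) = lax x (lax y (lax z v))" unfolding x1_def y1_def by (rule lax_R[OF n x y])
      finally show ?thesis .
    qed
    have r: "lax x2' (lax (R_fst n y2' z1') (lax (R_snd n y2' z1') v)) = lax x (lax y (lax z v))" for v
    proof -
      have "lax x2' (lax (R_fst n y2' z1') (lax (R_snd n y2' z1') v)) = lax x2' (lax y2' (lax z1' v))"
        by (simp only: lax_R[OF n p2(4) p1(4)])
      also have "lax x2' (lax y2' (lax z1' v)) = lax x (lax y1' (lax z1' v))"
        unfolding x2'_def y2'_def by (rule lax_R[OF n x p1(3)])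
      also have "lax y1' (lax z1' v) = lax y (lax z v)" unfolding y1'_def z1'_def by (rule lax_R[OF n y z])
      finally show ?thesis .
    qed
    note q = pp[OF p1(1) p2(1)] pp[OF p2(4) p1(4)]
    have w3: "?w (R_fst n x1 y2) = ?w z" "?w (R_snd n x1 y2) = ?w y"
      "?w (R_fst n y2' z1') = ?w y" "?w (R_snd n y2' z1') = ?w x"
      by (simp_all only: w[OF p1(1) p2(1)] w[OF p2(4) p1(4)] w1 w2)
    have "lax (R_fst n x1 y2) (lax (R_snd n x1 y2) (lax z2 v)) =
        lax x2' (lax (R_fst n y2' z1') (lax (R_snd n y2' z1') v))" for v
      by (simp only: l r)
    note * = lax_triple_unique[OF q(1,2) p2(2) p2(3) q(3,4) _ _ _ _ _ _ this]
    show ?thesis using * 4 unfolding w2 w3 by metis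
  qed
  then show "R_fst n x1 y2 = x2'" "R_snd n x1 y2 = R_fst n y2' z1'" "z2 = R_snd n y2' z1'" by simp_all
qed

section \<open>Column operators on functions on a torus\<close>

text \<open>An array with \<open>m\<close> columns and \<open>n\<close> rows is continued to the right by its first column, moved by \<open>h\<close>
  rows; the cyclic extension of the operators \<open>s\<^sub>l\<close> is then just translation.\<close>

definition torus_fun :: "nat \<Rightarrow> nat \<Rightarrow> int \<Rightarrow> (int \<Rightarrow> int \<Rightarrow> complex) set" where
  "torus_fun m n h = {f. (\<forall>a. pos_periodic n (f a)) \<and> (\<forall>a b. f (a + int m) (b + h) = f a b)}"

definition col_op :: "nat \<Rightarrow> nat \<Rightarrow> int \<Rightarrow> (int \<Rightarrow> int \<Rightarrow> complex) \<Rightarrow> int \<Rightarrow> int \<Rightarrow> complex" where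
  "col_op m n j f a =
     (if int m dvd a - j then R_fst n (f a) (f (a + 1))
      else if int m dvd a - j - 1 then R_snd n (f (a - 1)) (f a) else f a)"

lemma not_dvd_near:
  fixes m k d :: int
  assumes "m dvd k" "0 < d" "d < m"
  shows "\<not> m dvd k + d" "\<not> m dvd k - d"
proof -
  have "\<not> m dvd d" using assms zdvd_not_zless by blast
  then show "\<not> m dvd k + d" "\<not> m dvd k - d"
    using assms(1) by (simp_all add: dvd_add_right_iff dvd_diff_right_iff)
qed

lemma torus_funD:
  assumes "f \<in> torus_fun m n h"
  shows "pos_periodic n (f a)" "f (a + int m) (b + h) = f a b" "f a b \<noteq> 0" "f a (b + int n) = f a b"
  using assms pos_periodicD[of n "f a"] by (auto simp: torus_fun_def)

text \<open>\<open>R\<close> commutes with a simultaneous vertical translation of its two columns,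
  so it respects the gluing by \<open>h\<close>.\<close>

lemma R_torus_shift:
  assumes "f \<in> torus_fun m n h"
  shows "R_fst n (f (a + int m)) (f (a' + int m)) (b + h) = R_fst n (f a) (f a') b"
    "R_snd n (f (a + int m)) (f (a' + int m)) (b + h) = R_snd n (f a) (f a') b"
  unfolding R_shift[symmetric] by (simp_all add: torus_funD[OF assms])

lemma col_op_cong:
  assumes "int m dvd j - j'"
  shows "col_op m n j = col_op m n j'"
proof (intro ext)
  fix f a b
  have "int m dvd (a - j) + (j - j') \<longleftrightarrow> int m dvd a - j"
    "int m dvd (a - j - 1) + (j - j') \<longleftrightarrow> int m dvd a - j - 1"
    using assms dvd_add_left_iff by blast+
  moreover have "(a - j) + (j - j') = a - j'" "(a - j - 1) + (j - j') = a - j' - 1" by simp_all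
  ultimately have "int m dvd a - j' \<longleftrightarrow> int m dvd a - j" "int m dvd a - j' - 1 \<longleftrightarrow> int m dvd a - j - 1"
    by metis+
  then show "col_op m n j f a b = col_op m n j' f a b" by (simp only: col_op_def)
qed

lemma col_op_shift: "(\<lambda>a. col_op m n (j + 1) f (a + 1)) = col_op m n j (\<lambda>a. f (a + 1))"
  by (simp add: col_op_def fun_eq_iff)

lemma col_op_translate: "col_op m n j (\<lambda>a b. f a (b + t)) = (\<lambda>a b. col_op m n j f a (b + t))"
  by (simp add: col_op_def fun_eq_iff R_shift)

lemma dvd_offset_iff:
  fixes k u v w :: int
  shows "k dvd u \<Longrightarrow> v = u + w \<Longrightarrow> k dvd v \<longleftrightarrow> k dvd w"
  by (simp add: dvd_add_right_iff)

lemma col_op_far: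
  assumes "\<not> int m dvd j - l" "\<not> int m dvd j - l - 1" "\<not> int m dvd l - j - 1"
  shows "col_op m n j (col_op m n l f) = col_op m n l (col_op m n j f)"
proof
  have near: "col_op m n j (col_op m n l f) a = col_op m n l (col_op m n j f) a"
    if "int m dvd a - j \<or> int m dvd a - j - 1" and
      jl: "\<not> int m dvd j - l" "\<not> int m dvd j - l - 1" "\<not> int m dvd j - l + 1" for a j l
    using that(1)
  proof
    assume a: "int m dvd a - j"
    have "\<not> int m dvd a - l" "\<not> int m dvd a - l - 1" "\<not> int m dvd a + 1 - l"
      using dvd_offset_iff[OF a, of "a - l" "j - l"] dvd_offset_iff[OF a, of "a - l - 1" "j - l - 1"]
        dvd_offset_iff[OF a, of "a + 1 - l" "j - l + 1"] jl by simp_all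
    then show ?thesis using a by (simp add: col_op_def)
  next
    assume a: "int m dvd a - j - 1"
    have l: "\<not> int m dvd a - l" "\<not> int m dvd a - l - 1" "\<not> int m dvd a - 1 - l - 1"
      using dvd_offset_iff[OF a, of "a - l" "j - l + 1"] dvd_offset_iff[OF a, of "a - l - 1" "j - l"]
        dvd_offset_iff[OF a, of "a - 1 - l - 1" "j - l - 1"] jl by simp_all
    moreover have "a - 1 - l = a - l - 1" by simp
    ultimately have "\<not> int m dvd a - 1 - l" by (simp only: not_False_eq_True)
    with l have ?thesis if "\<not> int m dvd a - j" using a that by (simp add: col_op_def)
    moreover have ?thesis if "int m dvd a - j"
    proof -
      \<comment> \<open>Both divisibilities together mean \<open>m = 1\<close>, where every
        difference is divisible, against the assumptions on \<open>j - l\<close>.\<close>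
      have "int m dvd 1" using dvd_diff[OF that a] by simp
      then have "int m dvd j - l" by (meson dvd_trans one_dvd)
      with jl show ?thesis by simp
    qed
    ultimately show ?thesis by blast
  qed
  have lj: "\<not> int m dvd l - j" "\<not> int m dvd l - j + 1" "\<not> int m dvd j - l + 1"
    using assms dvd_minus_iff[of "int m" "j - l"] dvd_minus_iff[of "int m" "j - l - 1"]
      dvd_minus_iff[of "int m" "l - j - 1"] by (simp_all add: algebra_simps)
  fix a
  consider "int m dvd a - j \<or> int m dvd a - j - 1" | "int m dvd a - l \<or> int m dvd a - l - 1"
    | "\<not> int m dvd a - j" "\<not> int m dvd a - j - 1" "\<not> int m dvd a - l" "\<not> int m dvd a - l - 1" by blast
  then show "col_op m n j (col_op m n l f) a = col_op m n l (col_op m n j f) a"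
  proof cases
    case 1
    then show ?thesis by (rule near[OF _ assms(1,2) lj(3)])
  next
    case 2
    then show ?thesis by (rule near[OF _ lj(1) assms(3) lj(2), symmetric])
  qed (simp add: col_op_def)
qed

context
  fixes m n :: nat and h :: int
  assumes m: "m \<ge> 2" and n: "n > 0"
begin

lemma col_op_at:
  assumes "int m dvd a - j"
  shows "col_op m n j f a = R_fst n (f a) (f (a + 1))" "col_op m n j f (a + 1) = R_snd n (f a) (f (a + 1))"
proof -
  have "\<not> int m dvd a - j + 1" using not_dvd_near[OF assms, of 1] m by simp
  then show "col_op m n j f a = R_fst n (f a) (f (a + 1))" "col_op m n j f (a + 1) = R_snd n (f a) (f (a + 1))"
    using assms by (simp_all add: col_op_def algebra_simps)
qed

lemma col_op_away: "\<not> int m dvd a - j \<Longrightarrow> \<not> int m dvd a - j - 1 \<Longrightarrow> col_op m n j f a = f a"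
  by (simp add: col_op_def)

lemma col_op_closed:
  assumes f: "f \<in> torus_fun m n h"
  shows "col_op m n j f \<in> torus_fun m n h"
  unfolding torus_fun_def
proof (intro CollectI conjI allI)
  fix a b
  show "pos_periodic n (col_op m n j f a)"
    using R_pos_periodic[OF n] torus_funD(1)[OF f] by (simp add: col_op_def)
  have "int m dvd a + int m - j \<longleftrightarrow> int m dvd a - j" "int m dvd a + int m - j - 1 \<longleftrightarrow> int m dvd a - j - 1"
    using dvd_add_left_iff[of "int m" "int m" "a - j"] dvd_add_left_iff[of "int m" "int m" "a - j - 1"]
    by (simp_all add: algebra_simps)
  then show "col_op m n j f (a + int m) (b + h) = col_op m n j f a b"
    using R_torus_shift[OF f, of a "a + 1"] R_torus_shift[OF f, of "a - 1" a] torus_funD(2)[OF f]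
    by (simp add: col_op_def algebra_simps)
qed

lemma col_op_involution:
  assumes f: "f \<in> torus_fun m n h"
  shows "col_op m n j (col_op m n j f) = f"
proof
  fix a
  note inv = R_involution[OF n torus_funD(1)[OF f] torus_funD(1)[OF f]]
  consider "int m dvd a - j" | "int m dvd (a - 1) - j" | "\<not> int m dvd a - j" "\<not> int m dvd a - j - 1"
    by (auto simp: algebra_simps)
  then show "col_op m n j (col_op m n j f) a = f a"
  proof cases
    case 1
    then show ?thesis by (simp add: col_op_at inv)
  next
    case 2
    then show ?thesis using col_op_at[OF 2] inv by simp
  qed (simp add: col_op_away)
qed

lemma col_op_braid:
  assumes f: "f \<in> torus_fun m n h" and "m \<ge> 3"
  shows "col_op m n j (col_op m n (j + 1) (col_op m n j f)) =
    col_op m n (j + 1) (col_op m n j (col_op m n (j + 1) f))"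
proof
  fix a
  let ?L = "col_op m n j (col_op m n (j + 1) (col_op m n j f))"
  let ?R = "col_op m n (j + 1) (col_op m n j (col_op m n (j + 1) f))"
  \<comment> \<open>The columns \<open>c\<close>, \<open>c + 1\<close>, \<open>c + 2\<close> are
    distinct modulo \<open>m\<close> because \<open>m \<ge> 3\<close>, so on them the two operators
    act exactly as in \<open>R_braid\<close>.\<close>
  have block: "?L c = ?R c \<and> ?L (c + 1) = ?R (c + 1) \<and> ?L (c + 2) = ?R (c + 2)" if c: "int m dvd c - j" for c
  proof -
    have c': "int m dvd (c + 1) - (j + 1)" using c by simp
    have nd: "\<not> int m dvd c + 2 - j" "\<not> int m dvd c + 2 - j - 1" "\<not> int m dvd c - (j + 1)" "\<not> int m dvd c - (j + 1) - 1"
      using not_dvd_near[OF c, of 1] not_dvd_near[OF c, of 2] \<open>m \<ge> 3\<close> by (simp_all add: algebra_simps)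
    have s: "col_op m n j g c = R_fst n (g c) (g (c + 1))" "col_op m n j g (c + 1) = R_snd n (g c) (g (c + 1))"
      "col_op m n j g (c + 2) = g (c + 2)" for g
      using col_op_at[OF c] nd by (simp_all add: col_op_away)
    have t: "col_op m n (j + 1) g c = g c" "col_op m n (j + 1) g (c + 1) = R_fst n (g (c + 1)) (g (c + 2))"
      "col_op m n (j + 1) g (c + 2) = R_snd n (g (c + 1)) (g (c + 2))" for g
      using col_op_at[OF c'] nd by (simp_all add: col_op_away add.assoc)
    show ?thesis
      unfolding s t using R_braid[OF n torus_funD(1)[OF f] torus_funD(1)[OF f] torus_funD(1)[OF f]] by simp
  qed
  consider "int m dvd a - j" | "int m dvd (a - 1) - j" | "int m dvd (a - 2) - j"
    | "\<not> int m dvd a - j" "\<not> int m dvd (a - 1) - j" "\<not> int m dvd (a - 2) - j" by blast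
  then show "?L a = ?R a"
  proof cases
    case 1
    then show ?thesis using block by blast
  next
    case 2
    then show ?thesis using block[of "a - 1"] by simp
  next
    case 3
    then show ?thesis using block[of "a - 2"] by simp
  next
    case 4
    then have "\<not> int m dvd a - j - 1" "\<not> int m dvd a - (j + 1)" "\<not> int m dvd a - (j + 1) - 1"
      by (simp_all add: algebra_simps)
    then show ?thesis using 4 by (simp add: col_op_away)
  qed
qed

end

section \<open>Commutation of column and row operators\<close>

text \<open>The column operator with its weights \<open>e\<close> as a free parameter, so that
  commutation can be tested with locally constructed weights before these are recognized as
  \<open>eps\<close>.\<close>

definition col_move :: "(int \<Rightarrow> bool) \<Rightarrow> (int \<Rightarrow> int \<Rightarrow> complex) \<Rightarrow> (int \<Rightarrow> int \<Rightarrow> complex) \<Rightarrow> int \<Rightarrow> int \<Rightarrow> complex" where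
  "col_move J e f a b =
     (if J a then f (a + 1) b * (e a b / e a (b - 1))
      else if J (a - 1) then f (a - 1) b * (e (a - 1) (b - 1) / e (a - 1) b) else f a b)"

text \<open>\<open>flip\<close> reverses both axes: \<open>u\<close> therefore runs towards smaller
  \<open>a\<close>, and row \<open>b + 1\<close> plays the first column of the pair, row
  \<open>b\<close> the second.\<close>

definition row_move :: "(int \<Rightarrow> bool) \<Rightarrow> (int \<Rightarrow> int \<Rightarrow> complex) \<Rightarrow> (int \<Rightarrow> int \<Rightarrow> complex) \<Rightarrow> int \<Rightarrow> int \<Rightarrow> complex" where
  "row_move L u f a b =
     (if L (b - 1) then f a (b - 1) * (u a (b - 1) / u (a + 1) (b - 1))
      else if L b then f a (b + 1) * (u (a + 1) b / u a b) else f a b)"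

text \<open>One \<open>2\<times>2\<close> block with entries \<open>p, q\<close> (lower row) and \<open>r, s\<close>: the weight \<open>e\<close> moves up through
  the two rows and \<open>u\<close> moves left through the two columns.  That both can pass the block in either
  order is Zamolodchikov's tetrahedron equation.\<close>

lemma tetrahedron:
  fixes p q r s e0 e1 e2 u0 u1 u2 k l :: "'a::field"
  assumes nz: "p \<noteq> 0" "q \<noteq> 0" "r \<noteq> 0" "s \<noteq> 0" "e0 \<noteq> 0" "e1 \<noteq> 0" "e2 \<noteq> 0" "u0 \<noteq> 0" "u1 \<noteq> 0" "u2 \<noteq> 0"
    and e: "q * e1 - p * e0 = k" "s * e2 - r * e1 = k"
    and u: "p * u0 - r * u1 = l" "q * u1 - s * u2 = l"
  defines "e1' \<equiv> (k + r * (u1 / u0) * e0) / (s * (u2 / u1))"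
    and "u1' \<equiv> (l + r * (e1 / e2) * u2) / (p * (e0 / e1))"
  shows "q * (u1 / u2) * e2 - p * (u0 / u1) * e1' = k"
    and "q * (e1 / e0) * u0 - s * (e2 / e1) * u1' = l"
    and "u0 * u2 * e1 * e1' = e0 * e2 * u1 * u1'"
proof -
  \<comment> \<open>After the row move the lower row is \<open>r * (u1 / u0)\<close>,
    \<open>s * (u2 / u1)\<close>, and \<open>e1'\<close> is the weight forced by the recurrence
    there; the first claim is the recurrence in the upper row. Likewise \<open>u1'\<close> is forced
    in the right column after the column move, and the second claim concerns the left
    column.\<close>
  have e1': "e1' * (s * u2 * u0) = (k * u0 + r * u1 * e0) * u1"
    unfolding e1'_def using nz by (simp add: field_simps)
  have u1': "u1' * (p * e0 * e2) = (l * e2 + r * e1 * u2) * e1"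
    unfolding u1'_def using nz by (simp add: field_simps)
  have subst: "s * e2 = k + r * e1" "p * e0 = q * e1 - k" "p * u0 = l + r * u1" "s * u2 = q * u1 - l"
    using e u by (simp_all add: algebra_simps)
  \<comment> \<open>With denominators cleared, the three claims reduce to these identities, which
    hold once \<open>s * e2\<close>, \<open>p * e0\<close>, \<open>p * u0\<close>,
    \<open>s * u2\<close> are expressed through \<open>q\<close>, \<open>r\<close>,
    \<open>e1\<close>, \<open>u1\<close>, \<open>k\<close>, \<open>l\<close>.\<close>
  have ids: "q * u1 * (s * e2) - k * (p * u0) - r * u1 * (p * e0) = k * (s * u2)"
    "q * e1 * (p * u0) - l * (s * e2) - r * e1 * (s * u2) = l * (p * e0)"
    "k * (p * u0) + r * u1 * (p * e0) - l * (s * e2) - r * e1 * (s * u2) = 0"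
    unfolding subst by (simp_all add: algebra_simps)
  have "(q * u1 * u1 * e2 - p * u0 * e1' * u2) * (s * u2 * u0) =
      q * u1 * u1 * e2 * (s * u2 * u0) - p * u0 * u2 * (e1' * (s * u2 * u0))"
    by (simp add: algebra_simps)
  also have "\<dots> = u0 * u1 * u2 * (q * u1 * (s * e2) - k * (p * u0) - r * u1 * (p * e0))"
    unfolding e1' by (simp add: algebra_simps)
  also have "\<dots> = k * u1 * u2 * (s * u2 * u0)"
    unfolding ids by (simp add: algebra_simps)
  finally have "q * u1 * u1 * e2 - p * u0 * e1' * u2 = k * u1 * u2"
    using nz by simp
  then show "q * (u1 / u2) * e2 - p * (u0 / u1) * e1' = k"
    using nz by (simp add: field_simps)
  have "(q * e1 * e1 * u0 - s * e2 * u1' * e0) * (p * e0 * e2) =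
      q * e1 * e1 * u0 * (p * e0 * e2) - s * e2 * e0 * (u1' * (p * e0 * e2))"
    by (simp add: algebra_simps)
  also have "\<dots> = e0 * e1 * e2 * (q * e1 * (p * u0) - l * (s * e2) - r * e1 * (s * u2))"
    unfolding u1' by (simp add: algebra_simps)
  also have "\<dots> = l * e1 * e0 * (p * e0 * e2)"
    unfolding ids by (simp add: algebra_simps)
  finally have "q * e1 * e1 * u0 - s * e2 * u1' * e0 = l * e1 * e0"
    using nz by simp
  then show "q * (e1 / e0) * u0 - s * (e2 / e1) * u1' = l"
    using nz by (simp add: field_simps)
  have "(u0 * u2 * e1 * e1' - e0 * e2 * u1 * u1') * (s * p) =
      p * e1 * (e1' * (s * u2 * u0)) - s * u1 * (u1' * (p * e0 * e2))"
    by (simp add: algebra_simps)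
  also have "\<dots> = e1 * u1 * (k * (p * u0) + r * u1 * (p * e0) - l * (s * e2) - r * e1 * (s * u2))"
    unfolding e1' u1' by (simp add: algebra_simps)
  finally show "u0 * u2 * e1 * e1' = e0 * e2 * u1 * u1'" unfolding ids using nz by simp
qed


text \<open>The data of the local argument: the pairs of columns moved by \<open>J\<close> do not
  overlap, nor do the pairs of rows moved by \<open>L\<close>, and the weights solve recurrences
  whose constants depend only on the column or only on the row. Periodicity and uniqueness enter in
  \<open>col_row_commute\<close>.\<close>

locale local_moves =
  fixes J L :: "int \<Rightarrow> bool" and f e u :: "int \<Rightarrow> int \<Rightarrow> complex" and \<kappa> \<kappa>' :: "int \<Rightarrow> complex"
  assumes J: "\<And>a. J a \<Longrightarrow> \<not> J (a - 1)" "\<And>a. J a \<Longrightarrow> \<not> J (a + 1)"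
    and L: "\<And>b. L b \<Longrightarrow> \<not> L (b - 1)" "\<And>b. L b \<Longrightarrow> \<not> L (b + 1)"
    and nz: "\<And>a b. f a b \<noteq> 0" "\<And>a b. e a b \<noteq> 0" "\<And>a b. u a b \<noteq> 0"
    and e: "\<And>a b. J a \<Longrightarrow> f (a + 1) b * e a b - f a b * e a (b - 1) = \<kappa> a"
    and u: "\<And>a b. L b \<Longrightarrow> f a b * u a b - f a (b + 1) * u (a + 1) b = \<kappa>' b"
begin

abbreviation "fc \<equiv> col_move J e f"
abbreviation "fr \<equiv> row_move L u f"

text \<open>In a pair of rows \<open>b\<close>, \<open>b + 1\<close> with \<open>L b\<close> only
  the weight between the two rows changes, and it is solved for from the recurrence in row
  \<open>b\<close>. The weights at \<open>b - 1\<close> and \<open>b + 1\<close> stay, so the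
  recurrence in row \<open>b + 1\<close> becomes a condition, supplied by the tetrahedron equation.
  \<open>u_moved\<close> is built in the same way for columns.\<close>

definition "e_moved a b = (if L b then (\<kappa> a + fr a b * e a (b - 1)) / fr (a + 1) b else e a b)"
definition "u_moved a b = (if J (a - 1) then (\<kappa>' b + fc a (b + 1) * u (a + 1) b) / fc a b else u a b)"

lemma row_move_at:
  assumes "L b"
  shows "row_move L u g a b = g a (b + 1) * (u (a + 1) b / u a b)"
    "row_move L u g a (b + 1) = g a b * (u a b / u (a + 1) b)"
  using assms L by (simp_all add: row_move_def)

lemma col_move_at:
  assumes "J a"
  shows "col_move J e g a b = g (a + 1) b * (e a b / e a (b - 1))"
    "col_move J e g (a + 1) b = g a b * (e a (b - 1) / e a b)"
  using assms J by (simp_all add: col_move_def)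

lemma block_identities:
  assumes a: "J a" and b: "L b"
  shows "fr (a + 1) (b + 1) * e_moved a (b + 1) - fr a (b + 1) * e_moved a b = \<kappa> a"
    and "fc a b * u_moved a b - fc a (b + 1) * u_moved (a + 1) b = \<kappa>' b"
    and "u a b * u (a + 2) b * e a b * e_moved a b = e a (b - 1) * e a (b + 1) * u (a + 1) b * u_moved (a + 1) b"
proof -
  have 2: "a + 1 + 1 = a + 2" by simp
  have em: "e_moved a b = (\<kappa> a + f a (b + 1) * (u (a + 1) b / u a b) * e a (b - 1)) /
      (f (a + 1) (b + 1) * (u (a + 2) b / u (a + 1) b))"
    unfolding e_moved_def row_move_at[OF b] 2 using b by simp
  have um: "u_moved (a + 1) b = (\<kappa>' b + f a (b + 1) * (e a b / e a (b + 1)) * u (a + 2) b) /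
      (f a b * (e a (b - 1) / e a b))"
    unfolding u_moved_def col_move_at[OF a] 2 using a by simp
  have e2: "f (a + 1) (b + 1) * e a (b + 1) - f a (b + 1) * e a b = \<kappa> a"
    using e[OF a, of "b + 1"] by simp
  have u2: "f (a + 1) b * u (a + 1) b - f (a + 1) (b + 1) * u (a + 2) b = \<kappa>' b"
    using u[OF b, of "a + 1"] unfolding 2 .
  note tet = tetrahedron[OF nz(1)[of a b] nz(1)[of "a + 1" b] nz(1)[of a "b + 1"] nz(1)[of "a + 1" "b + 1"]
    nz(2)[of a "b - 1"] nz(2)[of a b] nz(2)[of a "b + 1"] nz(3)[of a b] nz(3)[of "a + 1" b] nz(3)[of "a + 2" b]
    e[OF a] e2 u[OF b] u2, folded em um]
  have "e_moved a (b + 1) = e a (b + 1)" "u_moved a b = u a b"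
    using L(2)[OF b] J(1)[OF a] by (simp_all add: e_moved_def u_moved_def)
  then show "fr (a + 1) (b + 1) * e_moved a (b + 1) - fr a (b + 1) * e_moved a b = \<kappa> a"
    "fc a b * u_moved a b - fc a (b + 1) * u_moved (a + 1) b = \<kappa>' b"
    unfolding row_move_at[OF b] col_move_at[OF a] 2 using tet(1,2) by simp_all
  show "u a b * u (a + 2) b * e a b * e_moved a b = e a (b - 1) * e a (b + 1) * u (a + 1) b * u_moved (a + 1) b"
    by (rule tet(3))
qed

lemma move_nonzero: "fc a b \<noteq> 0" "fr a b \<noteq> 0"
  by (simp_all add: col_move_def row_move_def nz)

lemma e_moved_recurrence:
  assumes a: "J a"
  shows "fr (a + 1) b * e_moved a b - fr a b * e_moved a (b - 1) = \<kappa> a"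
proof -
  consider "L b" | "L (b - 1)" | "\<not> L b" "\<not> L (b - 1)" by blast
  then show ?thesis
  proof cases
    case 1
    then have "e_moved a (b - 1) = e a (b - 1)" using L by (simp add: e_moved_def)
    then show ?thesis using 1 move_nonzero by (simp add: e_moved_def)
  next
    case 2
    then show ?thesis using block_identities(1)[OF a 2] by simp
  next
    case 3
    then show ?thesis using e[OF a] by (simp add: e_moved_def row_move_def)
  qed
qed

lemma u_moved_recurrence:
  assumes b: "L b"
  shows "fc a b * u_moved a b - fc a (b + 1) * u_moved (a + 1) b = \<kappa>' b"
proof -
  consider "J (a - 1)" | "J a" | "\<not> J a" "\<not> J (a - 1)" by blast
  then show ?thesis
  proof cases
    case 1
    then have "u_moved (a + 1) b = u (a + 1) b" using J[of "a - 1"] by (simp add: u_moved_def)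
    then show ?thesis using 1 move_nonzero by (simp add: u_moved_def)
  next
    case 2
    then show ?thesis using block_identities(2)[OF 2 b] by simp
  next
    case 3
    then show ?thesis using u[OF b] by (simp add: u_moved_def col_move_def)
  qed
qed

lemma moves_commute_at_block:
  assumes a: "J a" and b: "L b" and nz': "e_moved a b \<noteq> 0" "u_moved (a + 1) b \<noteq> 0"
    and c: "c = a \<or> c = a + 1" and d: "d = b \<or> d = b + 1"
  shows "col_move J e_moved fr c d = row_move L u_moved fc c d"
proof -
  have 2: "a + 1 + 1 = a + 2" by simp
  have keep: "e_moved a (b + 1) = e a (b + 1)" "e_moved a (b - 1) = e a (b - 1)"
    "u_moved a b = u a b" "u_moved (a + 2) b = u (a + 2) b"
    using L[OF b] J[OF a] by (simp_all add: e_moved_def u_moved_def add.commute[of 1])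
  have col: "col_move J e_moved g a y = g (a + 1) y * (e_moved a y / e_moved a (y - 1))"
    "col_move J e_moved g (a + 1) y = g a y * (e_moved a (y - 1) / e_moved a y)" for g y
    using a J by (simp_all add: col_move_def)
  have row: "row_move L u_moved g x b = g x (b + 1) * (u_moved (x + 1) b / u_moved x b)"
    "row_move L u_moved g x (b + 1) = g x b * (u_moved x b / u_moved (x + 1) b)" for g x
    using b L by (simp_all add: row_move_def)
  note nzs = nz' nz(2)[of a "b - 1"] nz(2)[of a b] nz(2)[of a "b + 1"] nz(3)[of a b] nz(3)[of "a + 1" b] nz(3)[of "a + 2" b]
  have "u a b * u (a + 2) b * e a b * e_moved a b = e a (b - 1) * e a (b + 1) * u (a + 1) b * u_moved (a + 1) b"
    by (rule block_identities(3)[OF a b])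
  \<comment> \<open>The third tetrahedron identity eliminates \<open>u_moved\<close>; the four
    entries of the block then agree as Laurent monomials in the weights.\<close>
  then have um: "u_moved (a + 1) b = u a b * u (a + 2) b * e a b * e_moved a b / (e a (b - 1) * e a (b + 1) * u (a + 1) b)"
    using nzs by (simp add: field_simps)
  show ?thesis
    using c d nzs by (elim disjE) (simp_all only: col row row_move_at[OF b] col_move_at[OF a] keep 2 um
        add_diff_cancel_right', simp_all add: field_simps)
qed

lemma moves_commute:
  assumes "\<And>a b. J a \<Longrightarrow> e_moved a b \<noteq> 0" "\<And>a b. L b \<Longrightarrow> u_moved a b \<noteq> 0"
  shows "col_move J e_moved fr = row_move L u_moved fc"
proof (intro ext)
  fix a b
  have cases_J: "\<exists>a'. J a' \<and> (a = a' \<or> a = a' + 1)" if "J a \<or> J (a - 1)"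
    using that by (metis diff_add_cancel)
  have cases_L: "\<exists>b'. L b' \<and> (b = b' \<or> b = b' + 1)" if "L b \<or> L (b - 1)"
    using that by (metis diff_add_cancel)
  consider "J a \<or> J (a - 1)" "L b \<or> L (b - 1)" | "\<not> J a" "\<not> J (a - 1)" | "\<not> L b" "\<not> L (b - 1)" by blast
  then show "col_move J e_moved fr a b = row_move L u_moved fc a b"
  proof cases
    case 1
    then obtain a' b' where "J a'" "L b'" "a = a' \<or> a = a' + 1" "b = b' \<or> b = b' + 1"
      using cases_J cases_L by blast
    then show ?thesis by (intro moves_commute_at_block assms)
  next
    case 2
    then show ?thesis
      by (cases "J (a + 1)") (simp_all add: col_move_def row_move_def u_moved_def)
  next
    case 3
    then show ?thesis
      by (simp add: col_move_def row_move_def e_moved_def)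
  qed
qed

end


section \<open>From free weights back to the R-matrix\<close>

lemma col_move_cong:
  assumes "\<And>a. J a \<Longrightarrow> \<exists>c. c \<noteq> 0 \<and> (\<forall>b. e' a b = c * e a b)"
  shows "col_move J e' g = col_move J e g"
proof (intro ext)
  fix a b
  have "e' a b / e' a (b - 1) = e a b / e a (b - 1) \<and> e' a (b - 1) / e' a b = e a (b - 1) / e a b" if "J a" for a
    using assms[OF that] by auto
  then show "col_move J e' g a b = col_move J e g a b" by (simp add: col_move_def)
qed

lemma row_move_cong:
  assumes "\<And>b. L b \<Longrightarrow> \<exists>c. c \<noteq> 0 \<and> (\<forall>a. u' a b = c * u a b)"
  shows "row_move L u' g = row_move L u g"
proof (intro ext)
  fix a b
  have "u' a b / u' (a + 1) b = u a b / u (a + 1) b \<and> u' (a + 1) b / u' a b = u (a + 1) b / u a b" if "L b" for b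
    using assms[OF that] by auto
  then show "row_move L u' g a b = row_move L u g a b" by (simp add: row_move_def)
qed

text \<open>Both axes are reversed because \<open>Q~\<close> numbers its columns by
  \<open>\<bb> + 1 - b\<close> and its rows decrease with \<open>a\<close>. The inverse is the flip
  with \<open>k\<close> and \<open>k'\<close> exchanged.\<close>

definition flip :: "int \<Rightarrow> int \<Rightarrow> (int \<Rightarrow> int \<Rightarrow> complex) \<Rightarrow> int \<Rightarrow> int \<Rightarrow> complex" where
  "flip k k' f = (\<lambda>a b. f (k - b) (k' - a))"

lemma flip_flip [simp]: "flip k' k (flip k k' f) = f"
  by (simp add: flip_def)

definition col_eps :: "nat \<Rightarrow> (int \<Rightarrow> int \<Rightarrow> complex) \<Rightarrow> int \<Rightarrow> int \<Rightarrow> complex" where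
  "col_eps n f a b = eps n (f a) (f (a + 1)) b"

lemma col_op_eq_move: "col_op m n j f = col_move (\<lambda>a. int m dvd a - j) (col_eps n f) f"
proof (intro ext)
  fix a b
  have "a - 1 - j = a - j - 1" by simp
  show "col_op m n j f a b = col_move (\<lambda>a. int m dvd a - j) (col_eps n f) f a b"
    by (simp add: \<open>a - 1 - j = a - j - 1\<close> col_op_def col_move_def col_eps_def R_fst_def R_snd_def)
qed

text \<open>The rows \<open>b + 1\<close>, \<open>b\<close> are the columns
  \<open>k' - 1 - b\<close>, \<open>k' - b\<close> of the flipped array, whence the offset
  1.\<close>

definition row_eps :: "int \<Rightarrow> int \<Rightarrow> nat \<Rightarrow> (int \<Rightarrow> int \<Rightarrow> complex) \<Rightarrow> int \<Rightarrow> int \<Rightarrow> complex" where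
  "row_eps k k' n f a b = col_eps n (flip k k' f) (k' - 1 - b) (k - a)"

lemma row_op_eq_move:
  "flip k' k (col_op m n l (flip k k' f)) = row_move (\<lambda>b. int m dvd k' - 1 - b - l) (row_eps k k' n f) f"
proof (intro ext)
  fix a b
  have "k' - 1 - (b - 1) - l = k' - b - l" "k' - 1 - b - l = k' - b - l - 1" "k - (k - a + 1) = a - 1"
    "k' - (k' - b - 1) = b + 1" "k' - 1 - (b - 1) = k' - b" "k' - 1 - b = k' - b - 1" "k - (a + 1) = k - a - 1" by simp_all
  then show "flip k' k (col_op m n l (flip k k' f)) a b =
      row_move (\<lambda>b. int m dvd k' - 1 - b - l) (row_eps k k' n f) f a b"
    by (simp add: flip_def col_op_eq_move col_move_def row_move_def row_eps_def algebra_simps)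
qed

lemma col_eps_recurrence:
  assumes "n > 0" "f \<in> torus_fun m n h"
  shows "f (a + 1) b * col_eps n f a b - f a b * col_eps n f a (b - 1) =
    window_prod n (f (a + 1)) 0 - window_prod n (f a) 0"
  unfolding col_eps_def by (rule eps_recurrence[OF assms(1) torus_funD(1)[OF assms(2)] torus_funD(1)[OF assms(2)]])

lemma col_eps_nonzero:
  assumes "n > 0" "f \<in> torus_fun m n h"
  shows "col_eps n f a b \<noteq> 0"
  unfolding col_eps_def by (rule eps_nonzero[OF assms(1) torus_funD(1)[OF assms(2)] torus_funD(1)[OF assms(2)]])

lemma col_eps_unique:
  assumes "n > 0" "f \<in> torus_fun m n h"
    and "\<And>b. g (b + int n) = g b" "\<And>b. f (a + 1) b * g b - f a b * g (b - 1) = \<kappa>" "g b0 \<noteq> 0"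
  shows "\<exists>c. c \<noteq> 0 \<and> (\<forall>b. g b = c * col_eps n f a b)"
  unfolding col_eps_def using eps_unique[OF assms(1) torus_funD(1)[OF assms(2)] torus_funD(1)[OF assms(2)] assms(3-5)] .

lemma col_eps_periodic:
  assumes "f \<in> torus_fun m n h"
  shows "col_eps n f a (b + int n) = col_eps n f a b"
  unfolding col_eps_def by (rule eps_periodic[OF torus_funD(1)[OF assms] torus_funD(1)[OF assms]])

lemma dvd_add_periodic:
  fixes a j :: int
  shows "int m dvd int n \<Longrightarrow> int m dvd a + int n - j \<longleftrightarrow> int m dvd a - j"
  using dvd_offset_iff[of "int m" "int n" "a + int n - j" "a - j"] by simp

text \<open>\<open>e_moved\<close> and \<open>u_moved\<close> are candidates for the weights of the
  array after the other move. The local lemmas give their recurrences, the divisibilities make the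
  patterns \<open>L\<close> and \<open>J\<close> compatible with the periods \<open>n\<close> and
  \<open>n'\<close>, and uniqueness makes the candidates nonzero multiples of the true weights.
  Uniqueness accepts any constant right-hand side, so the products of the moved columns need not be
  computed.\<close>

lemma col_row_commute:
  assumes m: "m \<ge> 2" "m' \<ge> 2" and n: "n > 0" "n' > 0" and dv: "m' dvd n" "m dvd n'"
    and flip: "\<And>g. g \<in> torus_fun m n h \<longleftrightarrow> flip k k' g \<in> torus_fun m' n' h'"
    and f: "f \<in> torus_fun m n h"
  shows "col_op m n j (flip k' k (col_op m' n' l (flip k k' f))) =
    flip k' k (col_op m' n' l (flip k k' (col_op m n j f)))"
proof -
  define J where "J = (\<lambda>a. int m dvd a - j)"
  define L where "L = (\<lambda>b. int m' dvd k' - 1 - b - l)"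
  let ?e = "col_eps n f" and ?u = "row_eps k k' n' f"
  define \<kappa> where "\<kappa> a = window_prod n (f (a + 1)) 0 - window_prod n (f a) 0" for a
  define \<kappa>' where "\<kappa>' b = window_prod n' (flip k k' f (k' - 1 - b + 1)) 0 - window_prod n' (flip k k' f (k' - 1 - b)) 0" for b
  have row_rec: "g a b * row_eps k k' n' g a b - g a (b + 1) * row_eps k k' n' g (a + 1) b =
      window_prod n' (flip k k' g (k' - 1 - b + 1)) 0 - window_prod n' (flip k k' g (k' - 1 - b)) 0"
    if "g \<in> torus_fun m n h" for g a b
  proof -
    have g': "flip k k' g \<in> torus_fun m' n' h'" using that flip by blast
    have "flip k k' g (k' - 1 - b + 1) (k - a) = g a b" "flip k k' g (k' - 1 - b) (k - a) = g a (b + 1)"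
      by (simp_all add: flip_def add.commute[of 1])
    then show ?thesis
      using col_eps_recurrence[OF n(2) g', of "k' - 1 - b" "k - a"] by (simp add: row_eps_def diff_diff_eq)
  qed
  have f': "flip k k' f \<in> torus_fun m' n' h'" using f flip by blast
  interpret local_moves J L f ?e ?u \<kappa> \<kappa>'
  proof
    show "J a \<Longrightarrow> \<not> J (a - 1)" "J a \<Longrightarrow> \<not> J (a + 1)" for a
      using not_dvd_near[of "int m" "a - j" 1] m(1) by (simp_all add: J_def algebra_simps)
    show "L b \<Longrightarrow> \<not> L (b - 1)" "L b \<Longrightarrow> \<not> L (b + 1)" for b
      using not_dvd_near[of "int m'" "k' - 1 - b - l" 1] m(2) by (simp_all add: L_def algebra_simps)
    show "f a b \<noteq> 0" "col_eps n f a b \<noteq> 0" "row_eps k k' n' f a b \<noteq> 0" for a b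
      by (rule torus_funD(3)[OF f], rule col_eps_nonzero[OF n(1) f],
          unfold row_eps_def, rule col_eps_nonzero[OF n(2) f'])
    show "f (a + 1) b * col_eps n f a b - f a b * col_eps n f a (b - 1) = \<kappa> a" for a b
      unfolding \<kappa>_def by (rule col_eps_recurrence[OF n(1) f])
    show "f a b * row_eps k k' n' f a b - f a (b + 1) * row_eps k k' n' f (a + 1) b = \<kappa>' b" for a b
      unfolding \<kappa>'_def by (rule row_rec[OF f])
  qed
  have fc: "col_op m n j f = fc" by (simp only: col_op_eq_move J_def)
  have fr: "flip k' k (col_op m' n' l (flip k k' f)) = fr" by (simp only: row_op_eq_move L_def)
  have fc_in: "fc \<in> torus_fun m n h" unfolding fc[symmetric] by (rule col_op_closed[OF m(1) n(1) f])
  have fr_in: "fr \<in> torus_fun m n h"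
    using col_op_closed[OF m(2) n(2) f'] unfolding fr[symmetric] flip by simp
  have fc_flip: "flip k k' fc \<in> torus_fun m' n' h'" using fc_in flip by blast
  have row_per: "g (a + int n') b = g a b" if "flip k k' g \<in> torus_fun m' n' h'" for g a b
    using torus_funD(4)[OF that, of "k' - b" "k - a - int n'"] by (simp add: flip_def)
  have J_per: "J (a + int n') = J a" "J (a + int n' - 1) = J (a - 1)" for a
    using dvd_add_periodic[of m n' a j] dvd_add_periodic[of m n' "a - 1" j] dv(2)
    by (simp_all add: J_def algebra_simps)
  have L_per: "L (b + int n) = L b" for b
  proof -
    have "int m' dvd int n" using dv by simp
    from dvd_offset_iff[OF this, of "k' - 1 - b - l" "k' - 1 - (b + int n) - l"]
    show ?thesis by (simp add: L_def)
  qed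
  have e_scaled: "\<exists>c. c \<noteq> 0 \<and> (\<forall>b. e_moved a b = c * col_eps n fr a b)" if a: "J a" for a
  proof -
    \<comment> \<open>Uniqueness asks for one nonzero value. Where \<open>L\<close> fails, the
      candidate equals the old weight; such a place exists because
      \<open>m' \<ge> 2\<close>.\<close>
    have "\<not> L (k' - l)" using m(2) by (simp add: L_def)
    then obtain b0 where "\<not> L b0" by blast
    then have e0: "e_moved a b0 \<noteq> 0" using nz by (simp add: e_moved_def)
    have per: "e_moved a (b + int n) = e_moved a b" for b
    proof -
      have "?e a (b + int n - 1) = ?e a (b - 1)"
        using col_eps_periodic[OF f, of a "b - 1"] by (simp add: algebra_simps)
      then show ?thesis
        unfolding e_moved_def L_per torus_funD(4)[OF fr_in] by (simp only: col_eps_periodic[OF f])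
    qed
    show ?thesis
      by (rule col_eps_unique[where g = "e_moved a", OF n(1) fr_in per e_moved_recurrence[OF a] e0])
  qed
  have u_scaled: "\<exists>c. c \<noteq> 0 \<and> (\<forall>a. u_moved a b = c * row_eps k k' n' fc a b)" if b: "L b" for b
  proof -
    have "\<not> J (j + 2 - 1)" using m(1) by (simp add: J_def)
    then obtain a0 where "\<not> J (a0 - 1)" by blast
    then have u0: "u_moved (k - (k - a0)) b \<noteq> 0" using nz by (simp add: u_moved_def)
    have u_per: "u_moved (k - (\<beta> + int n')) b = u_moved (k - \<beta>) b" for \<beta>
    proof -
      have per: "?u (a + int n') b = ?u a b" for a
        using col_eps_periodic[OF f', of "k' - 1 - b" "k - a - int n'"] by (simp add: row_eps_def algebra_simps)
      have "u_moved (a + int n') b = u_moved a b" for a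
        using per[of a] per[of "a + 1"] row_per[OF fc_flip, of a] 
        by (simp add: u_moved_def J_per add.assoc add.commute[of 1])
      from this[of "k - \<beta> - int n'"] show ?thesis by (simp add: algebra_simps)
    qed
    have u_rec: "flip k k' fc (k' - 1 - b + 1) \<beta> * u_moved (k - \<beta>) b
        - flip k k' fc (k' - 1 - b) \<beta> * u_moved (k - (\<beta> - 1)) b = \<kappa>' b" for \<beta>
      using u_moved_recurrence[OF b, of "k - \<beta>"] by (simp add: flip_def algebra_simps)
    obtain c where c: "c \<noteq> 0" "\<forall>\<beta>. u_moved (k - \<beta>) b = c * col_eps n' (flip k k' fc) (k' - 1 - b) \<beta>"
      using col_eps_unique[where g = "\<lambda>\<beta>. u_moved (k - \<beta>) b", OF n(2) fc_flip u_per u_rec u0] by blast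
    show ?thesis
    proof (intro exI conjI allI)
      show "u_moved a b = c * row_eps k k' n' fc a b" for a
        using c(2)[rule_format, of "k - a"] by (simp add: row_eps_def)
    qed (rule c(1))
  qed
  \<comment> \<open>Only now is nonvanishing known: the candidates were built from the constants
    \<open>\<kappa>\<close> and \<open>\<kappa>'\<close>, which may be negative, so positivity does
    not give it directly.\<close>
  have "e_moved a b \<noteq> 0" if "J a" for a b
    using e_scaled[OF that] col_eps_nonzero[OF n(1) fr_in] by (metis mult_eq_0_iff)
  moreover have "u_moved a b \<noteq> 0" if "L b" for a b
    using u_scaled[OF that] col_eps_nonzero[OF n(2) fc_flip] unfolding row_eps_def by (metis mult_eq_0_iff)
  ultimately have "col_move J e_moved fr = row_move L u_moved fc" by (rule moves_commute)
  moreover have "col_move J e_moved fr = col_move J (col_eps n fr) fr"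
    by (rule col_move_cong[OF e_scaled])
  moreover have "row_move L u_moved fc = row_move L (row_eps k k' n' fc) fc"
    by (rule row_move_cong[OF u_scaled])
  moreover have "col_op m n j fr = col_move J (col_eps n fr) fr" by (simp only: col_op_eq_move J_def)
  moreover have "flip k' k (col_op m' n' l (flip k k' fc)) = row_move L (row_eps k k' n' fc) fc"
    by (simp only: row_op_eq_move L_def)
  ultimately show ?thesis unfolding fc fr by (simp only:)
qed

section \<open>Coxeter groups by generators and relations\<close>

lemma coxeter_eq_lists: "coxeter_eq S m v w \<Longrightarrow> v \<in> lists S \<and> w \<in> lists S"
proof (induction rule: coxeter_eq.induct)
  case (rel u v i j)
  then have "set (concat (replicate k [i, j])) \<subseteq> S" for k by (induction k) auto
  with rel show ?case by (auto simp: in_lists_conv_set)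
qed auto

lemma coxeter_eq_append:
  assumes "coxeter_eq S m u v" "x \<in> lists S" "y \<in> lists S"
  shows "coxeter_eq S m (x @ u @ y) (x @ v @ y)"
  using assms
proof (induction rule: coxeter_eq.induct)
  case (refl w)
  then show ?case by (intro coxeter_eq.refl) simp
next
  case (sym v w)
  then show ?case using coxeter_eq.sym by blast
next
  case (trans u v w)
  then show ?case using coxeter_eq.trans[of S m "x @ u @ y" "x @ v @ y" "x @ w @ y"] by simp
next
  case (rel u v i j)
  then show ?case using coxeter_eq.rel[of "x @ u" S "v @ y" i j m] by simp
qed

lemma coxeter_eq_append2:
  assumes "coxeter_eq S m u u'" "coxeter_eq S m v v'"
  shows "coxeter_eq S m (u @ v) (u' @ v')"
proof -
  have "u' \<in> lists S" "v \<in> lists S" using assms coxeter_eq_lists by blast+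
  then show ?thesis
    using coxeter_eq.trans[of S m "u @ v" "u' @ v" "u' @ v'"]
      coxeter_eq_append[OF assms(1), of "[]" v] coxeter_eq_append[OF assms(2), of u' "[]"] by simp
qed

lemma coxeter_class_eq:
  assumes "coxeter_eq S m u v"
  shows "coxeter_class S m u = coxeter_class S m v"
proof -
  have "coxeter_eq S m u w \<longleftrightarrow> coxeter_eq S m v w" for w
    using coxeter_eq.trans[OF coxeter_eq.sym[OF assms], of w] coxeter_eq.trans[OF assms, of w] by blast
  then show ?thesis by (simp add: coxeter_class_def)
qed

lemma coxeter_mult:
  assumes "u \<in> lists S" "v \<in> lists S"
  shows "coxeter_class S m u \<otimes>\<^bsub>coxeter_group S m\<^esub> coxeter_class S m v = coxeter_class S m (u @ v)"
proof -
  have "(\<exists>u'. coxeter_eq S m u u' \<and> (\<exists>v'. coxeter_eq S m v v' \<and> coxeter_eq S m (u' @ v') w)) \<longleftrightarrow>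
      coxeter_eq S m (u @ v) w" for w
  proof
    assume "\<exists>u'. coxeter_eq S m u u' \<and> (\<exists>v'. coxeter_eq S m v v' \<and> coxeter_eq S m (u' @ v') w)"
    then obtain u' v' where e: "coxeter_eq S m u u'" "coxeter_eq S m v v'" "coxeter_eq S m (u' @ v') w" by blast
    show "coxeter_eq S m (u @ v) w" by (rule coxeter_eq.trans[OF coxeter_eq_append2[OF e(1,2)] e(3)])
  next
    assume "coxeter_eq S m (u @ v) w"
    then show "\<exists>u'. coxeter_eq S m u u' \<and> (\<exists>v'. coxeter_eq S m v v' \<and> coxeter_eq S m (u' @ v') w)"
      using coxeter_eq.refl[OF assms(1), of m] coxeter_eq.refl[OF assms(2), of m] by blast
  qed
  then show ?thesis by (simp add: coxeter_group_def coxeter_class_def)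
qed

lemma coxeter_carrier: "carrier (coxeter_group S m) = coxeter_class S m ` lists S"
  and coxeter_one: "\<one>\<^bsub>coxeter_group S m\<^esub> = coxeter_class S m []"
  by (simp_all add: coxeter_group_def)

lemma coxeter_group_is_group:
  assumes "\<And>i. i \<in> S \<Longrightarrow> m i i = 1"
  shows "group (coxeter_group S m)"
proof (rule groupI)
  let ?G = "coxeter_group S m" and ?c = "coxeter_class S m"
  show "x \<otimes>\<^bsub>?G\<^esub> y \<in> carrier ?G" if xy: "x \<in> carrier ?G" "y \<in> carrier ?G" for x y
  proof -
    obtain u v where "u \<in> lists S" "v \<in> lists S" "x = ?c u" "y = ?c v" using xy unfolding coxeter_carrier by blast
    then show ?thesis unfolding coxeter_carrier by (intro image_eqI[of _ _ "u @ v"]) (simp_all add: coxeter_mult)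
  qed
  show "\<one>\<^bsub>?G\<^esub> \<in> carrier ?G" by (auto simp: coxeter_carrier coxeter_one)
  show "x \<otimes>\<^bsub>?G\<^esub> y \<otimes>\<^bsub>?G\<^esub> z = x \<otimes>\<^bsub>?G\<^esub> (y \<otimes>\<^bsub>?G\<^esub> z)"
    if "x \<in> carrier ?G" "y \<in> carrier ?G" "z \<in> carrier ?G" for x y z
    using that unfolding coxeter_carrier by (elim imageE) (simp add: coxeter_mult)
  show "\<one>\<^bsub>?G\<^esub> \<otimes>\<^bsub>?G\<^esub> x = x" if "x \<in> carrier ?G" for x
    using that unfolding coxeter_carrier coxeter_one by (elim imageE) (simp add: coxeter_mult)
  show "\<exists>y\<in>carrier ?G. y \<otimes>\<^bsub>?G\<^esub> x = \<one>\<^bsub>?G\<^esub>" if x: "x \<in> carrier ?G" for x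
  proof -
    obtain w where w: "w \<in> lists S" "x = ?c w" using x by (auto simp: coxeter_carrier)
    \<comment> \<open>Since \<open>m i i = 1\<close>, the word \<open>[i, i]\<close> is a relator,
      and the reversed word is an inverse.\<close>
    have "coxeter_eq S m (rev w @ w) []"
      using w(1)
    proof (induction w)
      case Nil
      show ?case by (simp add: coxeter_eq.refl)
    next
      case (Cons i w)
      have "coxeter_eq S m (rev w @ concat (replicate (m i i) [i, i]) @ w) (rev w @ w)"
        using assms Cons.hyps by (intro coxeter_eq.rel) (auto simp: in_lists_conv_set)
      then have "coxeter_eq S m (rev (i # w) @ i # w) (rev w @ w)" using Cons.hyps assms by simp
      then show ?case using Cons.IH by (rule coxeter_eq.trans)
    qed
    then have "?c (rev w) \<otimes>\<^bsub>?G\<^esub> x = \<one>\<^bsub>?G\<^esub>"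
      using w coxeter_class_eq by (simp add: coxeter_mult coxeter_one in_lists_conv_set)
    then show ?thesis using w by (intro bexI[of _ "?c (rev w)"]) (auto simp: coxeter_carrier in_lists_conv_set)
  qed
qed

section \<open>Evaluating words in a group\<close>

context group
begin

definition word_eval :: "('i \<Rightarrow> 'a) \<Rightarrow> 'i list \<Rightarrow> 'a" where
  "word_eval g w = foldr (\<lambda>i x. g i \<otimes> x) w \<one>"

lemma word_eval_simps [simp]: "word_eval g [] = \<one>" "word_eval g (i # w) = g i \<otimes> word_eval g w"
  by (simp_all add: word_eval_def)

lemma word_eval_closed: "(\<And>i. i \<in> S \<Longrightarrow> g i \<in> carrier G) \<Longrightarrow> w \<in> lists S \<Longrightarrow> word_eval g w \<in> carrier G"
  by (induction w) auto

lemma word_eval_append: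
  assumes "\<And>i. i \<in> S \<Longrightarrow> g i \<in> carrier G" "u \<in> lists S" "v \<in> lists S"
  shows "word_eval g (u @ v) = word_eval g u \<otimes> word_eval g v"
  using assms(2)
proof (induction u)
  case Nil
  show ?case using word_eval_closed[of S g v] assms by simp
next
  case (Cons i u)
  then show ?case using word_eval_closed[of S g] assms by (simp add: m_assoc)
qed

text \<open>The universal property of the presentation (von Dyck), on the level of words.\<close>

lemma word_eval_coxeter_eq:
  assumes g: "\<And>i. i \<in> S \<Longrightarrow> g i \<in> carrier G"
    and rels: "\<And>i j. i \<in> S \<Longrightarrow> j \<in> S \<Longrightarrow> m i j \<noteq> 0 \<Longrightarrow> (g i \<otimes> g j) [^] m i j = \<one>"
  shows "coxeter_eq S m u v \<Longrightarrow> word_eval g u = word_eval g v"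
proof (induction rule: coxeter_eq.induct)
  case (rel u v i j)
  have "concat (replicate k [i, j]) \<in> lists S \<and> word_eval g (concat (replicate k [i, j])) = (g i \<otimes> g j) [^] k" for k
  proof (induction k)
    case (Suc k)
    have "(g i \<otimes> g j) [^] Suc k = (g i \<otimes> g j) \<otimes> (g i \<otimes> g j) [^] k"
      using rel(3,4) g by (intro nat_pow_Suc2) simp
    then show ?case using Suc rel(3,4) g by (simp add: m_assoc del: nat_pow_Suc)
  qed simp
  then show ?case using rel rels[OF rel(3-5)] word_eval_append[of S g] word_eval_closed[of S g] g by simp
qed simp_all

end

section \<open>The extended affine symmetric group\<close>

lemma semidirect_simps:
  "carrier (semidirect K \<theta> H) = carrier K \<times> carrier H"
  "(k, x) \<otimes>\<^bsub>semidirect K \<theta> H\<^esub> (k', x') = (k \<otimes>\<^bsub>K\<^esub> k', x \<otimes>\<^bsub>H\<^esub> \<theta> k x')"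
  "\<one>\<^bsub>semidirect K \<theta> H\<^esub> = (\<one>\<^bsub>K\<^esub>, \<one>\<^bsub>H\<^esub>)"
  by (simp_all add: semidirect_def)

lemma semidirect_group:
  assumes "group K" "group H"
    and hom: "\<And>k. k \<in> carrier K \<Longrightarrow> \<theta> k \<in> hom H H"
    and mult: "\<And>k k' x. k \<in> carrier K \<Longrightarrow> k' \<in> carrier K \<Longrightarrow> x \<in> carrier H \<Longrightarrow> \<theta> (k \<otimes>\<^bsub>K\<^esub> k') x = \<theta> k (\<theta> k' x)"
    and one: "\<And>x. x \<in> carrier H \<Longrightarrow> \<theta> \<one>\<^bsub>K\<^esub> x = x"
  shows "group (semidirect K \<theta> H)"
proof -
  interpret K: group K by fact
  interpret H: group H by fact
  have closed: "\<theta> k x \<in> carrier H" if "k \<in> carrier K" "x \<in> carrier H" for k x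
    using hom[OF that(1)] that by (auto simp: hom_def)
  have hm: "\<theta> k (x \<otimes>\<^bsub>H\<^esub> y) = \<theta> k x \<otimes>\<^bsub>H\<^esub> \<theta> k y" if "k \<in> carrier K" "x \<in> carrier H" "y \<in> carrier H" for k x y
    using hom[OF that(1)] that by (auto simp: hom_def)
  have h1: "\<theta> k \<one>\<^bsub>H\<^esub> = \<one>\<^bsub>H\<^esub>" if "k \<in> carrier K" for k
    using hom_one[OF hom[OF that]] assms(2) by blast
  show ?thesis
  proof (rule groupI)
    fix x assume "x \<in> carrier (semidirect K \<theta> H)"
    then obtain k y where x: "x = (k, y)" "k \<in> carrier K" "y \<in> carrier H" by (auto simp: semidirect_simps)
    let ?z = "(inv\<^bsub>K\<^esub> k, \<theta> (inv\<^bsub>K\<^esub> k) (inv\<^bsub>H\<^esub> y))"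
    have "?z \<otimes>\<^bsub>semidirect K \<theta> H\<^esub> x = \<one>\<^bsub>semidirect K \<theta> H\<^esub>"
      using x by (simp add: semidirect_simps hm[symmetric] h1)
    moreover have "?z \<in> carrier (semidirect K \<theta> H)" using x by (simp add: semidirect_simps closed)
    ultimately show "\<exists>y\<in>carrier (semidirect K \<theta> H). y \<otimes>\<^bsub>semidirect K \<theta> H\<^esub> x = \<one>\<^bsub>semidirect K \<theta> H\<^esub>"
      by blast
  qed (auto simp: semidirect_simps closed mult one hm K.m_assoc H.m_assoc)
qed

text \<open>The pair \<open>(k, x)\<close> stands for the product of \<open>x\<close> and
  \<open>k\<close> in this order, as the factor \<open>\<theta> k x'\<close> in the multiplication
  shows. Multiplying two pairs moves \<open>k\<close> past the second \<open>x\<close>, which is the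
  hypothesis \<open>twist\<close>.\<close>

lemma semidirect_hom:
  assumes "group G" "group (semidirect K \<theta> H)" "group K" "group H"
    and \<phi>: "\<phi> \<in> hom H G" and \<psi>: "\<psi> \<in> hom K G"
    and \<theta>: "\<And>k x. k \<in> carrier K \<Longrightarrow> x \<in> carrier H \<Longrightarrow> \<theta> k x \<in> carrier H"
    and twist: "\<And>k x. k \<in> carrier K \<Longrightarrow> x \<in> carrier H \<Longrightarrow> \<psi> k \<otimes>\<^bsub>G\<^esub> \<phi> x = \<phi> (\<theta> k x) \<otimes>\<^bsub>G\<^esub> \<psi> k"
  shows "group_hom (semidirect K \<theta> H) G (\<lambda>(k, x). \<phi> x \<otimes>\<^bsub>G\<^esub> \<psi> k)"
proof (intro group_hom.intro group_hom_axioms.intro homI assms)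
  interpret G: group G by fact
  have c: "\<phi> x \<in> carrier G" "\<psi> k \<in> carrier G" if "x \<in> carrier H" "k \<in> carrier K" for x k
    using \<phi> \<psi> that by (auto simp: hom_def)
  show "(case x of (k, x) \<Rightarrow> \<phi> x \<otimes>\<^bsub>G\<^esub> \<psi> k) \<in> carrier G" if "x \<in> carrier (semidirect K \<theta> H)" for x
    using that c by (auto simp: semidirect_simps)
  fix x y assume "x \<in> carrier (semidirect K \<theta> H)" "y \<in> carrier (semidirect K \<theta> H)"
  then obtain k u l v where xy: "x = (k, u)" "y = (l, v)" "k \<in> carrier K" "l \<in> carrier K" "u \<in> carrier H" "v \<in> carrier H"
    by (auto simp: semidirect_simps)
  have "\<phi> (u \<otimes>\<^bsub>H\<^esub> \<theta> k v) \<otimes>\<^bsub>G\<^esub> \<psi> (k \<otimes>\<^bsub>K\<^esub> l) = \<phi> u \<otimes>\<^bsub>G\<^esub> (\<phi> (\<theta> k v) \<otimes>\<^bsub>G\<^esub> \<psi> k) \<otimes>\<^bsub>G\<^esub> \<psi> l"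
    using xy c \<theta> hom_mult[OF \<phi>] hom_mult[OF \<psi>] by (simp add: G.m_assoc)
  also have "\<dots> = (\<phi> u \<otimes>\<^bsub>G\<^esub> \<psi> k) \<otimes>\<^bsub>G\<^esub> (\<phi> v \<otimes>\<^bsub>G\<^esub> \<psi> l)"
    using xy c twist[of k v, symmetric] by (simp add: G.m_assoc)
  finally show "(case x \<otimes>\<^bsub>semidirect K \<theta> H\<^esub> y of (k, x) \<Rightarrow> \<phi> x \<otimes>\<^bsub>G\<^esub> \<psi> k) =
      (case x of (k, x) \<Rightarrow> \<phi> x \<otimes>\<^bsub>G\<^esub> \<psi> k) \<otimes>\<^bsub>G\<^esub> (case y of (k, x) \<Rightarrow> \<phi> x \<otimes>\<^bsub>G\<^esub> \<psi> k)"
    by (simp add: xy semidirect_simps)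
qed

lemma integer_mod_group_simps:
  assumes "N > 0"
  shows "carrier (integer_mod_group N) = {0..<int N}" "\<one>\<^bsub>integer_mod_group N\<^esub> = 0"
    "x \<otimes>\<^bsub>integer_mod_group N\<^esub> y = (x + y) mod int N"
  using assms by (simp_all add: carrier_integer_mod_group mult_integer_mod_group)

section \<open>Rotation of the affine diagram\<close>

context
  fixes a :: nat
  assumes a: "a > 0"
begin

definition "rotate_node k l = nat ((int l - k) mod int a)"

lemma int_rotate_node: "int (rotate_node k l) = (int l - k) mod int a"
  using a by (simp add: rotate_node_def)

lemma rotate_node_less: "rotate_node k l < a"
  using a by (simp add: rotate_node_def nat_less_iff)

lemma rotate_node_add: "rotate_node k (rotate_node k' l) = rotate_node (k + k') l"
proof -
  have "int (rotate_node k (rotate_node k' l)) = (int l - k' - k) mod int a"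
    by (simp add: int_rotate_node mod_diff_left_eq)
  also have "\<dots> = int (rotate_node (k + k') l)" by (simp add: int_rotate_node algebra_simps)
  finally show ?thesis by simp
qed

lemma rotate_node_cong:
  assumes "int a dvd k - k'" shows "rotate_node k l = rotate_node k' l"
proof -
  have "(int l - k) mod int a = (int l - k') mod int a"
    using assms by (simp add: mod_eq_dvd_iff dvd_diff_commute)
  then show ?thesis by (simp add: rotate_node_def)
qed

lemma rotate_node_0: "l < a \<Longrightarrow> rotate_node 0 l = l"
  by (simp add: rotate_node_def nat_mod_distrib)

lemma rotate_node_in: "l \<in> affine_A_nodes a \<Longrightarrow> rotate_node k l \<in> affine_A_nodes a"
  using rotate_node_less by (auto simp: affine_A_nodes_def split: if_splits)

text \<open>Used with \<open>c = 0\<close> for equality of nodes and with \<open>c = 1\<close> for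
  adjacency, so that rotation is an automorphism of the diagram.\<close>

lemma cong_rotate_node:
  "[rotate_node k i + c = rotate_node k j] (mod a) \<longleftrightarrow> [i + c = j] (mod a)"
proof -
  have "[rotate_node k i + c = rotate_node k j] (mod a) \<longleftrightarrow>
      [int (rotate_node k i + c) = int (rotate_node k j)] (mod int a)"
    by (simp only: cong_int_iff)
  also have "\<dots> \<longleftrightarrow> [int i - k + int c = int j - k] (mod int a)"
    unfolding of_nat_add int_rotate_node cong_def by (simp only: mod_add_left_eq mod_mod_trivial)
  also have "\<dots> \<longleftrightarrow> [int (i + c) = int j] (mod int a)"
    by (simp add: cong_iff_dvd_diff algebra_simps)
  finally show ?thesis by (simp only: cong_int_iff)
qed

lemma affine_A_matrix_rotate:
  assumes "i \<in> affine_A_nodes a" "j \<in> affine_A_nodes a"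
  shows "affine_A_matrix a (rotate_node k i) (rotate_node k j) = affine_A_matrix a i j"
proof -
  have "i < a" "j < a" using assms by (auto simp: affine_A_nodes_def split: if_splits)
  then have "rotate_node k i = rotate_node k j \<longleftrightarrow> i = j"
    using cong_rotate_node[of k i 0 j] rotate_node_less by (simp add: cong_def)
  moreover have "cyc_adjacent a (rotate_node k i) (rotate_node k j) = cyc_adjacent a i j"
    unfolding cyc_adjacent_def by (simp only: cong_rotate_node)
  ultimately show ?thesis unfolding affine_A_matrix_def by simp
qed

lemma lists_rotate: "w \<in> lists (affine_A_nodes a) \<Longrightarrow> map (rotate_node k) w \<in> lists (affine_A_nodes a)"
  using rotate_node_in by (auto simp: in_lists_conv_set)

lemma map_rotate_0: "w \<in> lists (affine_A_nodes a) \<Longrightarrow> map (rotate_node 0) w = w"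
  by (intro map_idI) (auto simp: in_lists_conv_set affine_A_nodes_def rotate_node_0 split: if_splits)

lemma map_rotate_add: "map (rotate_node k) (map (rotate_node k') w) = map (rotate_node (k + k')) w"
  by (simp add: rotate_node_add)

abbreviation "affine_eq \<equiv> coxeter_eq (affine_A_nodes a) (affine_A_matrix a)"

lemma coxeter_eq_rotate:
  "affine_eq u v \<Longrightarrow>
    affine_eq (map (rotate_node k) u) (map (rotate_node k) v)"
proof (induction rule: coxeter_eq.induct)
  case (rel u v i j)
  have "map (rotate_node k) (concat (replicate n [i, j])) = concat (replicate n [rotate_node k i, rotate_node k j])" for n
    by (induction n) auto
  then show ?case
    using coxeter_eq.rel[of "map (rotate_node k) u" "affine_A_nodes a" "map (rotate_node k) v" "rotate_node k i" "rotate_node k j" "affine_A_matrix a"]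
      rel lists_rotate rotate_node_in affine_A_matrix_rotate[OF rel(3,4), of k] by simp
next
  case (trans u v w)
  show ?case by (rule coxeter_eq.trans[OF trans.IH])
next
  case (sym v w)
  show ?case by (rule coxeter_eq.sym[OF sym.IH])
next
  case (refl w)
  show ?case by (rule coxeter_eq.refl[OF lists_rotate[OF refl]])
qed

abbreviation "affine_class \<equiv> coxeter_class (affine_A_nodes a) (affine_A_matrix a)"

text \<open>\<open>diagram_rotation\<close> takes the image of a set of words; that this image is an
  entire class follows by applying the inverse rotation.\<close>

lemma diagram_rotation_class:
  assumes w: "w \<in> lists (affine_A_nodes a)"
  shows "diagram_rotation a k (affine_class w) = affine_class (map (rotate_node k) w)"
proof -
  have rot: "(\<lambda>l. nat ((int l - k) mod int a)) = rotate_node k" by (simp add: rotate_node_def fun_eq_iff)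
  show ?thesis unfolding diagram_rotation_def rot coxeter_class_def
  proof (intro equalityI subsetI)
    fix v assume "v \<in> map (rotate_node k) ` {v. affine_eq w v}"
    then show "v \<in> {v. affine_eq (map (rotate_node k) w) v}"
      using coxeter_eq_rotate by auto
  next
    fix v assume "v \<in> {v. affine_eq (map (rotate_node k) w) v}"
    then have v: "affine_eq (map (rotate_node k) w) v" by simp
    then have "v \<in> lists (affine_A_nodes a)" using coxeter_eq_lists by blast
    then have "v = map (rotate_node k) (map (rotate_node (- k)) v)"
      unfolding map_rotate_add by (simp add: map_rotate_0)
    moreover have "affine_eq w (map (rotate_node (- k)) v)"
      using coxeter_eq_rotate[OF v, of "- k"] unfolding map_rotate_add by (simp add: map_rotate_0[OF w])
    ultimately show "v \<in> map (rotate_node k) ` {v. affine_eq w v}"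
      by blast
  qed
qed

lemma affine_sym_group_is_group: "group (affine_sym_group a)"
  unfolding affine_sym_group_def by (rule coxeter_group_is_group) (simp add: affine_A_matrix_def)

lemma affine_sym_group_simps:
  "carrier (affine_sym_group a) = affine_class ` lists (affine_A_nodes a)"
  "\<one>\<^bsub>affine_sym_group a\<^esub> = affine_class []"
  "u \<in> lists (affine_A_nodes a) \<Longrightarrow> v \<in> lists (affine_A_nodes a) \<Longrightarrow>
    affine_class u \<otimes>\<^bsub>affine_sym_group a\<^esub> affine_class v = affine_class (u @ v)"
  by (simp_all add: affine_sym_group_def coxeter_carrier coxeter_one coxeter_mult)

lemma ext_affine_sym_group_is_group:
  assumes N: "N > 0" "a dvd N"
  shows "group (ext_affine_sym_group N a)"
  unfolding ext_affine_sym_group_def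
proof (rule semidirect_group[OF group_integer_mod_group affine_sym_group_is_group])
  fix k
  show "diagram_rotation a k \<in> hom (affine_sym_group a) (affine_sym_group a)"
  proof (rule homI)
    fix x assume "x \<in> carrier (affine_sym_group a)"
    then obtain u where u: "u \<in> lists (affine_A_nodes a)" "x = affine_class u" by (auto simp: affine_sym_group_simps)
    then show "diagram_rotation a k x \<in> carrier (affine_sym_group a)"
      using lists_rotate by (auto simp: diagram_rotation_class affine_sym_group_simps)
    fix y assume "y \<in> carrier (affine_sym_group a)"
    then obtain v where v: "v \<in> lists (affine_A_nodes a)" "y = affine_class v" by (auto simp: affine_sym_group_simps)
    then show "diagram_rotation a k (x \<otimes>\<^bsub>affine_sym_group a\<^esub> y) =
        diagram_rotation a k x \<otimes>\<^bsub>affine_sym_group a\<^esub> diagram_rotation a k y"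
      using u lists_rotate by (simp add: diagram_rotation_class affine_sym_group_simps)
  qed
  fix x assume "x \<in> carrier (affine_sym_group a)"
  then obtain u where u: "u \<in> lists (affine_A_nodes a)" "x = affine_class u" by (auto simp: affine_sym_group_simps)
  then show "diagram_rotation a \<one>\<^bsub>integer_mod_group N\<^esub> x = x"
    by (simp add: integer_mod_group_simps[OF N(1)] diagram_rotation_class map_rotate_0)
  fix k'
  \<comment> \<open>Reduction modulo \<open>N\<close> leaves the rotation unchanged because
    \<open>a\<close> divides \<open>N\<close>.\<close>
  have "int a dvd (k + k') mod int N - (k + k')"
    using N(2) by (metis dvd_trans dvd_minus_mod dvd_diff_commute of_nat_dvd_iff)
  then have "map (rotate_node ((k + k') mod int N)) u = map (rotate_node k) (map (rotate_node k') u)"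
    unfolding map_rotate_add by (intro map_cong HOL.refl rotate_node_cong)
  then show "diagram_rotation a (k \<otimes>\<^bsub>integer_mod_group N\<^esub> k') x = diagram_rotation a k (diagram_rotation a k' x)"
    using u by (simp only: integer_mod_group_simps[OF N(1)] diagram_rotation_class lists_rotate)
qed

end


section \<open>Commuting generated subgroups and the homomorphism from the extended group\<close>

lemma (in group) subgroup_centralizer:
  assumes "C \<subseteq> carrier G"
  shows "subgroup {x \<in> carrier G. \<forall>y\<in>C. x \<otimes> y = y \<otimes> x} G" (is "subgroup ?Z G")
proof (rule subgroupI)
  show "?Z \<noteq> {}" using assms by (auto intro!: exI[of _ \<one>])
  fix x assume x: "x \<in> ?Z"
  have "inv x \<otimes> y = y \<otimes> inv x" if "y \<in> C" for y
  proof -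
    have c: "x \<in> carrier G" "y \<in> carrier G" "x \<otimes> y = y \<otimes> x" using x assms that by auto
    have "inv x \<otimes> y = inv x \<otimes> (y \<otimes> x) \<otimes> inv x" using c(1,2) by (simp add: m_assoc)
    also have "\<dots> = y \<otimes> inv x" unfolding c(3)[symmetric] using c(1,2) by (simp add: m_assoc[symmetric])
    finally show ?thesis .
  qed
  then show "inv x \<in> ?Z" using x by auto
  fix z assume z: "z \<in> ?Z"
  have "x \<otimes> z \<otimes> y = y \<otimes> (x \<otimes> z)" if "y \<in> C" for y
  proof -
    have c: "x \<in> carrier G" "y \<in> carrier G" "z \<in> carrier G" "x \<otimes> y = y \<otimes> x" "z \<otimes> y = y \<otimes> z"
      using x z assms that by auto
    have "x \<otimes> z \<otimes> y = x \<otimes> (y \<otimes> z)" using c(1-3) by (simp add: m_assoc c(5))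
    also have "\<dots> = y \<otimes> x \<otimes> z" unfolding c(4)[symmetric] using c(1-3) by (simp add: m_assoc)
    finally show ?thesis using c(1-3) by (simp add: m_assoc)
  qed
  then show "x \<otimes> z \<in> ?Z" using x z by auto
qed auto

text \<open>Two passes through centralizers: \<open>generate G A\<close> lies in the centralizer of
  \<open>B\<close>, and then \<open>generate G B\<close> in that of the single element
  \<open>x\<close>.\<close>

lemma (in group) generate_commute:
  assumes "A \<subseteq> carrier G" "B \<subseteq> carrier G" and "\<And>x y. x \<in> A \<Longrightarrow> y \<in> B \<Longrightarrow> x \<otimes> y = y \<otimes> x"
    and "x \<in> generate G A" "y \<in> generate G B"
  shows "x \<otimes> y = y \<otimes> x"
proof -
  have "generate G A \<subseteq> {x \<in> carrier G. \<forall>y\<in>B. x \<otimes> y = y \<otimes> x}"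
    by (rule generate_subgroup_incl[OF _ subgroup_centralizer[OF assms(2)]]) (use assms in auto)
  then have x: "x \<in> carrier G" "\<forall>y\<in>B. x \<otimes> y = y \<otimes> x" using assms(4) by auto
  have "generate G B \<subseteq> {y \<in> carrier G. \<forall>z\<in>{x}. y \<otimes> z = z \<otimes> y}"
    by (rule generate_subgroup_incl[OF _ subgroup_centralizer]) (use assms(2) x in auto)
  then show ?thesis using assms(5) by auto
qed

text \<open>The homomorphism sends a word in the Coxeter generators followed by a power of the rotation to the
  corresponding product.\<close>

theorem (in group) ext_affine_sym_group_action:
  fixes a N :: nat and s :: "nat \<Rightarrow> 'a" and p :: 'a
  assumes a: "a > 0" "N > 0" "a dvd N" and p: "p \<in> carrier G" "p [^] N = \<one>"
    and s: "\<And>l. a \<ge> 2 \<Longrightarrow> s l \<in> carrier G" "\<And>l. a \<ge> 2 \<Longrightarrow> s (l mod a) = s l"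
    and s0: "a \<ge> 2 \<Longrightarrow> s 0 = p \<otimes> s 1 \<otimes> inv p"
    and braid: "\<And>l. a \<ge> 3 \<Longrightarrow> s l \<otimes> s (l + 1) \<otimes> s l = s (l + 1) \<otimes> s l \<otimes> s (l + 1)"
    and far: "\<And>j l. a \<ge> 2 \<Longrightarrow> \<not> [j = l] (mod a) \<Longrightarrow> \<not> cyc_adjacent a j l \<Longrightarrow> s j \<otimes> s l = s l \<otimes> s j"
    and square: "\<And>l. a \<ge> 2 \<Longrightarrow> s l \<otimes> s l = \<one>"
    and rotate: "\<And>l. a \<ge> 2 \<Longrightarrow> p \<otimes> s (l + 1) = s l \<otimes> p"
  shows "\<exists>\<rho>. group_hom (ext_affine_sym_group N a) G \<rho> \<and> (\<forall>l\<in>{1..<a}. \<rho> (W_s N a l) = s l) \<and>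
    \<rho> (W_pi N a) = p \<and> \<rho> ` carrier (ext_affine_sym_group N a) = generate G (insert p (s ` {1..<a}))"
proof -
  let ?S = "affine_A_nodes a" and ?m = "affine_A_matrix a" and ?K = "integer_mod_group N" and ?H = "affine_sym_group a"
  let ?c = "coxeter_class ?S ?m" and ?ev = "word_eval s"
  \<comment> \<open>Letters exist only for \<open>a \<ge> 2\<close>, as
    \<open>affine_A_nodes 1\<close> is empty. So the hypotheses guarded by \<open>a \<ge> 2\<close>
    apply to every letter, and for \<open>a = 1\<close> only powers of \<open>p\<close>
    remain.\<close>
  have node: "a \<ge> 2" "l < a" if "l \<in> ?S" for l
    using that a(1) by (auto simp: affine_A_nodes_def split: if_splits)
  have sc: "s l \<in> carrier G" if "l \<in> ?S" for l using s(1) node[OF that] by blast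
  have cong_s: "s i = s j" if "[i = j] (mod a)" "a \<ge> 2" for i j
    using s(2)[OF that(2), of i] s(2)[OF that(2), of j] that(1) by (simp add: cong_def)
  have cube: "(x \<otimes> y) [^] (3::nat) = \<one>"
    if "x \<in> carrier G" "y \<in> carrier G" "x \<otimes> x = \<one>" "y \<otimes> y = \<one>" "x \<otimes> y \<otimes> x = y \<otimes> x \<otimes> y" for x y
  proof -
    have "(x \<otimes> y) [^] (3::nat) = (x \<otimes> y \<otimes> x) \<otimes> (y \<otimes> x \<otimes> y)"
      using that(1,2) by (simp add: numeral_3_eq_3 m_assoc)
    also have "\<dots> = x \<otimes> (y \<otimes> (x \<otimes> x) \<otimes> y) \<otimes> x"
      unfolding that(5)[symmetric] using that(1,2) by (simp add: m_assoc)
    also have "\<dots> = \<one>" using that by simp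
    finally show ?thesis .
  qed
  have rels: "(s i \<otimes> s j) [^] ?m i j = \<one>" if i: "i \<in> ?S" and j: "j \<in> ?S" and m: "?m i j \<noteq> 0" for i j
  proof -
    note a2 = node(1)[OF i] and c = sc[OF i] sc[OF j]
    \<comment> \<open>For \<open>a = 2\<close> the two nodes are adjacent with matrix entry 0,
      excluded by the assumption \<open>m\<close>; hence adjacency comes with
      \<open>a \<ge> 3\<close>.\<close>
    consider "i = j" | "i \<noteq> j" "cyc_adjacent a i j" "a \<ge> 3" | "i \<noteq> j" "\<not> cyc_adjacent a i j"
      using m a2 by (force simp: affine_A_matrix_def split: if_splits)
    then show ?thesis
    proof cases
      case 1
      then show ?thesis using square[OF a2] c by (simp add: affine_A_matrix_def)
    next
      case 2
      have "s i \<otimes> s j \<otimes> s i = s j \<otimes> s i \<otimes> s j"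
        using 2(2) unfolding cyc_adjacent_def
      proof
        assume "[i + 1 = j] (mod a)"
        then show ?thesis using cong_s[OF _ a2] braid[OF 2(3), of i] by simp
      next
        assume "[j + 1 = i] (mod a)"
        then show ?thesis using cong_s[OF _ a2] braid[OF 2(3), of j] by simp
      qed
      then show ?thesis using cube c square[OF a2] 2 by (simp add: affine_A_matrix_def)
    next
      case 3
      then have "\<not> [i = j] (mod a)" using node[OF i] node[OF j] by (simp add: cong_def)
      then have ji: "s j \<otimes> s i = s i \<otimes> s j" by (rule far[OF a2 _ 3(2), symmetric])
      have "s i \<otimes> s j \<otimes> (s i \<otimes> s j) = s i \<otimes> (s j \<otimes> s i) \<otimes> s j" using c by (simp add: m_assoc)
      also have "\<dots> = (s i \<otimes> s i) \<otimes> (s j \<otimes> s j)" unfolding ji using c by (simp add: m_assoc)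
      finally show ?thesis using 3 c square[OF a2] by (simp add: affine_A_matrix_def numeral_2_eq_2)
    qed
  qed
  \<comment> \<open>An arbitrary word of the class is evaluated; by \<open>rels\<close> the choice
    does not matter.\<close>
  define \<phi> where "\<phi> A = ?ev (SOME w. w \<in> A)" for A
  have \<phi>: "\<phi> (?c w) = ?ev w" if w: "w \<in> lists ?S" for w
  proof -
    have "w \<in> ?c w" using coxeter_eq.refl[OF w, of ?m] by (simp add: coxeter_class_def)
    then have "(SOME v. v \<in> ?c w) \<in> ?c w" by (rule someI)
    then have "coxeter_eq ?S ?m w (SOME v. v \<in> ?c w)" by (simp add: coxeter_class_def)
    then have "?ev w = ?ev (SOME v. v \<in> ?c w)" using word_eval_coxeter_eq[where S = ?S and m = ?m and g = s, OF sc rels] by blast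
    then show ?thesis by (simp add: \<phi>_def)
  qed
  have ev_closed: "?ev w \<in> carrier G" if "w \<in> lists ?S" for w
    using word_eval_closed[of ?S s, OF sc that] .
  have \<phi>_hom: "\<phi> \<in> hom ?H G"
  proof (rule homI)
    fix x assume "x \<in> carrier ?H"
    then obtain u where u: "u \<in> lists ?S" "x = ?c u" by (auto simp: affine_sym_group_simps[OF a(1)])
    then show "\<phi> x \<in> carrier G" using ev_closed by (simp add: \<phi>)
    fix y assume "y \<in> carrier ?H"
    then obtain v where v: "v \<in> lists ?S" "y = ?c v" by (auto simp: affine_sym_group_simps[OF a(1)])
    have "u @ v \<in> lists ?S" using u(1) v(1) by simp
    then show "\<phi> (x \<otimes>\<^bsub>?H\<^esub> y) = \<phi> x \<otimes> \<phi> y"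
      using word_eval_append[of ?S s, OF sc u(1) v(1)]
      by (simp only: u(2) v(2) \<phi> \<phi>[OF u(1)] \<phi>[OF v(1)] affine_sym_group_simps(3)[OF a(1) u(1) v(1)])
  qed
  have \<psi>_hom: "(\<lambda>k. p [^] nat k) \<in> hom ?K G"
  proof (rule homI)
    fix k l assume "k \<in> carrier ?K" "l \<in> carrier ?K"
    then have kl: "k \<ge> 0" "l \<ge> 0" by (simp_all add: integer_mod_group_simps[OF a(2)])
    have "p [^] (nat (k + l)) = p [^] (N * (nat (k + l) div N) + nat (k + l) mod N)" by simp
    also have "\<dots> = p [^] (N * (nat (k + l) div N)) \<otimes> p [^] (nat (k + l) mod N)"
      by (rule nat_pow_mult[symmetric, OF p(1)])
    also have "p [^] (N * (nat (k + l) div N)) = \<one>"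
      using nat_pow_pow[OF p(1), of N "nat (k + l) div N"] p(2) by simp
    also have "\<one> \<otimes> p [^] (nat (k + l) mod N) = p [^] (nat (k + l) mod N)" using p(1) by simp
    also have "nat (k + l) mod N = nat ((k + l) mod int N)" using kl by (simp add: nat_mod_distrib)
    finally have "p [^] nat ((k + l) mod int N) = p [^] (nat k + nat l)"
      by (simp only: nat_add_distrib[OF kl])
    then show "p [^] nat (k \<otimes>\<^bsub>?K\<^esub> l) = p [^] nat k \<otimes> p [^] nat l"
      by (simp only: integer_mod_group_simps(3)[OF a(2)] nat_pow_mult[OF p(1)])
  qed (use p in simp)
  have rot1: "p \<otimes> s l = s (rotate_node a 1 l) \<otimes> p" if "a \<ge> 2" for l
  proof -
    have "[rotate_node a 1 l + 1 = l] (mod a)"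
    proof -
      have "[int (rotate_node a 1 l + 1) = int l] (mod int a)"
        unfolding of_nat_add int_rotate_node[OF a(1)] cong_def by (simp add: mod_add_left_eq)
      then show ?thesis by (simp only: cong_int_iff)
    qed
    then show ?thesis using rotate[OF that, of "rotate_node a 1 l"] cong_s[OF _ that] by metis
  qed
  have rot: "p [^] k \<otimes> s l = s (rotate_node a (int k) l) \<otimes> p [^] k" if a2: "a \<ge> 2" and l: "l < a" for k l
    using l
  proof (induction k arbitrary: l)
    case 0
    then show ?case using s(1)[OF a2] by (simp add: rotate_node_0[OF a(1)])
  next
    case (Suc k)
    note c = s(1)[OF a2] p(1)
    have "p [^] Suc k \<otimes> s l = p [^] k \<otimes> (p \<otimes> s l)" using c by (simp add: m_assoc)
    also have "\<dots> = p [^] k \<otimes> s (rotate_node a 1 l) \<otimes> p" unfolding rot1[OF a2] using c by (simp add: m_assoc)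
    also have "\<dots> = s (rotate_node a (int k) (rotate_node a 1 l)) \<otimes> p [^] Suc k"
      unfolding Suc.IH[OF rotate_node_less[OF a(1)]] using c by (simp add: m_assoc)
    finally show ?case by (simp add: rotate_node_add[OF a(1)] add.commute)
  qed
  have twist: "p [^] k \<otimes> ?ev w = ?ev (map (rotate_node a (int k)) w) \<otimes> p [^] k" if "w \<in> lists ?S" for k w
    using that
  proof (induction w rule: list.induct)
    case Nil
    show ?case using p(1) by simp
  next
    case (Cons l w)
    then have l: "l \<in> ?S" and w: "w \<in> lists ?S" by simp_all
    note c = sc[OF l] sc[OF rotate_node_in[OF a(1) l, of "int k"]] p(1) ev_closed[OF w]
      ev_closed[OF lists_rotate[OF a(1) w, of "int k"]]
    have "p [^] k \<otimes> ?ev (l # w) = (p [^] k \<otimes> s l) \<otimes> ?ev w" using c by (simp add: m_assoc)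
    also have "\<dots> = s (rotate_node a (int k) l) \<otimes> (p [^] k \<otimes> ?ev w)"
      unfolding rot[OF node[OF l]] using c by (simp add: m_assoc)
    also have "\<dots> = ?ev (map (rotate_node a (int k)) (l # w)) \<otimes> p [^] k"
      unfolding Cons.IH[OF w] using c by (simp add: m_assoc)
    finally show ?case .
  qed
  have rotation_closed: "diagram_rotation a k x \<in> carrier ?H" if x: "x \<in> carrier ?H" for k x
  proof -
    obtain u where u: "u \<in> lists ?S" "x = ?c u" using x by (auto simp: affine_sym_group_simps[OF a(1)])
    show ?thesis
      unfolding u(2) diagram_rotation_class[OF a(1) u(1)] affine_sym_group_simps(1)[OF a(1)]
      by (rule imageI[OF lists_rotate[OF a(1) u(1)]])
  qed
  define \<rho> where "\<rho> = (\<lambda>(k, x). \<phi> x \<otimes> p [^] nat k)"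
  have hom: "group_hom (ext_affine_sym_group N a) G \<rho>"
    unfolding ext_affine_sym_group_def \<rho>_def
  proof (rule semidirect_hom[OF is_group _ group_integer_mod_group affine_sym_group_is_group[OF a(1)] \<phi>_hom \<psi>_hom rotation_closed])
    show "group (semidirect ?K (diagram_rotation a) ?H)"
      using ext_affine_sym_group_is_group[OF a(1) a(2,3)] by (simp add: ext_affine_sym_group_def)
    fix k x assume "k \<in> carrier ?K" "x \<in> carrier ?H"
    then obtain u where u: "u \<in> lists ?S" "x = ?c u" "k \<ge> 0"
      by (auto simp: affine_sym_group_simps[OF a(1)] integer_mod_group_simps[OF a(2)])
    have "p [^] nat k \<otimes> ?ev u = ?ev (map (rotate_node a k) u) \<otimes> p [^] nat k"
      using twist[OF u(1), of "nat k"] u(3) by simp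
    then show "p [^] nat k \<otimes> \<phi> x = \<phi> (diagram_rotation a k x) \<otimes> p [^] nat k"
      unfolding u(2) diagram_rotation_class[OF a(1) u(1)] \<phi>[OF u(1)] \<phi>[OF lists_rotate[OF a(1) u(1)]] .
  qed
  interpret \<rho>: group_hom "ext_affine_sym_group N a" G \<rho> by (rule hom)
  have rho_s: "\<rho> (W_s N a l) = s l" if "l \<in> ?S" for l
    using that \<phi>[of "[l]"] sc by (simp add: \<rho>_def W_s_def)
  have rho_pi: "\<rho> (W_pi N a) = p"
  proof -
    have "p [^] nat (1 mod int N) = p"
    \<comment> \<open>For \<open>N = 1\<close> the exponent is 0, and \<open>p\<close> is trivial by
      \<open>p [^] N = \<one>\<close>.\<close>
    proof (cases "N = 1")
      case True
      then show ?thesis using p by simp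
    next
      case False
      then have "1 mod int N = 1" using a(2) by simp
      then show ?thesis using p(1) by simp
    qed
    then show ?thesis using \<phi>[of "[]"] p(1) by (simp add: \<rho>_def W_pi_def affine_sym_group_simps[OF a(1)])
  qed
  have carrier_W: "carrier (ext_affine_sym_group N a) = {0..<int N} \<times> ?c ` lists ?S"
    by (simp add: ext_affine_sym_group_def semidirect_simps integer_mod_group_simps[OF a(2)] affine_sym_group_simps[OF a(1)])
  let ?gen = "insert p (s ` {1..<a})"
  have gen_sub: "?gen \<subseteq> carrier G" using p s(1) by auto
  interpret gen: subgroup "generate G ?gen" G by (rule generate_is_subgroup[OF gen_sub])
  have in_gen: "x \<in> generate G ?gen" if "x \<in> ?gen" for x using that by (rule generate.incl)
  have gen_s: "s l \<in> generate G ?gen" if "l \<in> ?S" for l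
  proof (cases "l = 0")
    case True
    have "1 \<in> {1..<a}" using node(1)[OF that] by simp
    then have g: "s 1 \<in> generate G ?gen" "p \<in> generate G ?gen" using in_gen by blast+
    show ?thesis unfolding True s0[OF node(1)[OF that]]
      by (rule gen.m_closed[OF gen.m_closed[OF g(2,1)] gen.m_inv_closed[OF g(2)]])
  next
    case False
    then show ?thesis using in_gen node(2)[OF that] by simp
  qed
  have "\<rho> ` carrier (ext_affine_sym_group N a) \<subseteq> generate G ?gen"
  proof
    fix y assume "y \<in> \<rho> ` carrier (ext_affine_sym_group N a)"
    then obtain k w where w: "w \<in> lists ?S" and "y = \<rho> (k, ?c w)" unfolding carrier_W by blast
    then have y: "y = ?ev w \<otimes> p [^] nat k" by (simp only: \<rho>_def prod.case \<phi>)
    have ev: "?ev w \<in> generate G ?gen"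
      using w
    proof (induction w rule: list.induct)
      case Nil
      show ?case unfolding word_eval_simps by (rule gen.one_closed)
    next
      case (Cons l w)
      then have "l \<in> ?S" "?ev w \<in> generate G ?gen" by simp_all
      then show ?case unfolding word_eval_simps by (intro gen.m_closed gen_s)
    qed
    have pow: "p [^] (n::nat) \<in> generate G ?gen" for n
    proof (induction n)
      case 0
      show ?case unfolding nat_pow_0 by (rule gen.one_closed)
    next
      case (Suc n)
      show ?case unfolding nat_pow_Suc by (rule gen.m_closed[OF Suc.IH in_gen]) simp
    qed
    show "y \<in> generate G ?gen" unfolding y by (rule gen.m_closed[OF ev pow])
  qed
  moreover have "generate G ?gen \<subseteq> \<rho> ` carrier (ext_affine_sym_group N a)"
  proof (rule generate_subgroup_incl[OF _ \<rho>.img_is_subgroup])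
    show "?gen \<subseteq> \<rho> ` carrier (ext_affine_sym_group N a)"
    proof
      fix x assume "x \<in> ?gen"
      then consider "x = p" | l where "l \<in> {1..<a}" "x = s l" by blast
      then show "x \<in> \<rho> ` carrier (ext_affine_sym_group N a)"
      proof cases
        case 1
        have "W_pi N a \<in> carrier (ext_affine_sym_group N a)"
          using a(2) unfolding carrier_W by (simp add: W_pi_def affine_sym_group_simps[OF a(1)])
        then show ?thesis using rho_pi 1 by force
      next
        case 2
        then have l: "l \<in> ?S" by (auto simp: affine_A_nodes_def)
        then have "W_s N a l \<in> carrier (ext_affine_sym_group N a)"
          using a(2) unfolding carrier_W by (simp add: W_s_def)
        then show ?thesis using rho_s[OF l] 2 by force
      qed
    qed
  qed
  moreover have "\<forall>l\<in>{1..<a}. \<rho> (W_s N a l) = s l" using rho_s by (auto simp: affine_A_nodes_def)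
  ultimately show ?thesis using hom rho_pi by blast
qed

section \<open>Lifting arrays to the torus\<close>

lemma cyc_range: "n > 0 \<Longrightarrow> 1 \<le> cyc n k \<and> cyc n k \<le> n"
  by (simp add: cyc_def nat_less_iff Suc_le_eq)

lemma int_cyc: "n > 0 \<Longrightarrow> int (cyc n k) = (k - 1) mod int n + 1"
  by (simp add: cyc_def)

lemma cyc_id: "1 \<le> j \<Longrightarrow> j \<le> n \<Longrightarrow> cyc n (int j) = j"
proof -
  assume j: "1 \<le> j" "j \<le> n"
  have "(int j - 1) mod int n = int j - 1" using j by (intro mod_pos_pos_trivial) auto
  then have "int (cyc n (int j)) = int j" using j by (subst int_cyc) auto
  then show "cyc n (int j) = j" by simp
qed

lemma cyc_cong:
  assumes "n > 0"
  shows "cyc n k = cyc n k' \<longleftrightarrow> int n dvd k - k'"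
proof -
  have "cyc n k = cyc n k' \<longleftrightarrow> (k - 1) mod int n = (k' - 1) mod int n"
    using assms by (simp add: cyc_def eq_nat_nat_iff)
  also have "\<dots> \<longleftrightarrow> int n dvd k - k'" by (simp add: mod_eq_dvd_iff)
  finally show ?thesis .
qed

lemma cyc_cyc_add:
  assumes "n > 0" shows "cyc n (int (cyc n k) + t) = cyc n (k + t)"
proof -
  have "int (cyc n k) - k = - (int n * ((k - 1) div int n))"
    using assms by (simp add: int_cyc minus_mult_div_eq_mod[symmetric])
  then have "int n dvd int (cyc n k) + t - (k + t)" by simp
  then show ?thesis using cyc_cong[OF assms] by blast
qed

text \<open>The array does not determine \<open>h\<close>, which only says how it continues beyond
  its last column. The value is chosen later so that two arrangements lift to the same
  function.\<close>

locale arrangement =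
  fixes I :: "'i set" and \<phi> :: "'i \<Rightarrow> nat \<times> nat" and m n :: nat and h :: int
  assumes m: "m > 0" and n: "n > 0"
    and bij: "bij_betw \<phi> I ({1..m} \<times> {1..n})"
begin

text \<open>Steps \<open>(m, h)\<close> bring \<open>(a, b)\<close> back to the columns
  \<open>1..m\<close>; the \<open>a - 1\<close> in the quotient is due to numbering columns from
  1.\<close>

definition index_at :: "int \<Rightarrow> int \<Rightarrow> 'i" where
  "index_at a b = inv_into I \<phi> (cyc m a, cyc n (b - h * ((a - 1) div int m)))"

definition lift :: "('i \<Rightarrow> complex) \<Rightarrow> int \<Rightarrow> int \<Rightarrow> complex" where
  "lift q a b = q (index_at a b)"

lemma finite_index: "finite I"
  using bij_betw_finite[OF bij] by simp

lemma pos_in: "t \<in> I \<Longrightarrow> fst (\<phi> t) \<in> {1..m} \<and> snd (\<phi> t) \<in> {1..n}"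
  using bij_betw_apply[OF bij, of t] by (cases "\<phi> t") simp

lemma index_at_in: "index_at a b \<in> I"
proof -
  have "(cyc m a, cyc n (b - h * ((a - 1) div int m))) \<in> \<phi> ` I"
    using bij cyc_range[OF m] cyc_range[OF n] by (auto simp: bij_betw_def)
  then show ?thesis unfolding index_at_def by (rule inv_into_into)
qed

lemma pos_index_at: "\<phi> (index_at a b) = (cyc m a, cyc n (b - h * ((a - 1) div int m)))"
proof -
  have "(cyc m a, cyc n (b - h * ((a - 1) div int m))) \<in> \<phi> ` I"
    using bij cyc_range[OF m] cyc_range[OF n] by (auto simp: bij_betw_def)
  then show ?thesis unfolding index_at_def by (rule f_inv_into_f)
qed

lemma index_at_eqI:
  assumes "t \<in> I" "fst (\<phi> t) = cyc m a" "snd (\<phi> t) = cyc n (b - h * ((a - 1) div int m))"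
  shows "index_at a b = t"
proof -
  have "\<phi> (index_at a b) = \<phi> t" unfolding pos_index_at using assms by (simp add: prod_eq_iff)
  then show ?thesis using bij index_at_in assms(1) by (auto simp: bij_betw_def inj_on_def)
qed

lemma index_at_fundamental:
  assumes "1 \<le> a" "a \<le> int m"
  shows "index_at a b = inv_into I \<phi> (nat a, cyc n b)"
proof -
  have "(a - 1) div int m = 0" using assms by (simp add: div_pos_pos_trivial)
  moreover have "cyc m a = nat a" using cyc_id[of "nat a" m] assms by simp
  ultimately show ?thesis by (simp add: index_at_def)
qed

lemma index_at_pos: "t \<in> I \<Longrightarrow> index_at (int (fst (\<phi> t))) (int (snd (\<phi> t))) = t"
  using pos_in[of t] by (intro index_at_eqI) (simp_all add: cyc_id div_pos_pos_trivial)

lemma index_at_shift: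
  "index_at a (b + int n) = index_at a b" "index_at (a + int m) (b + h) = index_at a b"
proof -
  have c: "cyc n (x + int n) = cyc n x" for x using cyc_cong[OF n] by simp
  have "(b + int n - h * ((a - 1) div int m)) = (b - h * ((a - 1) div int m)) + int n" by simp
  then show "index_at a (b + int n) = index_at a b" by (simp only: index_at_def c)
  have "(a + int m - 1) div int m = (a - 1) div int m + 1"
    using m div_add_self2[of "int m" "a - 1"] by (simp add: algebra_simps)
  moreover have "cyc m (a + int m) = cyc m a" using cyc_cong[OF m] by simp
  ultimately show "index_at (a + int m) (b + h) = index_at a b"
    by (simp add: index_at_def algebra_simps)
qed

lemma lift_torus_fun: "q \<in> positive_points I \<Longrightarrow> lift q \<in> torus_fun m n h"
  using index_at_in by (auto simp: torus_fun_def pos_periodic_def lift_def index_at_shift positive_points_def PiE_iff)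

text \<open>The fundamental rectangle determines a torus function, which makes \<open>unlift\<close>
  a two-sided inverse of \<open>lift\<close>.\<close>

lemma torus_fun_reduce:
  assumes f: "f \<in> torus_fun m n h"
  shows "f a b = f (int (cyc m a)) (int (cyc n (b - h * ((a - 1) div int m))))"
proof -
  let ?k = "(a - 1) div int m"
  have rows: "f x y = f x (int (cyc n y))" for x y
  proof -
    have "y = int (cyc n y) + ((y - 1) div int n) * int n"
      using n by (simp add: int_cyc algebra_simps)
    then show ?thesis using periodic_mult[of "f x" "int n" "int (cyc n y)" "(y - 1) div int n"] torus_funD(4)[OF f]
      by metis
  qed
  have "f (a' + z * int m) (b' + z * h) = f a' b'" for a' b' z
  proof -
    have "f (a' + (i + 1) * int m) (b' + (i + 1) * h) = f (a' + i * int m) (b' + i * h)" for i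
      using torus_funD(2)[OF f, of "a' + i * int m" "b' + i * h"] by (simp add: algebra_simps)
    then show ?thesis using periodic_mult[of "\<lambda>z. f (a' + z * int m) (b' + z * h)" 1 0 z] by simp
  qed
  from this[of "int (cyc m a)" ?k "b - h * ?k"]
  have "f (int (cyc m a) + ?k * int m) b = f (int (cyc m a)) (b - h * ?k)" by (simp add: algebra_simps)
  moreover have "int (cyc m a) + ?k * int m = a" using m by (simp add: int_cyc algebra_simps)
  ultimately show ?thesis using rows by metis
qed

definition unlift :: "(int \<Rightarrow> int \<Rightarrow> complex) \<Rightarrow> 'i \<Rightarrow> complex" where
  "unlift f = (\<lambda>t\<in>I. f (int (fst (\<phi> t))) (int (snd (\<phi> t))))"

lemma unlift_lift: "q \<in> affine_space I \<Longrightarrow> unlift (lift q) = q"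
  by (auto simp: unlift_def lift_def index_at_pos affine_space_def PiE_iff extensional_def restrict_def fun_eq_iff)

lemma lift_unlift: "f \<in> torus_fun m n h \<Longrightarrow> lift (unlift f) = f"
  by (intro ext) (simp add: lift_def unlift_def index_at_in pos_index_at torus_fun_reduce[symmetric])

lemma unlift_positive: "f \<in> torus_fun m n h \<Longrightarrow> unlift f \<in> positive_points I"
  by (auto simp: unlift_def positive_points_def PiE_iff torus_fun_def pos_periodic_def)

lemma bij_lift: "bij_betw lift (positive_points I) (torus_fun m n h)"
  using lift_torus_fun unlift_lift lift_unlift unlift_positive subsetD[OF positive_points_affine[of I]]
  by (intro bij_betw_byWitness[where f' = unlift]) auto

sublocale positive_coordinates I lift "torus_fun m n h"
  by unfold_locales (rule finite_index, rule bij_lift)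

section \<open>The operators in lifted coordinates\<close>

lemma to_array_lift:
  assumes "1 \<le> i" "i \<le> m"
  shows "to_array I \<phi> q i (cyc n b) = lift q (int i) b"
  using index_at_fundamental[of "int i" b] assms by (simp add: to_array_def lift_def)

text \<open>The rotation by \<open>i\<close> in \<open>E_rot\<close> is a translation of the lift,
  where the cyclic reduction of row indices has disappeared.\<close>

lemma E_rot_eps:
  assumes "1 \<le> l" "l + 1 \<le> m"
  shows "E_rot n (to_array I \<phi> q l) (to_array I \<phi> q (l + 1)) i = eps n (lift q (int l)) (lift q (int l + 1)) (int i)"
proof -
  have "lift q (int l + 1) b = lift q (int (l + 1)) b" for b by (simp add: add.commute)
  then show ?thesis
    using assms to_array_lift[of l q] to_array_lift[of "l + 1" q]
    by (simp add: E_rot_def E_def eps_def rot_def add.commute[of 1])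
qed

lemma coordinate_poly: "(\<lambda>q. lift q a b) \<in> poly_functions I"
  unfolding lift_def by (rule poly_functions.coord[OF index_at_in])

lemma eps_poly: "(\<lambda>q. eps k (lift q a) (lift q a') i) \<in> poly_functions I"
  unfolding eps_def by (intro poly_functions_sum poly_functions.mult poly_functions_prod coordinate_poly) simp_all

lemma of_array_R_columns:
  assumes l: "1 \<le> l" "l + 1 \<le> m"
  shows "of_array I \<phi> (R_columns n l (to_array I \<phi> q)) = unlift (col_op m n (int l) (lift q))"
proof -
  let ?A = "to_array I \<phi> q" and ?f = "lift q"
  have A: "?A i j = ?f (int i) (int j)" if "i \<in> {1..m}" "j \<in> {1..n}" for i j
    using to_array_lift[of i q "int j"] cyc_id[of j n] that by simp
  have "R_columns n l ?A i j = col_op m n (int l) ?f (int i) (int j)" if i: "i \<in> {1..m}" and j: "j \<in> {1..n}" for i j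
  proof -
    have m2: "m \<ge> 2" using l by simp
    have l1: "int l + 1 = int (l + 1)" by simp
    have jj: "int j - 1 = int (j - 1)" using j by simp
    have lm: "l \<in> {1..m}" "l + 1 \<in> {1..m}" using l by auto
    consider "i = l" | "i = l + 1" | "i \<noteq> l" "i \<noteq> l + 1" by blast
    then show ?thesis
    proof cases
      case 1
      have "R_columns n l ?A i j = ?f (int (l + 1)) (int j) * (eps n (?f (int l)) (?f (int l + 1)) (int j) /
          eps n (?f (int l)) (?f (int l + 1)) (int (j - 1)))"
        using 1 A[OF lm(2) j] by (simp add: R_columns_def R_matrix_def E_rot_eps[OF l, simplified])
      moreover have "col_op m n (int l) ?f (int i) (int j) = R_fst n (?f (int l)) (?f (int l + 1)) (int j)"
        using col_op_at(1)[OF m2 n, of "int l" "int l" ?f] 1 by simp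
      ultimately show ?thesis by (simp only: R_fst_def jj l1)
    next
      case 2
      have "R_columns n l ?A i j = ?f (int l) (int j) * (eps n (?f (int l)) (?f (int l + 1)) (int (j - 1)) /
          eps n (?f (int l)) (?f (int l + 1)) (int j))"
        using 2 A[OF lm(1) j] by (simp add: R_columns_def R_matrix_def E_rot_eps[OF l, simplified])
      moreover have "col_op m n (int l) ?f (int l + 1) (int j) = R_snd n (?f (int l)) (?f (int l + 1)) (int j)"
        using col_op_at(2)[OF m2 n, of "int l" "int l" ?f] by simp
      ultimately show ?thesis by (simp only: R_snd_def jj l1 2)
    next
      case 3
      have "\<not> int m dvd int i - int l"
        using 3 i l dvd_imp_le_int[of "int i - int l" "int m"] by auto
      moreover have "\<not> int m dvd int i - int l - 1"
        using 3 i l dvd_imp_le_int[of "int i - int l - 1" "int m"] by auto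
      ultimately show ?thesis using A[OF i j] 3
        by (simp add: R_columns_def col_op_def)
    qed
  qed
  then show ?thesis using pos_in by (auto simp: of_array_def unlift_def)
qed

lemma R_map_rational:
  assumes l: "1 \<le> l" "l + 1 \<le> m"
  shows "R_map I \<phi> n l \<in> rational_reps I"
proof -
  let ?e = "\<lambda>q. eps n (lift q (int l)) (lift q (int l + 1))"
  \<comment> \<open>The domain of \<open>R_map\<close> is the principal open set of
    \<open>d\<close>. The index 0 is included because row 1 also involves the weight at 0.\<close>
  define d where "d = (\<lambda>q. \<Prod>i\<in>{0..n}. ?e q (int i))"
  have d_poly: "d \<in> poly_functions I"
    unfolding d_def by (intro poly_functions_prod eps_poly) simp
  have R: "R_map I \<phi> n l q =
      (if q \<in> affine_space I \<and> d q \<noteq> 0 then Some (unlift (col_op m n (int l) (lift q))) else None)" for q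
    unfolding R_map_def Let_def E_rot_eps[OF l] of_array_R_columns[OF l] d_def by simp
  then have dom: "dom (R_map I \<phi> n l) = {q \<in> affine_space I. d q \<noteq> 0}"
    by (auto simp: dom_def)
  show ?thesis unfolding rational_reps_def mem_Collect_eq
  proof (intro conjI ballI)
    show "zariski_open I (dom (R_map I \<phi> n l))"
      unfolding dom by (rule zariski_open_nonvanishing[OF d_poly])
    have q1: "(\<lambda>t\<in>I. 1) \<in> positive_points I" by (auto simp: positive_points_def)
    then have "d (\<lambda>t\<in>I. 1) \<noteq> 0"
      using lift_torus_fun[OF q1] eps_nonzero[OF n] by (auto simp: d_def torus_fun_def)
    then show "dom (R_map I \<phi> n l) \<noteq> {}"
      unfolding dom using q1 positive_points_affine[of I] by blast
    show "ran (R_map I \<phi> n l) \<subseteq> affine_space I"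
      by (auto simp: ran_def R unlift_def affine_space_def split: if_splits)
    fix t assume t: "t \<in> I"
    let ?a = "int (fst (\<phi> t))" and ?b = "int (snd (\<phi> t))"
    have b: "snd (\<phi> t) \<in> {0..n}" "snd (\<phi> t) - 1 \<in> {0..n}" "?b - 1 = int (snd (\<phi> t) - 1)"
      using pos_in[OF t] by auto
    have e_nz: "?e q ?b \<noteq> 0" "?e q (?b - 1) \<noteq> 0" if "d q \<noteq> 0" for q
      using that b(1,2) unfolding d_def b(3) by auto
    have "\<exists>p\<in>poly_functions I. \<exists>r\<in>poly_functions I. \<forall>q. d q \<noteq> 0 \<longrightarrow> r q \<noteq> 0 \<and> col_op m n (int l) (lift q) ?a ?b = p q / r q"
    proof -
      consider "int m dvd ?a - int l" | "\<not> int m dvd ?a - int l" "int m dvd ?a - int l - 1"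
        | "\<not> int m dvd ?a - int l" "\<not> int m dvd ?a - int l - 1" by blast
      then show ?thesis
      proof cases
        case 1
        then have a: "?a = int l"
          using pos_in[OF t] l dvd_imp_le_int[of "?a - int l" "int m"] by force
        show ?thesis
          by (intro bexI[of _ "\<lambda>q. lift q (int l + 1) ?b * ?e q ?b"] bexI[of _ "\<lambda>q. ?e q (?b - 1)"] allI impI conjI)
            (use 1 a e_nz in \<open>simp_all add: col_op_def R_fst_def eps_poly coordinate_poly poly_functions.mult\<close>)
      next
        case 2
        then have a: "?a = int l + 1"
          using pos_in[OF t] l dvd_imp_le_int[of "?a - int l - 1" "int m"] by force
        show ?thesis
          by (intro bexI[of _ "\<lambda>q. lift q (int l) ?b * ?e q (?b - 1)"] bexI[of _ "\<lambda>q. ?e q ?b"] allI impI conjI)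
            (use 2 a e_nz in \<open>simp_all add: col_op_def R_snd_def eps_poly coordinate_poly poly_functions.mult\<close>)
      next
        case 3
        then show ?thesis
          by (intro bexI[of _ "\<lambda>q. lift q ?a ?b"] bexI[of _ "\<lambda>q. 1"] allI impI conjI)
            (simp_all add: col_op_def coordinate_poly poly_functions.const)
      qed
    qed
    then obtain p r where pr: "p \<in> poly_functions I" "r \<in> poly_functions I"
      "\<forall>q. d q \<noteq> 0 \<longrightarrow> r q \<noteq> 0 \<and> col_op m n (int l) (lift q) ?a ?b = p q / r q" by blast
    show "regular_function I (dom (R_map I \<phi> n l)) (\<lambda>q. the (R_map I \<phi> n l q) t)"
    proof (rule regular_functionI)
      fix x assume "x \<in> dom (R_map I \<phi> n l)"
      then have "d x \<noteq> 0" by (simp add: dom)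
      moreover have "\<forall>y\<in>affine_space I. d y \<noteq> 0 \<longrightarrow>
          y \<in> dom (R_map I \<phi> n l) \<and> r y \<noteq> 0 \<and> the (R_map I \<phi> n l y) t = p y / r y"
        using pr(3) t by (simp add: dom R unlift_def)
      ultimately show "\<exists>g\<in>poly_functions I. \<exists>p\<in>poly_functions I. \<exists>q\<in>poly_functions I. g x \<noteq> 0 \<and>
         (\<forall>y\<in>affine_space I. g y \<noteq> 0 \<longrightarrow>
            y \<in> dom (R_map I \<phi> n l) \<and> q y \<noteq> 0 \<and> the (R_map I \<phi> n l y) t = p y / q y)"
        using d_poly pr(1,2) by (intro bexI[of _ d] bexI[of _ p] bexI[of _ r] conjI)
    qed (auto simp: dom)
  qed
qed

lemma acts_R_map:
  assumes l: "1 \<le> l" "l + 1 \<le> m"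
  shows "acts (rational_class I (R_map I \<phi> n l)) (col_op m n (int l))"
  unfolding acts_by_def
proof (intro conjI bexI[of _ "R_map I \<phi> n l"] ballI HOL.refl R_map_rational l)
  have m2: "m \<ge> 2" using l by simp
  show "col_op m n (int l) ` torus_fun m n h = torus_fun m n h"
  proof (intro equalityI subsetI)
    fix f assume f: "f \<in> torus_fun m n h"
    show "f \<in> col_op m n (int l) ` torus_fun m n h"
      using col_op_closed[OF m2 n f, of "int l"] col_op_involution[OF m2 n f, of "int l"]
      by (intro image_eqI[of _ _ "col_op m n (int l) f"]) simp_all
  next
    fix f assume "f \<in> col_op m n (int l) ` torus_fun m n h"
    then show "f \<in> torus_fun m n h" using col_op_closed[OF m2 n] by (elim imageE) simp
  qed
  fix q assume q: "q \<in> positive_points I"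
  have "E_rot n (to_array I \<phi> q l) (to_array I \<phi> q (l + 1)) i \<noteq> 0" for i
    unfolding E_rot_eps[OF l] using lift_torus_fun[OF q] by (intro eps_nonzero[OF n]) (auto simp: torus_fun_def)
  then have "R_map I \<phi> n l q = Some (unlift (col_op m n (int l) (lift q)))"
    using q positive_points_affine[of I] unfolding R_map_def Let_def of_array_R_columns[OF l] by auto
  then show "\<exists>q'\<in>positive_points I. R_map I \<phi> n l q = Some q' \<and> lift q' = col_op m n (int l) (lift q)"
    using col_op_closed[OF m2 n lift_torus_fun[OF q], of "int l"] by (auto simp: unlift_positive lift_unlift)
qed

lemma torus_fun_translate: "f \<in> torus_fun m n h \<Longrightarrow> (\<lambda>a b. f (a + s) (b + t)) \<in> torus_fun m n h"
proof -
  assume f: "f \<in> torus_fun m n h"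
  have "f (a + s) (b + int n + t) = f (a + s) (b + t)" "f (a + int m + s) (b + h + t) = f (a + s) (b + t)" for a b
    using torus_funD(4)[OF f, of "a + s" "b + t"] torus_funD(2)[OF f, of "a + s" "b + t"]
    by (simp_all add: algebra_simps)
  then show ?thesis using f by (simp add: torus_fun_def pos_periodic_def)
qed

lemma torus_fun_translate_image: "(\<lambda>f a b. f (a + s) (b + t)) ` torus_fun m n h = torus_fun m n h"
proof (intro equalityI subsetI)
  fix f assume "f \<in> torus_fun m n h"
  then have "(\<lambda>a b. f (a + - s) (b + - t)) \<in> torus_fun m n h" by (rule torus_fun_translate)
  then show "f \<in> (\<lambda>f a b. f (a + s) (b + t)) ` torus_fun m n h"
    by (rule rev_image_eqI) simp
qed (auto intro: torus_fun_translate)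

lemma acts_shift_map: "acts (rational_class I (shift_map I \<phi> n)) (\<lambda>f a b. f a (b - 1))"
proof -
  have val: "of_array I \<phi> (shift_rows n (to_array I \<phi> q)) = unlift (\<lambda>a b. lift q a (b - 1))" for q
    using pos_in to_array_lift by (auto simp: of_array_def unlift_def shift_rows_def)
  have S: "shift_map I \<phi> n q = (if q \<in> affine_space I then Some (unlift (\<lambda>a b. lift q a (b - 1))) else None)" for q
    by (simp add: shift_map_def val)
  have dom: "dom (shift_map I \<phi> n) = affine_space I" by (auto simp: dom_def S)
  have "(\<lambda>t\<in>I. 1) \<in> affine_space I" by (simp add: affine_space_def)
  then have ne: "affine_space I \<noteq> {}" by blast
  have rat: "shift_map I \<phi> n \<in> rational_reps I"
    unfolding rational_reps_def mem_Collect_eq dom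
  proof (intro conjI ballI zariski_open_affine ne regular_functionI subset_refl)
    show "ran (shift_map I \<phi> n) \<subseteq> affine_space I"
      by (auto simp: ran_def S unlift_def affine_space_def split: if_splits)
    fix t x assume t: "t \<in> I"
    show "\<exists>g\<in>poly_functions I. \<exists>p\<in>poly_functions I. \<exists>q\<in>poly_functions I. g x \<noteq> 0 \<and>
         (\<forall>y\<in>affine_space I. g y \<noteq> 0 \<longrightarrow>
            y \<in> affine_space I \<and> q y \<noteq> 0 \<and> the (shift_map I \<phi> n y) t = p y / q y)"
      by (intro bexI[of _ "\<lambda>_. 1"] bexI[of _ "\<lambda>q. lift q (int (fst (\<phi> t))) (int (snd (\<phi> t)) - 1)"]
          poly_functions.const coordinate_poly) (simp add: S unlift_def t)
  qed
  show ?thesis unfolding acts_by_def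
  proof (intro conjI bexI[OF _ rat] ballI HOL.refl)
    show "(\<lambda>f a b. f a (b - 1)) ` torus_fun m n h = torus_fun m n h"
      using torus_fun_translate_image[of 0 "- 1"] by simp
    fix q assume q: "q \<in> positive_points I"
    have "(\<lambda>a b. lift q a (b - 1)) \<in> torus_fun m n h"
      using torus_fun_translate[OF lift_torus_fun[OF q], of 0 "- 1"] by simp
    then show "\<exists>q'\<in>positive_points I. shift_map I \<phi> n q = Some q' \<and> lift q' = (\<lambda>a b. lift q a (b - 1))"
      using q positive_points_affine[of I] by (auto simp: S unlift_positive lift_unlift)
  qed
qed

end


section \<open>Two dual arrangements\<close>

context arrangement
begin

abbreviation "G \<equiv> Bir I"

definition s_class :: "nat \<Rightarrow> 'i partial_map set" where
  "s_class l = rational_class I (R_map I \<phi> n l)"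

text \<open>\<open>P\<close> will be the cyclic shift of the dual array, which here translates the
  columns by one; \<open>N\<close> will be the number of rows of that array.\<close>

context
  fixes P :: "'i partial_map set" and N :: nat
  assumes P: "acts P (\<lambda>f a. f (a + 1))" and N: "N > 0"
    and period: "\<And>f a. f \<in> torus_fun m n h \<Longrightarrow> f (a + int N) = f a"
begin

lemma group_G: "group G"
  by (rule group_Bir[OF finite_index])

lemma shift_pow: "((\<lambda>f a. f (a + 1)) ^^ k) f = (\<lambda>a. f (a + int k))" for f :: "int \<Rightarrow> int \<Rightarrow> complex"
  by (induction k) (simp_all add: algebra_simps)

lemma acts_P_pow: "acts (P [^]\<^bsub>G\<^esub> k) (\<lambda>f a. f (a + int k))"
  using acts_pow[OF P, of k] by (rule acts_cong) (simp add: shift_pow)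

lemma P_pow_N: "P [^]\<^bsub>G\<^esub> N = \<one>\<^bsub>G\<^esub>"
  by (rule acts_unique[OF acts_P_pow acts_one]) (simp add: period)

lemma P_carrier: "P \<in> carrier G"
proof (rule acts_Bir[OF P acts_P_pow[of "N - 1"]])
  fix f assume f: "f \<in> torus_fun m n h"
  have "a + 1 + int (N - 1) = a + int N" "a + int (N - 1) + 1 = a + int N" for a using N by simp_all
  then show "(\<lambda>a. f (a + 1 + int (N - 1))) = f" "(\<lambda>a. f (a + int (N - 1) + 1)) = f"
    by (simp_all only: period[OF f])
qed

text \<open>As \<open>P [^] N\<close> is trivial, the inverse is a natural power of
  \<open>P\<close>, so its action is explicit as well.\<close>

lemma acts_P_inv: "acts (inv\<^bsub>G\<^esub> P) (\<lambda>f a. f (a + int (N - 1)))"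
proof -
  interpret group G by (rule group_G)
  have "P [^]\<^bsub>G\<^esub> (N - 1) \<otimes>\<^bsub>G\<^esub> P = P [^]\<^bsub>G\<^esub> Suc (N - 1)" by (simp only: nat_pow_Suc)
  then have "P [^]\<^bsub>G\<^esub> (N - 1) \<otimes>\<^bsub>G\<^esub> P = \<one>\<^bsub>G\<^esub>" using N P_pow_N by simp
  then have "inv\<^bsub>G\<^esub> P = P [^]\<^bsub>G\<^esub> (N - 1)" by (rule inv_equality) (simp_all add: P_carrier)
  then show ?thesis using acts_P_pow by simp
qed

lemma s_class_carrier: "l \<in> {1..<m} \<Longrightarrow> s_class l \<in> carrier G"
proof -
  assume "l \<in> {1..<m}"
  then have l: "1 \<le> l" "l + 1 \<le> m" "m \<ge> 2" by auto
  have S: "acts (s_class l) (col_op m n (int l))" unfolding s_class_def by (rule acts_R_map[OF l(1,2)])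
  show ?thesis by (rule acts_Bir[OF S S]) (rule col_op_involution[OF l(3) n], assumption)+
qed

abbreviation "s_cyclic \<equiv> cyclic_family G m s_class P"

context
  assumes m2: "m \<ge> 2"
begin

text \<open>For \<open>l\<close> divisible by \<open>m\<close>, conjugation by the unit translation
  carries the operator on columns 1 and 2 to columns 0 and 1. Column 0 is the last column up to a
  vertical shift by \<open>h\<close>, so the wrap-around is already built into
  \<open>col_op\<close>.\<close>

lemma acts_s_cyclic: "acts (s_cyclic l) (col_op m n (int l))"
proof (cases "l mod m = 0")
  case True
  have 1: "acts (s_class 1) (col_op m n (int 1))" unfolding s_class_def by (rule acts_R_map) (use m2 in simp_all)
  have "acts (P \<otimes>\<^bsub>G\<^esub> s_class 1 \<otimes>\<^bsub>G\<^esub> inv\<^bsub>G\<^esub> P) (\<lambda>f a. col_op m n (int 1) (\<lambda>a. f (a + int (N - 1))) (a + 1))"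
    by (rule acts_mult[OF acts_mult[OF P 1] acts_P_inv])
  then have "acts (s_cyclic l) (\<lambda>f a. col_op m n (int 1) (\<lambda>a. f (a + int (N - 1))) (a + 1))"
    using True by (simp add: cyclic_family_def)
  then show ?thesis
  proof (rule acts_cong)
    fix f assume f: "f \<in> torus_fun m n h"
    have "a + 1 + int (N - 1) = a + int N" for a using N by simp
    then have "(\<lambda>a. f (a + 1 + int (N - 1))) = f" by (simp only: period[OF f])
    then have "(\<lambda>a. col_op m n (0 + 1) (\<lambda>a. f (a + int (N - 1))) (a + 1)) = col_op m n 0 f"
      unfolding col_op_shift by simp
    moreover have "col_op m n (int l) = col_op m n 0"
      using True by (intro col_op_cong) (simp add: mod_eq_0_iff_dvd)
    ultimately show "(\<lambda>a. col_op m n (int 1) (\<lambda>a. f (a + int (N - 1))) (a + 1)) = col_op m n (int l) f" by simp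
  qed
next
  case False
  have "l mod m < m" using m by simp
  then have "acts (s_class (l mod m)) (col_op m n (int (l mod m)))"
    unfolding s_class_def using False by (intro acts_R_map) simp_all
  moreover have "col_op m n (int (l mod m)) = col_op m n (int l)"
    by (intro col_op_cong) (simp add: zmod_int mod_eq_dvd_iff[symmetric])
  ultimately show ?thesis using False by (simp add: cyclic_family_def)
qed

lemma s_cyclic_carrier: "s_cyclic l \<in> carrier G"
  by (rule acts_Bir[OF acts_s_cyclic[of l] acts_s_cyclic[of l]])
    (rule col_op_involution[OF m2 n], assumption)+

lemma s_cyclic_mod: "s_cyclic (l mod m) = s_cyclic l"
  by (simp add: cyclic_family_def)

lemma s_cyclic_0: "s_cyclic 0 = P \<otimes>\<^bsub>G\<^esub> s_cyclic 1 \<otimes>\<^bsub>G\<^esub> inv\<^bsub>G\<^esub> P"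
  using m2 by (simp add: cyclic_family_def)

lemma s_cyclic_square: "s_cyclic l \<otimes>\<^bsub>G\<^esub> s_cyclic l = \<one>\<^bsub>G\<^esub>"
  by (rule acts_unique[OF acts_mult[OF acts_s_cyclic acts_s_cyclic] acts_one]) (rule col_op_involution[OF m2 n])

lemma s_cyclic_rotate: "P \<otimes>\<^bsub>G\<^esub> s_cyclic (l + 1) = s_cyclic l \<otimes>\<^bsub>G\<^esub> P"
  by (rule acts_unique[OF acts_mult[OF P acts_s_cyclic] acts_mult[OF acts_s_cyclic P]])
    (simp add: col_op_shift[symmetric] add.commute)

lemma s_cyclic_far:
  assumes "\<not> [j = l] (mod m)" "\<not> cyc_adjacent m j l"
  shows "s_cyclic j \<otimes>\<^bsub>G\<^esub> s_cyclic l = s_cyclic l \<otimes>\<^bsub>G\<^esub> s_cyclic j"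
proof (rule acts_unique[OF acts_mult[OF acts_s_cyclic acts_s_cyclic] acts_mult[OF acts_s_cyclic acts_s_cyclic]])
  have c: "[x = y] (mod m) \<longleftrightarrow> int m dvd int x - int y" for x y
    by (simp only: cong_int_iff[symmetric] cong_iff_dvd_diff)
  have d: "int m dvd int l - int j - 1 \<longleftrightarrow> int m dvd int (j + 1) - int l"
    "int m dvd int j - int l - 1 \<longleftrightarrow> int m dvd int (l + 1) - int j"
    using dvd_minus_iff[of "int m" "int l - int j - 1"] dvd_minus_iff[of "int m" "int j - int l - 1"]
    by (simp_all add: algebra_simps)
  show "col_op m n (int j) (col_op m n (int l) f) = col_op m n (int l) (col_op m n (int j) f)" for f
    by (rule col_op_far) (use assms d in \<open>simp_all add: cyc_adjacent_def c\<close>)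
qed

lemma s_cyclic_braid:
  assumes "m \<ge> 3"
  shows "s_cyclic l \<otimes>\<^bsub>G\<^esub> s_cyclic (l + 1) \<otimes>\<^bsub>G\<^esub> s_cyclic l =
    s_cyclic (l + 1) \<otimes>\<^bsub>G\<^esub> s_cyclic l \<otimes>\<^bsub>G\<^esub> s_cyclic (l + 1)"
proof (rule acts_unique[OF acts_mult[OF acts_mult[OF acts_s_cyclic acts_s_cyclic] acts_s_cyclic]
      acts_mult[OF acts_mult[OF acts_s_cyclic acts_s_cyclic] acts_s_cyclic]])
  fix f assume "f \<in> torus_fun m n h"
  then show "col_op m n (int l) (col_op m n (int (l + 1)) (col_op m n (int l) f)) =
      col_op m n (int (l + 1)) (col_op m n (int l) (col_op m n (int (l + 1)) f))"
    using col_op_braid[OF m2 n _ assms, of f h "int l"] by (simp add: add.commute)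
qed

end

lemma action_exists:
  assumes "m dvd N"
  shows "\<exists>\<rho>. group_hom (ext_affine_sym_group N m) G \<rho> \<and> (\<forall>l\<in>{1..<m}. \<rho> (W_s N m l) = s_class l) \<and>
    \<rho> (W_pi N m) = P \<and> \<rho> ` carrier (ext_affine_sym_group N m) = generate G (insert P (s_class ` {1..<m}))"
proof -
  interpret group G by (rule group_G)
  have s: "s_cyclic l = s_class l" if "l \<in> {1..<m}" for l using that by (simp add: cyclic_family_def)
  then have "s_cyclic ` {1..<m} = s_class ` {1..<m}" by (intro image_cong) simp_all
  then show ?thesis
    using ext_affine_sym_group_action[OF m N assms P_carrier P_pow_N, of s_cyclic,
        OF s_cyclic_carrier s_cyclic_mod s_cyclic_0 s_cyclic_braid s_cyclic_far s_cyclic_square s_cyclic_rotate] s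
    by simp
qed

end

end

locale dual_arrangements =
  A: arrangement I \<phi> m n h + B: arrangement I \<psi> m' n' h'
  for I :: "'i set" and \<phi> m n h \<psi> m' n' h' +
  fixes k k' :: int
  assumes dvd: "m' dvd n" "m dvd n'"
    and lift_flip: "\<And>q. B.lift q = flip k k' (A.lift q)"
    and torus_flip: "\<And>g. g \<in> torus_fun m n h \<longleftrightarrow> flip k k' g \<in> torus_fun m' n' h'"
begin

text \<open>The roles of the two arrays are symmetric, so every statement on \<open>A\<close> and
  \<open>shift_B\<close> yields its counterpart for \<open>B\<close> and
  \<open>shift_A\<close>.\<close>

lemma swap: "dual_arrangements I \<psi> m' n' h' \<phi> m n h k' k"
proof (intro dual_arrangements.intro dual_arrangements_axioms.intro dvd A.arrangement_axioms B.arrangement_axioms)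
  show "A.lift q = flip k' k (B.lift q)" for q by (simp add: lift_flip)
  show "g \<in> torus_fun m' n' h' \<longleftrightarrow> flip k' k g \<in> torus_fun m n h" for g
    unfolding torus_flip by simp
qed

text \<open>The operators of the two arrays come in two coordinate systems; to be compared they must
  be expressed in one, and \<open>flip\<close> is the change of coordinates.\<close>

lemma acts_transfer:
  assumes "B.acts C T"
  shows "A.acts C (\<lambda>f. flip k' k (T (flip k k' f)))"
proof -
  obtain f where f: "f \<in> rational_reps I" "C = rational_class I f" and T: "T ` torus_fun m' n' h' = torus_fun m' n' h'"
    and fT: "\<And>q. q \<in> positive_points I \<Longrightarrow> \<exists>q'\<in>positive_points I. f q = Some q' \<and> B.lift q' = T (B.lift q)"
    using assms unfolding acts_by_def by auto
  have flips: "flip k k' ` torus_fun m n h = torus_fun m' n' h'" "flip k' k ` torus_fun m' n' h' = torus_fun m n h"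
  proof -
    show "flip k k' ` torus_fun m n h = torus_fun m' n' h'"
    proof (intro equalityI subsetI)
      fix g assume "g \<in> torus_fun m' n' h'"
      then have "flip k' k g \<in> torus_fun m n h" unfolding torus_flip by simp
      then show "g \<in> flip k k' ` torus_fun m n h" by (intro image_eqI[of _ _ "flip k' k g"]) simp_all
    qed (auto simp: torus_flip)
    then have "flip k' k ` torus_fun m' n' h' = flip k' k ` flip k k' ` torus_fun m n h" by simp
    then show "flip k' k ` torus_fun m' n' h' = torus_fun m n h" by (simp add: image_image)
  qed
  show ?thesis unfolding acts_by_def
  proof (intro conjI bexI[OF _ f(1)] ballI f(2))
    have "(\<lambda>f. flip k' k (T (flip k k' f))) ` torus_fun m n h = flip k' k ` T ` flip k k' ` torus_fun m n h"
      by (simp add: image_image)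
    then show "(\<lambda>f. flip k' k (T (flip k k' f))) ` torus_fun m n h = torus_fun m n h"
      by (simp only: flips T)
    fix q assume "q \<in> positive_points I"
    then obtain q' where q': "q' \<in> positive_points I" "f q = Some q'" "B.lift q' = T (B.lift q)" using fT by blast
    then have "flip k' k (B.lift q') = flip k' k (T (flip k k' (A.lift q)))" by (simp add: lift_flip)
    then have "A.lift q' = flip k' k (T (flip k k' (A.lift q)))" by (simp add: lift_flip)
    then show "\<exists>q'\<in>positive_points I. f q = Some q' \<and> A.lift q' = flip k' k (T (flip k k' (A.lift q)))"
      using q' by blast
  qed
qed

definition shift_A :: "'i partial_map set" where
  "shift_A = rational_class I (shift_map I \<phi> n)"

definition shift_B :: "'i partial_map set" where
  "shift_B = rational_class I (shift_map I \<psi> n')"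

lemma acts_shift_A: "A.acts shift_A (\<lambda>f a b. f a (b - 1))"
  unfolding shift_A_def by (rule A.acts_shift_map)

text \<open>\<open>flip\<close> reverses directions, so lowering a row index of the second array
  raises a column index of the first: hence \<open>a + 1\<close> here against \<open>b - 1\<close>
  in \<open>acts_shift_A\<close>.\<close>

lemma acts_shift_B: "A.acts shift_B (\<lambda>f a. f (a + 1))"
  unfolding shift_B_def
  by (rule A.acts_cong[OF acts_transfer[OF B.acts_shift_map]]) (simp add: flip_def)

lemma period: "f \<in> torus_fun m n h \<Longrightarrow> f (a + int n') = f a"
proof
  fix b assume "f \<in> torus_fun m n h"
  then have "flip k k' f \<in> torus_fun m' n' h'" using torus_flip by blast
  from torus_funD(4)[OF this, of "k' - b" "k - a - int n'"] show "f (a + int n') b = f a b"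
    by (simp add: flip_def)
qed

lemmas shift_B_assms = acts_shift_B B.n period

lemma shifts_commute: "shift_A \<otimes>\<^bsub>Bir I\<^esub> shift_B = shift_B \<otimes>\<^bsub>Bir I\<^esub> shift_A"
  by (rule A.acts_unique[OF A.acts_mult[OF acts_shift_A acts_shift_B] A.acts_mult[OF acts_shift_B acts_shift_A]]) simp

abbreviation "s \<equiv> cyclic_family (Bir I) m A.s_class shift_B"
abbreviation "st \<equiv> cyclic_family (Bir I) m' B.s_class shift_A"

lemma shift_A_s: "m \<ge> 2 \<Longrightarrow> shift_A \<otimes>\<^bsub>Bir I\<^esub> s l = s l \<otimes>\<^bsub>Bir I\<^esub> shift_A"
  by (rule A.acts_unique[OF A.acts_mult[OF acts_shift_A A.acts_s_cyclic[OF shift_B_assms]]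
        A.acts_mult[OF A.acts_s_cyclic[OF shift_B_assms] acts_shift_A]])
    (simp_all add: col_op_translate[where t = "- 1", simplified])

end

text \<open>In the swapped instance the two shifts exchange their names; the rewrites identify them
  with the existing constants.\<close>

sublocale dual_arrangements \<subseteq> dual: dual_arrangements I \<psi> m' n' h' \<phi> m n h k' k
  rewrites "dual_arrangements.shift_A I \<psi> n' = shift_B" and "dual_arrangements.shift_B I \<phi> n = shift_A"
  by (rule swap) (simp_all add: dual_arrangements.shift_A_def[OF swap] dual_arrangements.shift_B_def[OF swap]
      shift_A_def shift_B_def)

context dual_arrangements
begin

lemma s_st:
  assumes "m \<ge> 2" "m' \<ge> 2"
  shows "s j \<otimes>\<^bsub>Bir I\<^esub> st l = st l \<otimes>\<^bsub>Bir I\<^esub> s j"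
proof -
  have s: "A.acts (s j) (col_op m n (int j))" by (rule A.acts_s_cyclic[OF shift_B_assms assms(1)])
  have "B.acts (st l) (col_op m' n' (int l))" by (rule B.acts_s_cyclic[OF dual.shift_B_assms assms(2)])
  then have st: "A.acts (st l) (\<lambda>f. flip k' k (col_op m' n' (int l) (flip k k' f)))" by (rule acts_transfer)
  show ?thesis
    by (rule A.acts_unique[OF A.acts_mult[OF s st] A.acts_mult[OF st s]])
      (rule col_row_commute[OF assms A.n B.n dvd torus_flip])
qed

lemma generators_commute:
  assumes "x \<in> insert shift_B (A.s_class ` {1..<m})" "y \<in> insert shift_A (B.s_class ` {1..<m'})"
  shows "x \<otimes>\<^bsub>Bir I\<^esub> y = y \<otimes>\<^bsub>Bir I\<^esub> x"
proof -
  have sA: "\<exists>l. x = s l \<and> m \<ge> 2" if xA: "x \<in> A.s_class ` {1..<m}"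
  proof -
    obtain l where "l \<in> {1..<m}" "x = A.s_class l" using xA by blast
    then have "x = s l" "m \<ge> 2" by (simp_all add: cyclic_family_def)
    then show ?thesis by blast
  qed
  have sB: "\<exists>l. y = st l \<and> m' \<ge> 2" if yB: "y \<in> B.s_class ` {1..<m'}"
  proof -
    obtain l where "l \<in> {1..<m'}" "y = B.s_class l" using yB by blast
    then have "y = st l" "m' \<ge> 2" by (simp_all add: cyclic_family_def)
    then show ?thesis by blast
  qed
  from assms consider "x = shift_B" "y = shift_A" | "x = shift_B" "y \<in> B.s_class ` {1..<m'}"
    | "x \<in> A.s_class ` {1..<m}" "y = shift_A" | "x \<in> A.s_class ` {1..<m}" "y \<in> B.s_class ` {1..<m'}" by blast
  then show ?thesis
  proof cases
    case 1
    then show ?thesis by (simp only: shifts_commute)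
  next
    case 2
    then obtain l where "y = st l" "m' \<ge> 2" using sB by blast
    then show ?thesis using dual.shift_A_s[of l] 2 by simp
  next
    case 3
    then obtain l where "x = s l" "m \<ge> 2" using sA by blast
    then show ?thesis using shift_A_s[of l] 3 by simp
  next
    case 4
    then obtain j l where "x = s j" "m \<ge> 2" "y = st l" "m' \<ge> 2" using sA sB by blast
    then show ?thesis using s_st by simp
  qed
qed

lemma commuting_actions:
  "\<exists>\<rho> \<rho>t. group_hom (ext_affine_sym_group n' m) (Bir I) \<rho> \<and> group_hom (ext_affine_sym_group n m') (Bir I) \<rho>t \<and>
    (\<forall>l\<in>{1..<m}. \<rho> (W_s n' m l) = A.s_class l) \<and> \<rho> (W_pi n' m) = shift_B \<and>
    \<rho> ` carrier (ext_affine_sym_group n' m) = generate (Bir I) (insert shift_B (A.s_class ` {1..<m})) \<and>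
    (\<forall>l\<in>{1..<m'}. \<rho>t (W_s n m' l) = B.s_class l) \<and> \<rho>t (W_pi n m') = shift_A \<and>
    \<rho>t ` carrier (ext_affine_sym_group n m') = generate (Bir I) (insert shift_A (B.s_class ` {1..<m'})) \<and>
    (\<forall>w\<in>carrier (ext_affine_sym_group n' m). \<forall>wt\<in>carrier (ext_affine_sym_group n m').
       \<rho> w \<otimes>\<^bsub>Bir I\<^esub> \<rho>t wt = \<rho>t wt \<otimes>\<^bsub>Bir I\<^esub> \<rho> w)"
proof -
  let ?gA = "insert shift_B (A.s_class ` {1..<m})" and ?gB = "insert shift_A (B.s_class ` {1..<m'})"
  obtain \<rho> where \<rho>: "group_hom (ext_affine_sym_group n' m) (Bir I) \<rho>" "\<forall>l\<in>{1..<m}. \<rho> (W_s n' m l) = A.s_class l"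
    "\<rho> (W_pi n' m) = shift_B" "\<rho> ` carrier (ext_affine_sym_group n' m) = generate (Bir I) ?gA"
    using A.action_exists[OF shift_B_assms dvd(2)] by blast
  obtain \<rho>t where \<rho>t: "group_hom (ext_affine_sym_group n m') (Bir I) \<rho>t" "\<forall>l\<in>{1..<m'}. \<rho>t (W_s n m' l) = B.s_class l"
    "\<rho>t (W_pi n m') = shift_A" "\<rho>t ` carrier (ext_affine_sym_group n m') = generate (Bir I) ?gB"
    using B.action_exists[OF dual.shift_B_assms dvd(1)] by blast
  have sub: "?gA \<subseteq> carrier (Bir I)" "?gB \<subseteq> carrier (Bir I)"
    using A.P_carrier[OF shift_B_assms] A.s_class_carrier[OF shift_B_assms]
      B.P_carrier[OF dual.shift_B_assms] B.s_class_carrier[OF dual.shift_B_assms] by blast+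
  have "\<rho> w \<otimes>\<^bsub>Bir I\<^esub> \<rho>t wt = \<rho>t wt \<otimes>\<^bsub>Bir I\<^esub> \<rho> w"
    if "w \<in> carrier (ext_affine_sym_group n' m)" "wt \<in> carrier (ext_affine_sym_group n m')" for w wt
  proof (rule group.generate_commute[OF group_Bir[OF A.finite_index] sub generators_commute])
    show "\<rho> w \<in> generate (Bir I) ?gA" "\<rho>t wt \<in> generate (Bir I) ?gB"
      unfolding \<rho>(4)[symmetric] \<rho>t(4)[symmetric] using that by simp_all
  qed
  then show ?thesis using \<rho> \<rho>t by blast
qed

end

section \<open>The arrangements \<open>Q\<close> and \<open>Q~\<close>\<close>

text \<open>Among the periods of \<open>f\<close>, modulo \<open>(0, b * c)\<close>, taking
  \<open>c\<close> times the step \<open>(a, b * d)\<close> gives \<open>(a * c, 0)\<close>, and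
  \<open>e\<close> times gives \<open>(a * e, b)\<close> because \<open>d * e\<close> is 1 modulo
  \<open>c\<close>.\<close>

lemma torus_fun_flip:
  fixes a b c d e :: nat
  assumes f: "f \<in> torus_fun a (b * c) (int (b * d))" and de: "[d * e = 1] (mod c)"
  shows "flip k k' f \<in> torus_fun b (a * c) (int (a * e))"
proof -
  have vert: "f x (y + z * (int b * int c)) = f x y" for x y z
    using periodic_mult[of "f x" "int b * int c" y z] torus_funD(4)[OF f] by simp
  have horiz: "f (x + z * int a) (y + z * (int b * int d)) = f x y" for x y z
  proof -
    have "f (x + (i + 1) * int a) (y + (i + 1) * (int b * int d)) = f (x + i * int a) (y + i * (int b * int d))" for i
      using torus_funD(2)[OF f, of "x + i * int a" "y + i * (int b * int d)"] by (simp add: algebra_simps)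
    then show ?thesis using periodic_mult[of "\<lambda>z. f (x + z * int a) (y + z * (int b * int d))" 1 0 z] by simp
  qed
  obtain r where r: "int d * int e = 1 + r * int c"
  proof -
    have "[int (d * e) = int 1] (mod int c)" using de by (simp only: cong_int_iff)
    then have "int c dvd int d * int e - 1" by (simp add: cong_iff_dvd_diff)
    then show ?thesis using that by (metis dvd_def mult.commute add_diff_cancel_left' diff_add_cancel add.commute)
  qed
  have "f (k - (y + int (a * c))) (k' - x) = f (k - y) (k' - x)" for x y
    using horiz[of "k - (y + int (a * c))" "int c" "k' - x"] vert[of "k - y" "k' - x" "int d"]
    by (simp add: algebra_simps)
  moreover have "f (k - (y + int (a * e))) (k' - (x + int b)) = f (k - y) (k' - x)" for x y
  proof -
    have "k' - (x + int b) + int e * (int b * int d) = k' - x + int b * (int d * int e - 1)" by (simp add: algebra_simps)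
    also have "\<dots> = k' - x + r * (int b * int c)" unfolding r by simp
    finally show ?thesis
      using horiz[of "k - (y + int (a * e))" "int e" "k' - (x + int b)"] vert[of "k - y" "k' - x" r]
      by (simp add: algebra_simps)
  qed
  ultimately show ?thesis
    using f by (simp add: torus_fun_def pos_periodic_def flip_def)
qed

text \<open>The case \<open>c = 1\<close>, \<open>d = 0\<close> is included, with inverse 0.\<close>

lemma mod_inverse:
  assumes "d < c" "gcd c d = 1"
  shows "[d * mod_inverse c d = 1] (mod c)"
proof -
  have cop: "coprime d c" using assms(2) by (simp add: coprime_iff_gcd_eq_1 gcd.commute)
  obtain e where e: "[d * e = 1] (mod c)" using cong_solve_coprime_nat[OF cop] by auto
  have "mod_inverse c d < c \<and> [d * mod_inverse c d = 1] (mod c)"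
    unfolding mod_inverse_def
  proof (rule theI')
    show "\<exists>!e. e < c \<and> [d * e = 1] (mod c)"
    proof (rule ex1I)
      show "e mod c < c \<and> [d * (e mod c) = 1] (mod c)"
        using assms(1) e by (simp add: cong_def mod_mult_right_eq)
      fix e' assume e': "e' < c \<and> [d * e' = 1] (mod c)"
      then have "[d * e' = d * e] (mod c)" using e by (metis cong_sym cong_trans)
      then have "[e' = e] (mod c)" using cong_mult_lcancel_nat[OF cop] by simp
      then show "e' = e mod c" using e' by (simp add: cong_def)
    qed
  qed
  then show ?thesis by simp
qed

lemma eq_if_dvd_diff:
  fixes x y :: nat
  assumes "int n dvd int x - int y" "1 \<le> x" "x \<le> n" "1 \<le> y" "y \<le> n"
  shows "x = y"
proof -
  have "cyc n (int x) = cyc n (int y)" using assms by (subst cyc_cong) auto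
  then show ?thesis using assms by (simp add: cyc_id)
qed

lemma Q_arrangement:
  assumes "a > 0" "b > 0" "c > 0"
  shows "arrangement (indices a b c) (Q_pos b) a (b * c)"
proof
  have inj: "inj_on (Q_pos b) (indices a b c)"
  proof (rule inj_onI)
    fix s t assume "s \<in> indices a b c" "t \<in> indices a b c" and eq: "Q_pos b s = Q_pos b t"
    then obtain x y z x' y' z' where st: "s = (x, y, z)" "1 \<le> y" "y \<le> b" "1 \<le> z"
        "t = (x', y', z')" "1 \<le> y'" "y' \<le> b" "1 \<le> z'"
      by (auto simp: indices_def)
    then have "x = x'" and "y + b * (z - 1) = y' + b * (z' - 1)" using eq by (simp_all add: Q_pos_def)
    then have "int y + int b * int (z - 1) = int y' + int b * int (z' - 1)" by (metis of_nat_add of_nat_mult)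
    moreover have "int (z - 1) = int z - 1" "int (z' - 1) = int z' - 1" using st by (simp_all add: of_nat_diff)
    ultimately have yz: "int y - int y' = int b * (int z' - int z)" by (simp add: algebra_simps)
    then have "y = y'" using st by (intro eq_if_dvd_diff[of b]) simp_all
    moreover from this have "z = z'" using yz assms by simp
    ultimately show "s = t" using \<open>x = x'\<close> st by simp
  qed
  have "y + b * (z - 1) \<le> b * c" if "y \<le> b" "1 \<le> z" "z \<le> c" for y z
  proof -
    have "y + b * (z - 1) \<le> b * Suc (z - 1)" unfolding mult_Suc_right using that by (intro add_right_mono)
    also have "\<dots> \<le> b * c" using that by (intro mult_le_mono2) simp
    finally show ?thesis .
  qed
  then have "Q_pos b ` indices a b c \<subseteq> {1..a} \<times> {1..b * c}"
    by (auto simp: Q_pos_def indices_def)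
  moreover have "card (indices a b c) = card ({1..a} \<times> {1..b * c})"
    by (simp add: indices_def card_cartesian_product)
  ultimately show "bij_betw (Q_pos b) (indices a b c) ({1..a} \<times> {1..b * c})"
    using inj unfolding bij_betw_def by (metis card_image card_subset_eq finite_SigmaI finite_atLeastAtMost)
qed (use assms in simp_all)

text \<open>Injectivity and equal cardinalities. Modulo \<open>a\<close> the row recovers the first
  index; what is left is the third index times the inverse of \<open>d\<close> modulo
  \<open>c\<close>, and that inverse is a unit.\<close>

lemma Qt_arrangement:
  assumes pos: "a > 0" "b > 0" "c > 0" and d: "d < c" "gcd c d = 1"
  shows "arrangement (indices a b c) (Qt_pos a b c d) b (a * c)"
proof
  let ?e = "mod_inverse c d"
  have cop: "coprime (int c) (int ?e)"
  proof -
    have "[d * ?e = 1] (mod c)" by (rule mod_inverse[OF d])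
    then have "coprime (d * ?e) c" by (metis coprime_1_left cong_imp_coprime cong_sym)
    then show ?thesis by (simp add: coprime_commute)
  qed
  have inj: "inj_on (Qt_pos a b c d) (indices a b c)"
  proof (rule inj_onI)
    fix s t assume s: "s \<in> indices a b c" and t: "t \<in> indices a b c" and eq: "Qt_pos a b c d s = Qt_pos a b c d t"
    obtain x y z where s': "s = (x, y, z)" "1 \<le> x" "x \<le> a" "1 \<le> y" "y \<le> b" "1 \<le> z" "z \<le> c"
      using s by (auto simp: indices_def)
    obtain x' y' z' where t': "t = (x', y', z')" "1 \<le> x'" "x' \<le> a" "1 \<le> y'" "y' \<le> b" "1 \<le> z'" "z' \<le> c"
      using t by (auto simp: indices_def)
    have "b + 1 - y = b + 1 - y'" using eq by (simp add: s'(1) t'(1) Qt_pos_def)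
    then have y: "y = y'" using s' t' by linarith
    have "cyc (a * c) (int (a * ?e * z) - int x + 1) = cyc (a * c) (int (a * ?e * z') - int x' + 1)"
      using eq by (simp add: s'(1) t'(1) Qt_pos_def)
    then have "int (a * c) dvd (int (a * ?e * z) - int x + 1) - (int (a * ?e * z') - int x' + 1)"
      using pos by (subst (asm) cyc_cong) simp_all
    also have "(int (a * ?e * z) - int x + 1) - (int (a * ?e * z') - int x' + 1) =
        int a * (int ?e * (int z - int z')) - (int x - int x')" by (simp add: algebra_simps)
    finally have D: "int a * int c dvd int a * (int ?e * (int z - int z')) - (int x - int x')" by simp
    then have "int a dvd int a * (int ?e * (int z - int z')) - (int x - int x')" by (rule dvd_mult_left)
    then have "int a dvd int x - int x'" by (simp add: dvd_diff_right_iff)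
    then have x: "x = x'" using s' t' by (intro eq_if_dvd_diff[of a])
    then have "int c dvd int ?e * (int z - int z')" using D pos by simp
    then have "int c dvd int z - int z'" using cop by (simp add: coprime_dvd_mult_right_iff)
    then have "z = z'" using s' t' by (intro eq_if_dvd_diff[of c])
    then show "s = t" using x y s'(1) t'(1) by simp
  qed
  moreover have "Qt_pos a b c d ` indices a b c \<subseteq> {1..b} \<times> {1..a * c}"
    using pos cyc_range[of "a * c"] by (auto simp: Qt_pos_def indices_def)
  moreover have "card (indices a b c) = card ({1..b} \<times> {1..a * c})"
    by (simp add: indices_def card_cartesian_product mult.left_commute mult.commute)
  ultimately show "bij_betw (Qt_pos a b c d) (indices a b c) ({1..b} \<times> {1..a * c})"
    unfolding bij_betw_def by (metis card_image card_subset_eq finite_SigmaI finite_atLeastAtMost)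
qed (use pos in simp_all)

text \<open>The offsets of \<open>flip\<close> are read off at third index 1:
  \<open>(x, y, 1)\<close> has column \<open>x\<close> and row \<open>y\<close> in \<open>Q\<close>,
  but column \<open>b + 1 - y\<close> and, modulo \<open>a * c\<close>, row
  \<open>a * mod_inverse c d - x + 1\<close> in \<open>Q~\<close>.\<close>

lemma Q_Qt_dual:
  assumes pos: "a > 0" "b > 0" "c > 0" and d: "d < c" "gcd c d = 1"
  shows "dual_arrangements (indices a b c) (Q_pos b) a (b * c) (int (b * d))
    (Qt_pos a b c d) b (a * c) (int (a * mod_inverse c d)) (1 + int (a * mod_inverse c d)) (int b + 1)"
proof -
  let ?e = "mod_inverse c d"
  let ?k = "1 + int (a * ?e)" and ?k' = "int b + 1"
  interpret A: arrangement "indices a b c" "Q_pos b" a "b * c" "int (b * d)" by (rule Q_arrangement[OF pos])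
  interpret B: arrangement "indices a b c" "Qt_pos a b c d" b "a * c" "int (a * ?e)" by (rule Qt_arrangement[OF pos d])
  have inverse: "[d * ?e = 1] (mod c)" by (rule mod_inverse[OF d])
  have index: "B.index_at \<alpha> \<beta> = A.index_at (?k - \<beta>) (?k' - \<alpha>)" for \<alpha> \<beta>
  proof (rule B.index_at_eqI)
    let ?x = "?k - \<beta>" and ?y = "?k' - \<alpha>"
    let ?q = "(?x - 1) div int a" and ?w = "(\<alpha> - 1) div int b"
    show "A.index_at ?x ?y \<in> indices a b c" by (rule A.index_at_in)
    then obtain x y z where t: "A.index_at ?x ?y = (x, y, z)" "1 \<le> x" "x \<le> a" "1 \<le> y" "y \<le> b" "1 \<le> z" "z \<le> c"
      by (auto simp: indices_def)
    have "Q_pos b (x, y, z) = (cyc a ?x, cyc (b * c) (?y - int (b * d) * ?q))"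
      using A.pos_index_at[of ?x ?y] unfolding t(1) .
    then have P: "x = cyc a ?x" "y + b * (z - 1) = cyc (b * c) (?y - int (b * d) * ?q)"
      by (simp_all only: Q_pos_def prod.case prod.inject)
    have x: "int x = ?x - int a * ?q"
      unfolding P(1) int_cyc[OF pos(1)] by (simp add: minus_mult_div_eq_mod[symmetric])
    have "int y + int b * (int z - 1) = int (cyc (b * c) (?y - int (b * d) * ?q))"
      unfolding P(2)[symmetric] using t by (simp add: of_nat_diff)
    then have "cyc (b * c) (int y + int b * (int z - 1)) =
        cyc (b * c) (int (cyc (b * c) (?y - int (b * d) * ?q)) + 0)" by (simp only: add_0_right)
    also have "\<dots> = cyc (b * c) (?y - int (b * d) * ?q + 0)" by (rule cyc_cyc_add) (use pos in simp)
    finally have "cyc (b * c) (int y + int b * (int z - 1)) = cyc (b * c) (?y - int (b * d) * ?q)"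
      by (simp only: add_0_right)
    then have D: "int b * int c dvd int y + int b * (int z - 1) - (?y - int (b * d) * ?q)"
      using pos by (subst (asm) cyc_cong) simp_all
    then have "int b dvd int y + int b * (int z - 1) - (?y - int (b * d) * ?q)" by (rule dvd_mult_left)
    moreover have "int y + int b * (int z - 1) - (?y - int (b * d) * ?q) =
        int b * (int z - 1 + int d * ?q) + (int y - ?y)" by (simp add: algebra_simps)
    ultimately have "int b dvd int b * (int z - 1 + int d * ?q) + (int y - ?y)" by (simp only:)
    then have "int b dvd int y - ?y" by (simp only: dvd_add_right_iff[OF dvd_triv_left])
    moreover have "int y - ?y = - (?k' - int y - \<alpha>)" by simp
    ultimately have "int b dvd ?k' - int y - \<alpha>" by (simp only: dvd_minus_iff)
    then have "cyc b (?k' - int y) = cyc b \<alpha>" using cyc_cong[OF pos(2)] by blast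
    moreover have k'y: "?k' - int y = int (b + 1 - y)" using t by simp
    moreover have "cyc b (int (b + 1 - y)) = b + 1 - y" using t by (intro cyc_id) auto
    ultimately have col: "b + 1 - y = cyc b \<alpha>" by simp
    then show "fst (Qt_pos a b c d (A.index_at ?x ?y)) = cyc b \<alpha>"
      by (simp only: t(1) Qt_pos_def prod.case fst_conv)
    have "?k' - int y = \<alpha> - int b * ?w"
      unfolding k'y col int_cyc[OF pos(2)] by (simp add: minus_mult_div_eq_mod[symmetric])
    then have y: "?y = int y - int b * ?w" by simp
    have "int y + int b * (int z - 1) - (?y - int (b * d) * ?q) = int b * (int z - 1 + ?w + int d * ?q)"
      unfolding y by (simp add: algebra_simps)
    then have "int c dvd int z - 1 + ?w + int d * ?q" using D pos by simp
    \<comment> \<open>The row in \<open>Q\<close> controls \<open>z - 1 + ?w + d * ?q\<close> modulo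
      \<open>c\<close>; multiplication by the inverse of \<open>d\<close> frees \<open>?q\<close>
      and gives the congruence required of the row in \<open>Q~\<close>.\<close>
    then have 1: "int c dvd int ?e * (int z - 1 + ?w + int d * ?q)" by simp
    have "int c dvd int d * int ?e - 1"
      using inverse cong_int_iff[of "d * ?e" 1 c] by (simp add: cong_iff_dvd_diff)
    then have "int c dvd (int d * int ?e - 1) * ?q" by simp
    from dvd_diff[OF 1 this] have "int c dvd int ?e * (int z - 1 + ?w) + ?q" by (simp add: algebra_simps)
    then have "int a * int c dvd int a * (int ?e * (int z - 1 + ?w) + ?q)" by simp
    moreover have "(int (a * ?e * z) - int x + 1) - (\<beta> - int (a * ?e) * ?w) =
        int a * (int ?e * (int z - 1 + ?w) + ?q)"
      unfolding x by (simp add: algebra_simps)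
    ultimately have "int (a * c) dvd (int (a * ?e * z) - int x + 1) - (\<beta> - int (a * ?e) * ?w)" by simp
    then have "cyc (a * c) (int (a * ?e * z) - int x + 1) = cyc (a * c) (\<beta> - int (a * ?e) * ?w)"
      using cyc_cong[of "a * c"] pos by simp
    then show "snd (Qt_pos a b c d (A.index_at ?x ?y)) = cyc (a * c) (\<beta> - int (a * ?e) * ?w)"
      by (simp only: t(1) Qt_pos_def prod.case snd_conv)
  qed
  show ?thesis
  proof (intro dual_arrangements.intro dual_arrangements_axioms.intro A.arrangement_axioms B.arrangement_axioms)
    show "B.lift q = flip ?k ?k' (A.lift q)" for q
      by (intro ext) (simp only: B.lift_def A.lift_def flip_def index)
    show "g \<in> torus_fun a (b * c) (int (b * d)) \<longleftrightarrow> flip ?k ?k' g \<in> torus_fun b (a * c) (int (a * ?e))" for g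
    proof
      assume "g \<in> torus_fun a (b * c) (int (b * d))"
      then show "flip ?k ?k' g \<in> torus_fun b (a * c) (int (a * ?e))" by (rule torus_fun_flip[OF _ inverse])
    next
      assume "flip ?k ?k' g \<in> torus_fun b (a * c) (int (a * ?e))"
      then have "flip ?k' ?k (flip ?k ?k' g) \<in> torus_fun a (b * c) (int (b * d))"
        using inverse by (intro torus_fun_flip[of _ b a c ?e d]) (simp_all add: mult.commute)
      then show "g \<in> torus_fun a (b * c) (int (b * d))" by simp
    qed
  qed simp_all
qed

theorem theorem2p4:
  fixes \<aa> \<bb> \<cc> \<dd> :: nat
  assumes "\<aa> > 0" and "\<bb> > 0" and "\<cc> > 0" and "\<dd> < \<cc>" and "gcd \<cc> \<dd> = 1"
  shows "let
      G = Bir (indices \<aa> \<bb> \<cc>);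
      \<pi> = op_pi \<aa> \<bb> \<cc> \<dd>;
      \<pi>t = op_pit \<aa> \<bb> \<cc>;
      s = cyclic_family G \<aa> (op_s \<aa> \<bb> \<cc>) \<pi>;
      st = cyclic_family G \<bb> (op_st \<aa> \<bb> \<cc> \<dd>) \<pi>t;
      W = ext_affine_sym_group (\<aa> * \<cc>) \<aa>;
      Wt = ext_affine_sym_group (\<bb> * \<cc>) \<bb>
    in
      \<comment> \<open>the operators are birational\<close>
      (\<forall>l\<in>{1..<\<aa>}. op_s \<aa> \<bb> \<cc> l \<in> carrier G) \<and> \<pi> \<in> carrier G \<and>
      (\<forall>l\<in>{1..<\<bb>}. op_st \<aa> \<bb> \<cc> \<dd> l \<in> carrier G) \<and> \<pi>t \<in> carrier G \<and>
      \<comment> \<open>they generate two commuting actions\<close>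
      (\<exists>\<rho> \<rho>t.
         group_hom W G \<rho> \<and> group_hom Wt G \<rho>t \<and>
         (\<forall>l\<in>{1..<\<aa>}. \<rho> (W_s (\<aa> * \<cc>) \<aa> l) = op_s \<aa> \<bb> \<cc> l) \<and>
         \<rho> (W_pi (\<aa> * \<cc>) \<aa>) = \<pi> \<and>
         \<rho> ` carrier W = generate G (insert \<pi> (op_s \<aa> \<bb> \<cc> ` {1..<\<aa>})) \<and>
         (\<forall>l\<in>{1..<\<bb>}. \<rho>t (W_s (\<bb> * \<cc>) \<bb> l) = op_st \<aa> \<bb> \<cc> \<dd> l) \<and>
         \<rho>t (W_pi (\<bb> * \<cc>) \<bb>) = \<pi>t \<and>
         \<rho>t ` carrier Wt = generate G (insert \<pi>t (op_st \<aa> \<bb> \<cc> \<dd> ` {1..<\<bb>})) \<and>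
         (\<forall>w\<in>carrier W. \<forall>wt\<in>carrier Wt. \<rho> w \<otimes>\<^bsub>G\<^esub> \<rho>t wt = \<rho>t wt \<otimes>\<^bsub>G\<^esub> \<rho> w)) \<and>
      \<comment> \<open>(1)\<close>
      (\<aa> \<ge> 3 \<longrightarrow> (\<forall>l. s l \<otimes>\<^bsub>G\<^esub> s (l + 1) \<otimes>\<^bsub>G\<^esub> s l = s (l + 1) \<otimes>\<^bsub>G\<^esub> s l \<otimes>\<^bsub>G\<^esub> s (l + 1))) \<and>
      (\<aa> \<ge> 2 \<longrightarrow>
         (\<forall>j l. \<not> [j = l] (mod \<aa>) \<and> \<not> cyc_adjacent \<aa> j l \<longrightarrow> s j \<otimes>\<^bsub>G\<^esub> s l = s l \<otimes>\<^bsub>G\<^esub> s j) \<and>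
         (\<forall>l. s l \<otimes>\<^bsub>G\<^esub> s l = \<one>\<^bsub>G\<^esub>) \<and>
         (\<forall>l. \<pi> \<otimes>\<^bsub>G\<^esub> s (l + 1) = s l \<otimes>\<^bsub>G\<^esub> \<pi>)) \<and>
      \<pi> [^]\<^bsub>G\<^esub> (\<aa> * \<cc>) = \<one>\<^bsub>G\<^esub> \<and>
      \<comment> \<open>(2)\<close>
      (\<bb> \<ge> 3 \<longrightarrow> (\<forall>l. st l \<otimes>\<^bsub>G\<^esub> st (l + 1) \<otimes>\<^bsub>G\<^esub> st l = st (l + 1) \<otimes>\<^bsub>G\<^esub> st l \<otimes>\<^bsub>G\<^esub> st (l + 1))) \<and>
      (\<bb> \<ge> 2 \<longrightarrow>
         (\<forall>j l. \<not> [j = l] (mod \<bb>) \<and> \<not> cyc_adjacent \<bb> j l \<longrightarrow> st j \<otimes>\<^bsub>G\<^esub> st l = st l \<otimes>\<^bsub>G\<^esub> st j) \<and>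
         (\<forall>l. st l \<otimes>\<^bsub>G\<^esub> st l = \<one>\<^bsub>G\<^esub>) \<and>
         (\<forall>l. \<pi>t \<otimes>\<^bsub>G\<^esub> st (l + 1) = st l \<otimes>\<^bsub>G\<^esub> \<pi>t)) \<and>
      \<pi>t [^]\<^bsub>G\<^esub> (\<bb> * \<cc>) = \<one>\<^bsub>G\<^esub> \<and>
      \<comment> \<open>(3)\<close>
      (\<aa> \<ge> 2 \<and> \<bb> \<ge> 2 \<longrightarrow> (\<forall>j l. s j \<otimes>\<^bsub>G\<^esub> st l = st l \<otimes>\<^bsub>G\<^esub> s j)) \<and>
      (\<aa> \<ge> 2 \<longrightarrow> (\<forall>l. \<pi>t \<otimes>\<^bsub>G\<^esub> s l = s l \<otimes>\<^bsub>G\<^esub> \<pi>t)) \<and>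
      (\<bb> \<ge> 2 \<longrightarrow> (\<forall>l. \<pi> \<otimes>\<^bsub>G\<^esub> st l = st l \<otimes>\<^bsub>G\<^esub> \<pi>)) \<and>
      \<pi>t \<otimes>\<^bsub>G\<^esub> \<pi> = \<pi> \<otimes>\<^bsub>G\<^esub> \<pi>t"
proof -
  interpret D: dual_arrangements "indices \<aa> \<bb> \<cc>" "Q_pos \<bb>" \<aa> "\<bb> * \<cc>" "int (\<bb> * \<dd>)"
    "Qt_pos \<aa> \<bb> \<cc> \<dd>" \<bb> "\<aa> * \<cc>" "int (\<aa> * mod_inverse \<cc> \<dd>)" "1 + int (\<aa> * mod_inverse \<cc> \<dd>)" "int \<bb> + 1"
    by (rule Q_Qt_dual[OF assms])
  have op: "op_s \<aa> \<bb> \<cc> = D.A.s_class" "op_st \<aa> \<bb> \<cc> \<dd> = D.B.s_class"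
    "op_pi \<aa> \<bb> \<cc> \<dd> = D.shift_B" "op_pit \<aa> \<bb> \<cc> = D.shift_A"
    by (simp_all add: fun_eq_iff op_s_def op_st_def op_pi_def op_pit_def D.A.s_class_def D.B.s_class_def
        D.shift_A_def D.shift_B_def)
  note a = D.shift_B_assms and b = D.dual.shift_B_assms
  show ?thesis
    unfolding Let_def op
  proof (intro conjI impI allI)
    show "\<forall>l\<in>{1..<\<aa>}. D.A.s_class l \<in> carrier (Bir (indices \<aa> \<bb> \<cc>))"
      using D.A.s_class_carrier[OF a] by blast
    show "\<forall>l\<in>{1..<\<bb>}. D.B.s_class l \<in> carrier (Bir (indices \<aa> \<bb> \<cc>))"
      using D.B.s_class_carrier[OF b] by blast
    show "D.s j \<otimes>\<^bsub>Bir (indices \<aa> \<bb> \<cc>)\<^esub> D.s l = D.s l \<otimes>\<^bsub>Bir (indices \<aa> \<bb> \<cc>)\<^esub> D.s j"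
      if "\<aa> \<ge> 2" "\<not> [j = l] (mod \<aa>) \<and> \<not> cyc_adjacent \<aa> j l" for j l
      using D.A.s_cyclic_far[OF a] that by blast
    show "D.st j \<otimes>\<^bsub>Bir (indices \<aa> \<bb> \<cc>)\<^esub> D.st l = D.st l \<otimes>\<^bsub>Bir (indices \<aa> \<bb> \<cc>)\<^esub> D.st j"
      if "\<bb> \<ge> 2" "\<not> [j = l] (mod \<bb>) \<and> \<not> cyc_adjacent \<bb> j l" for j l
      using D.B.s_cyclic_far[OF b] that by blast
  qed (use D.A.P_carrier[OF a] D.A.P_pow_N[OF a] D.A.s_cyclic_braid[OF a]
      D.A.s_cyclic_square[OF a] D.A.s_cyclic_rotate[OF a]
      D.B.P_carrier[OF b] D.B.P_pow_N[OF b] D.B.s_cyclic_braid[OF b]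
      D.B.s_cyclic_square[OF b] D.B.s_cyclic_rotate[OF b]
      D.commuting_actions D.s_st D.shift_A_s D.dual.shift_A_s D.shifts_commute in \<open>simp_all\<close>)
qed

end
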